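(* The satisfiability problem for $\mathrm{PL}[\perp_{\mathrm c},\subseteq,\sim]$ belongs to $\mathrm{AEXPTIME(poly)}$.
   Context: An assignment is a function $s:D\to\{0,1\}$ for a finite set $D$ of proposition symbols. A team is a set of assignments with common domain. We write $s(\bar p)$ for the tuple of values of $s$ on a tuple $\bar p$ of symbols. Formulas of $\mathrm{PL}[\perp_{\mathrm c},\subseteq,\sim]$ are built by $\varphi::=p\mid\neg p\mid \bar q\perp_{\bar p}\bar r\mid \bar p\subseteq\bar q\mid\varphi\wedge\varphi\mid\varphi\vee\varphi\mid\sim\varphi$. Team semantics is defined as follows. - $X\models p$ iff all $s\in X$ have $s(p)=1$. - $X\models\neg p$ iff all $s\in X$ have $s(p)=0$. - $\wedge$ is interpreted conjunctively. - $X\models\varphi\vee\psi$ iff $X=Y\cup Z$ with $Y\models\varphi$ and $Z\models\psi$. - $X\models\sim\varphi$ iff $X\not\models\varphi$. - $X\models\bar q\perp_{\bar p}\bar r$ iff for all $s,t\in X$ with $s(\bar p)=t(\bar p)$ there is $u\in X$ with $u(\bar p\bar q)=s(\bar p\bar q)$ and $u(\bar r)=t(\bar r)$. - $X\models\bar p\subseteq\bar q$ (equal-length tuples) iff for every $s\in X$ there is $t\in X$ with $s(\bar p)=t(\bar q)$. A formula is satisfiable if some non-empty team satisfies it. $\mathrm{AEXPTIME(poly)}$ is the class of problems decidable by an alternating Turing machine in time $2^{p(n)}$ with at most $q(n)$ alternations, for polynomials $p,q$. *)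

theory Defs
  imports Main
begin

datatype fml =
    Atom nat
  | NegAtom nat
  | CondIndep "nat list" "nat list" "nat list"   (* CondIndep q p r  is  q \<perp>_p r *)
  | Incl "nat list" "nat list"
  | Conj fml fml
  | Disj fml fml
  | Tilde fml

fun vars :: "fml \<Rightarrow> nat set" where
  "vars (Atom p) = {p}"
| "vars (NegAtom p) = {p}"
| "vars (CondIndep q p r) = set q \<union> set p \<union> set r"
| "vars (Incl p q) = set p \<union> set q"
| "vars (Conj a b) = vars a \<union> vars b"
| "vars (Disj a b) = vars a \<union> vars b"
| "vars (Tilde a) = vars a"

fun wf_fml :: "fml \<Rightarrow> bool" where
  "wf_fml (Incl p q) = (length p = length q)"
| "wf_fml (Conj a b) = (wf_fml a \<and> wf_fml b)"
| "wf_fml (Disj a b) = (wf_fml a \<and> wf_fml b)"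
| "wf_fml (Tilde a) = wf_fml a"
| "wf_fml _ = True"

primrec tsat :: "(nat \<Rightarrow> bool) set \<Rightarrow> fml \<Rightarrow> bool" where
  "tsat X (Atom p) = (\<forall>s\<in>X. s p)"
| "tsat X (NegAtom p) = (\<forall>s\<in>X. \<not> s p)"
| "tsat X (CondIndep q p r) =
     (\<forall>s\<in>X. \<forall>t\<in>X. map s p = map t p \<longrightarrow>
        (\<exists>u\<in>X. map u (p @ q) = map s (p @ q) \<and> map u r = map t r))"
| "tsat X (Incl p q) = (\<forall>s\<in>X. \<exists>t\<in>X. map s p = map t q)"
| "tsat X (Conj a b) = (tsat X a \<and> tsat X b)"
| "tsat X (Disj a b) = (\<exists>Y Z. X = Y \<union> Z \<and> tsat Y a \<and> tsat Z b)"
| "tsat X (Tilde a) = (\<not> tsat X a)"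

text \<open>Assignments with (finite) domain D: values outside D are fixed to False,
  so that the team is a set of assignments with common domain D.\<close>
definition team_on :: "nat set \<Rightarrow> (nat \<Rightarrow> bool) set \<Rightarrow> bool" where
  "team_on D X \<longleftrightarrow> (\<forall>s\<in>X. \<forall>x. x \<notin> D \<longrightarrow> \<not> s x)"

definition satisfiable :: "fml \<Rightarrow> bool" where
  "satisfiable \<phi> \<longleftrightarrow>
     (\<exists>D X. finite D \<and> vars \<phi> \<subseteq> D \<and> team_on D X \<and> X \<noteq> {} \<and> tsat X \<phi>)"

datatype sym = SP | SNP | SCI | SInc | SAnd | SOr | STil | SB0 | SB1 | SSep

fun bits :: "nat \<Rightarrow> sym list" where
  "bits n = (if n < 2 then [if n = 0 then SB0 else SB1]
             else bits (n div 2) @ [if n mod 2 = 0 then SB0 else SB1])"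

definition enc_nat :: "nat \<Rightarrow> sym list" where
  "enc_nat n = bits n @ [SSep]"

definition enc_tuple :: "nat list \<Rightarrow> sym list" where
  "enc_tuple xs = concat (map enc_nat xs) @ [SSep]"

primrec enc :: "fml \<Rightarrow> sym list" where
  "enc (Atom p) = SP # enc_nat p"
| "enc (NegAtom p) = SNP # enc_nat p"
| "enc (CondIndep q p r) = SCI # enc_tuple q @ enc_tuple p @ enc_tuple r"
| "enc (Incl p q) = SInc # enc_tuple p @ enc_tuple q"
| "enc (Conj a b) = SAnd # enc a @ enc b"
| "enc (Disj a b) = SOr # enc a @ enc b"
| "enc (Tilde a) = STil # enc a"

definition SAT_lang :: "sym list set" where
  "SAT_lang = {enc \<phi> | \<phi>. wf_fml \<phi> \<and> satisfiable \<phi>}"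

datatype kind = Exist | Univ | Accept | Reject
datatype dir = Left | Right | Stay

record atm =
  states :: "nat set"
  tape_alph :: "nat set"
  start :: nat
  blank :: nat
  input :: "sym \<Rightarrow> nat"
  kind_of :: "nat \<Rightarrow> kind"
  delta :: "nat \<Rightarrow> nat \<Rightarrow> (nat \<times> nat \<times> dir) set"

definition wf_atm :: "atm \<Rightarrow> bool" where
  "wf_atm M \<longleftrightarrow> finite (states M) \<and> finite (tape_alph M) \<and>
     start M \<in> states M \<and> blank M \<in> tape_alph M \<and>
     (\<forall>a. input M a \<in> tape_alph M \<and> input M a \<noteq> blank M) \<and>
     (\<forall>q\<in>states M. \<forall>g\<in>tape_alph M. delta M q g \<subseteq> states M \<times> tape_alph M \<times> UNIV)"

text \<open>Configuration: state, tape contents, head position.\<close>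
type_synonym config = "nat \<times> (int \<Rightarrow> nat) \<times> int"

fun mv :: "dir \<Rightarrow> int" where
  "mv Left = -1" | "mv Right = 1" | "mv Stay = 0"

definition init_conf :: "atm \<Rightarrow> sym list \<Rightarrow> config" where
  "init_conf M w = (start M,
     (\<lambda>i. if 0 \<le> i \<and> i < int (length w) then input M (w ! nat i) else blank M), 0)"

fun succs :: "atm \<Rightarrow> config \<Rightarrow> config set" where
  "succs M (q, tp, h) =
     {(q', tp(h := g'), h + mv d) | q' g' d. (q', g', d) \<in> delta M q (tp h)}"

definition halting :: "atm \<Rightarrow> config \<Rightarrow> bool" where
  "halting M c \<longleftrightarrow> kind_of M (fst c) \<in> {Accept, Reject}"

definition alternation :: "atm \<Rightarrow> config \<Rightarrow> config \<Rightarrow> bool" where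
  "alternation M c c' \<longleftrightarrow>
     kind_of M (fst c) \<in> {Exist, Univ} \<and> kind_of M (fst c') \<in> {Exist, Univ} \<and>
     kind_of M (fst c') \<noteq> kind_of M (fst c)"

fun bounded :: "atm \<Rightarrow> nat \<Rightarrow> nat \<Rightarrow> config \<Rightarrow> bool" where
  "bounded M 0 a c = halting M c"
| "bounded M (Suc t) a c = (halting M c \<or>
     (\<forall>c'\<in>succs M c. if alternation M c c'
                       then a > 0 \<and> bounded M t (a - 1) c'
                       else bounded M t a c'))"

fun accepts :: "atm \<Rightarrow> nat \<Rightarrow> config \<Rightarrow> bool" where
  "accepts M 0 c = (kind_of M (fst c) = Accept)"
| "accepts M (Suc t) c = (case kind_of M (fst c) of
     Accept \<Rightarrow> True
   | Reject \<Rightarrow> False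
   | Exist \<Rightarrow> (\<exists>c'\<in>succs M c. accepts M t c')
   | Univ \<Rightarrow> (\<forall>c'\<in>succs M c. accepts M t c'))"

text \<open>AEXPTIME(poly): decidable by an ATM in time 2^p(n) with at most q(n)
  alternations, p, q polynomials (bounded by c*n^k + c).\<close>
definition AEXPTIME_poly :: "sym list set \<Rightarrow> bool" where
  "AEXPTIME_poly L \<longleftrightarrow>
     (\<exists>M c k. wf_atm M \<and>
        (\<forall>w. bounded M (2 ^ (c * length w ^ k + c)) (c * length w ^ k + c) (init_conf M w) \<and>
             (w \<in> L \<longleftrightarrow> accepts M (2 ^ (c * length w ^ k + c)) (init_conf M w))))"

end

theory Submission
  imports Defs
begin

text \<open>
A team is a set of row numbers below some L that is at least 2 to the power of the input length,
stored as one flag per cell; the bits of a row number give the values of the propositions. The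
players evaluate the formula along one branch: the player who claims that the current subformula
holds guesses where its first argument ends and, for a disjunction, how the team splits; the
opponent selects an argument, or challenges the guess, which starts the same game without a team for
the claim that a part of the input encodes a formula. A negation swaps the roles, and an atom is a
first-order statement about positions and row numbers, whose quantifiers are choices. One branch
has at most one round per input symbol, hence few alternations.

The machine is programmed in a small language with bounded loops whose variables are pointers into
the tape, that is, marks on the cells, and serve as counters up to L at the same time. An increment
costs one scan of the tape. Since no pointer passes the end mark L, the running time is polynomial
in L.
\<close>

section \<open>The machine\<close>

text \<open>The bounds on time and alternations must hold on every branch and every input, also on
  words that encode no formula. So loops are limited by marks on the tape rather than by the course
  of the game, and the text of the program shows how often the players alternate: only
  \<open>Mode\<close> changes the player, and a loop that contains it must be counted by the input
  length. Following one branch avoids a stack of subteams, but the end of a subformula is then only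
  guessed; the challenge settles this because the code is prefix-free, so that exactly one guess is
  right. Rows below 2 to the power of the input length suffice for two reasons: truth depends only
  on the propositions of the formula, and each of these has a token at some position of the input,
  so bits indexed by positions can give them any values. The end mark is n + 1 doubled n times and
  thus exceeds the input length n as well. Since a negation flips the polarity of the claim, the
  statements about the game compare the value for the existential player with the polarity, and both
  polarities share one proof.\<close>

text \<open>\<open>Pn\<close>, \<open>PE\<close> and \<open>PZ\<close> stand for the input length,
  the end mark L and the constant 0. \<open>PI\<close>, \<open>PJ\<close> and \<open>PM\<close> are
  the start, the end and the guessed inner boundary of the current subformula; \<open>Ppol\<close>
  is the polarity, and \<open>Pph\<close> tells whether a challenge is on. \<open>PS\<close>,
  \<open>PT\<close>, \<open>PU\<close> range over rows, \<open>PK\<close> over indices of tuples;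
  \<open>PX\<close>, \<open>PY\<close>, \<open>PW\<close> locate the arguments of an atom,
  \<open>PA\<close> and \<open>PB\<close> walk through tuples, \<open>PC\<close> is a candidate
  token position. The rest are loop counters, temporaries and flags.\<close>

datatype ptr = Pn | PE | PZ | PI | PJ | PM | Ppol | Pph | Pit | Pix | PS | PT | PU | PK
  | PX | PY | PW | PA | PB | PC | Pl1 | Pl2 | Pl3 | Pl4 | Pt1 | Pt2 | Pt3 | Pok | Pdone | Pbad

text \<open>\<open>LE\<close> is the left end. The components of \<open>Cell\<close> are the input
  symbol, membership of the row in the current team, its membership in the right part of a split,
  and the pointers at this position.\<close>

datatype cell = LE | Cell "sym option" bool bool "ptr set"

fun marked :: "ptr \<Rightarrow> cell \<Rightarrow> bool" where
  "marked p LE = False"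
| "marked p (Cell a f g M) = (p \<in> M)"

fun mark :: "ptr set \<Rightarrow> cell \<Rightarrow> cell" where
  "mark ps LE = LE"
| "mark ps (Cell a f g M) = Cell a f g (M \<union> ps)"

fun unmark :: "ptr \<Rightarrow> cell \<Rightarrow> cell" where
  "unmark p LE = LE"
| "unmark p (Cell a f g M) = Cell a f g (M - {p})"

fun wrcell :: "bool \<Rightarrow> bool \<Rightarrow> cell \<Rightarrow> cell" where
  "wrcell f g LE = LE"
| "wrcell f g (Cell a f' g' M) = Cell a f g M"

fun symc :: "cell \<Rightarrow> sym option" where
  "symc LE = None"
| "symc (Cell a f g M) = a"

text \<open>\<open>Loop\<close> is the run-time form of \<open>For\<close> after the counter has
  been reset; programs are written with \<open>For\<close> only. \<open>Mode\<close> fixes who makes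
  the choices from then on.\<close>

datatype com = Skip | Seq com com (infixr ";;" 60) | Zero ptr | Inc ptr | Wr ptr bool bool
  | Cond ptr "cell \<Rightarrow> bool" com com | Choice com com | Mode bool | Halt bool
  | For ptr ptr com | Loop ptr ptr com

type_synonym astate = "bool \<times> nat \<times> com list"
type_synonym acfg = "astate \<times> (int \<Rightarrow> cell) \<times> int"

text \<open>An empty continuation rejects, so a program that ends without \<open>Halt\<close> is
  lost for the existential player.\<close>

fun kindA :: "astate \<Rightarrow> kind" where
  "kindA (m, ph, k) = (if 4 \<le> ph then Exist else case k of [] \<Rightarrow> Reject
     | c # k' \<Rightarrow> (case c of Halt v \<Rightarrow> (if v then Accept else Reject)
        | _ \<Rightarrow> (if m then Exist else Univ)))"

text \<open>Every command starts and ends at the left end in phase 0. Phase 1 searches the mark to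
  the right and the later phases return. \<open>Cond\<close> remembers the outcome of its test by
  returning in phase 2 or in phase 3; in \<open>Zero\<close> and \<open>Inc\<close>, phase 3 puts
  the mark down at its new place.\<close>

fun dl :: "com \<Rightarrow> bool \<Rightarrow> nat \<Rightarrow> com list \<Rightarrow> cell \<Rightarrow> (astate \<times> cell \<times> dir) set" where
  "dl Skip m ph k x = {((m,0,k),x,Stay)}"
| "dl (a ;; b) m ph k x = {((m,0,a # b # k),x,Stay)}"
| "dl (Mode m') m ph k x = {((m',0,k),x,Stay)}"
| "dl (Choice a b) m ph k x = {((m,0,a # k),x,Stay), ((m,0,b # k),x,Stay)}"
| "dl (Halt v) m ph k x = {}"
| "dl (For i y b) m ph k x = {((m,0,Zero i # Loop i y b # k),x,Stay)}"
| "dl (Loop i y b) m ph k x =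
     {((m,0,Cond i (marked y) Skip (b ;; Inc i ;; Loop i y b) # k),x,Stay)}"
| "dl (Zero p) m ph k x =
    (if ph = 0 then {((m,1,Zero p # k),x,Right)}
     else if ph = 1 then
       (if marked p x then {((m,2,Zero p # k),unmark p x,Left)} else {((m,1,Zero p # k),x,Right)})
     else if ph = 2 then
       (if x = LE then {((m,3,Zero p # k),x,Right)} else {((m,2,Zero p # k),x,Left)})
     else {((m,0,k),mark {p} x,Left)})"
| "dl (Inc p) m ph k x =
    (if ph = 0 then {((m,1,Inc p # k),x,Right)}
     else if ph = 1 then
       (if marked p x then
          (if p \<noteq> PE \<and> marked PE x then {((m,2,Inc p # k),x,Left)}
           else {((m,3,Inc p # k),unmark p x,Right)})
        else {((m,1,Inc p # k),x,Right)})
     else if ph = 2 then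
       (if x = LE then {((m,0,k),x,Stay)} else {((m,2,Inc p # k),x,Left)})
     else {((m,2,Inc p # k),mark {p} x,Left)})"
| "dl (Wr p f g) m ph k x =
    (if ph = 0 then {((m,1,Wr p f g # k),x,Right)}
     else if ph = 1 then
       (if marked p x then {((m,2,Wr p f g # k),wrcell f g x,Left)}
        else {((m,1,Wr p f g # k),x,Right)})
     else
       (if x = LE then {((m,0,k),x,Stay)} else {((m,2,Wr p f g # k),x,Left)}))"
| "dl (Cond p t a b) m ph k x =
    (if ph = 0 then {((m,1,Cond p t a b # k),x,Right)}
     else if ph = 1 then
       (if marked p x then {((m,if t x then 2 else 3,Cond p t a b # k),x,Left)}
        else {((m,1,Cond p t a b # k),x,Right)})
     else
       (if x = LE then {((m,0,(if ph = 2 then a else b) # k),x,Stay)}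
        else {((m,ph,Cond p t a b # k),x,Left)}))"

text \<open>Phases from 4 on prepare the tape: the left end is marked at position -1, the pointers
  Pn and PE are put behind the input, all others at position 0.\<close>
fun deltaA :: "astate \<Rightarrow> cell \<Rightarrow> (astate \<times> cell \<times> dir) set" where
  "deltaA (m, ph, k) x =
    (if ph = 4 then {((m,5,k),x,Left)}
     else if ph = 5 then {((m,6,k),LE,Right)}
     else if ph = 6 then {((m,7,k),mark (- {Pn,PE}) x,Stay)}
     else if ph = 7 then
       (if symc x = None then {((m,8,k),mark {Pn,PE} x,Left)} else {((m,7,k),x,Right)})
     else if 8 \<le> ph then (if x = LE then {((m,0,k),x,Stay)} else {((m,8,k),x,Left)})
     else case k of [] \<Rightarrow> {} | c # k' \<Rightarrow> dl c m ph k' x)"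

fun succA :: "acfg \<Rightarrow> acfg set" where
  "succA (q,tp,h) = (\<lambda>(q',g,d). (q', tp(h := g), h + mv d)) ` deltaA q (tp h)"

definition alternA :: "acfg \<Rightarrow> acfg \<Rightarrow> bool" where
  "alternA c c' \<longleftrightarrow> kindA (fst c) \<in> {Exist,Univ} \<and> kindA (fst c') \<in> {Exist,Univ} \<and>
     kindA (fst c') \<noteq> kindA (fst c)"

text \<open>Every run from the configuration halts within the given time and number of alternations,
  and the last argument tells whether the configuration is accepting.\<close>
inductive runs :: "nat \<Rightarrow> nat \<Rightarrow> acfg \<Rightarrow> bool \<Rightarrow> bool" where
  runs_acc: "kindA (fst c) = Accept \<Longrightarrow> runs t a c True"
| runs_rej: "kindA (fst c) = Reject \<Longrightarrow> runs t a c False"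
| runs_step: "kindA (fst c) \<in> {Exist,Univ} \<Longrightarrow>
    (\<And>c'. c' \<in> succA c \<Longrightarrow> runs t (a - (if alternA c c' then 1 else 0)) c' (V c')) \<Longrightarrow>
    (\<And>c'. c' \<in> succA c \<Longrightarrow> alternA c c' \<Longrightarrow> 0 < a) \<Longrightarrow>
    v = (if kindA (fst c) = Exist then \<exists>c'\<in>succA c. V c' else \<forall>c'\<in>succA c. V c') \<Longrightarrow>
    runs (Suc t) a c v"

lemma runs_mono: "runs t a c v \<Longrightarrow> t \<le> t' \<Longrightarrow> a \<le> a' \<Longrightarrow> runs t' a' c v"
proof (induction arbitrary: t' a' rule: runs.induct)
  case (runs_step c t a V v)
  obtain u where u: "t' = Suc u" "t \<le> u" using runs_step.prems by (cases t') auto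
  show ?case unfolding u(1)
  proof (rule runs.runs_step[where V = V])
    fix c' assume c': "c' \<in> succA c"
    show "runs u (a' - (if alternA c c' then 1 else 0)) c' (V c')"
      using runs_step.IH[OF c' u(2)] runs_step.prems by (simp add: diff_le_mono)
    show "alternA c c' \<Longrightarrow> 0 < a'"
      using runs_step.hyps(3)[OF c'] runs_step.prems by linarith
  qed (fact runs_step.hyps(1), fact runs_step.hyps(4))
qed (simp_all add: runs_acc runs_rej)

section \<open>Composition of bounded runs\<close>

text \<open>Like the other rules for \<open>runs\<close>, it leads from the later configuration to
  the earlier one, so that budgets add up along a program. Entering a halting state is not an
  alternation, hence the two extra kinds.\<close>

lemma runs_det:
  assumes "runs t a c' v" "kindA (fst c) \<in> {Exist,Univ}" "succA c = {c'}"
    "kindA (fst c') \<in> {kindA (fst c), Accept, Reject}"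
  shows "runs (Suc t) a c v"
  using assms by (intro runs_step[where V = "\<lambda>_. v"]) (auto simp: alternA_def)

text \<open>One alternation is charged even if the kind stays the same, which saves a case
  distinction on the old mode.\<close>

lemma runs_alt:
  assumes "runs t a c' v" "kindA (fst c) \<in> {Exist,Univ}" "succA c = {c'}"
  shows "runs (Suc t) (Suc a) c v"
  using assms by (intro runs_step[where V = "\<lambda>_. v"]) (auto intro: runs_mono)

lemma runs_scan_right:
  assumes "runs t a (q, tp, h + int d) v" "kindA q \<in> {Exist,Univ}"
    "\<And>i. h \<le> i \<Longrightarrow> i < h + int d \<Longrightarrow> deltaA q (tp i) = {(q, tp i, Right)}"
  shows "runs (t + d) a (q, tp, h) v"
  using assms
proof (induction d arbitrary: h)
  case (Suc d)
  have "runs (t + d) a (q, tp, h + 1) v"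
    using Suc.prems by (intro Suc.IH) (auto simp: algebra_simps)
  then show ?case
    using Suc.prems(2) Suc.prems(3)[of h] by (auto intro!: runs_det)
qed auto

lemma runs_scan_left:
  assumes "runs t a (q, tp, -1) v" "kindA q \<in> {Exist,Univ}"
    "\<And>i. 0 \<le> i \<Longrightarrow> i < int d \<Longrightarrow> deltaA q (tp i) = {(q, tp i, Left)}"
  shows "runs (t + d) a (q, tp, int d - 1) v"
  using assms
proof (induction d)
  case (Suc d)
  have "runs (t + d) a (q, tp, int d - 1) v"
    using Suc.prems by (intro Suc.IH) auto
  then show ?case
    using Suc.prems(2) Suc.prems(3)[of "int d"] by (auto intro!: runs_det)
qed auto

section \<open>Stores and the tapes that represent them\<close>

record st =
  pv :: "ptr \<Rightarrow> nat"
  fl :: "nat \<Rightarrow> bool"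
  gl :: "nat \<Rightarrow> bool"

definition upd :: "ptr \<Rightarrow> nat \<Rightarrow> st \<Rightarrow> st" where
  "upd p x s = s\<lparr>pv := (pv s)(p := x)\<rparr>"

lemma upd_simps [simp]:
  "pv (upd p x s) q = (if q = p then x else pv s q)" "fl (upd p x s) = fl s" "gl (upd p x s) = gl s"
  "upd p x (upd p y s) = upd p x s"
  by (simp_all add: upd_def)

lemma upd_twist: "p \<noteq> q \<Longrightarrow> upd p x (upd q y s) = upd q y (upd p x s)"
  by (simp add: upd_def fun_upd_twist)

text \<open>Pointers other than \<open>PE\<close> saturate at \<open>PE\<close>, so none of them
  passes the end mark, whatever the players do.\<close>

definition incp :: "ptr \<Rightarrow> st \<Rightarrow> st" where
  "incp p s = (if p \<noteq> PE \<and> pv s p = pv s PE then s else upd p (Suc (pv s p)) s)"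

definition cellat :: "sym list \<Rightarrow> st \<Rightarrow> nat \<Rightarrow> cell" where
  "cellat w s i = Cell (if i < length w then Some (w ! i) else None) (fl s i) (gl s i) {p. pv s p = i}"

definition wr :: "ptr \<Rightarrow> bool \<Rightarrow> bool \<Rightarrow> st \<Rightarrow> st" where
  "wr p f g s = s\<lparr>fl := (fl s)(pv s p := f), gl := (gl s)(pv s p := g)\<rparr>"

definition tape :: "sym list \<Rightarrow> st \<Rightarrow> int \<Rightarrow> cell" where
  "tape w s i = (if i < -1 then Cell None False False {} else if i = -1 then LE
     else cellat w s (nat i))"

lemma tape_simps [simp]: "tape w s (-1) = LE" "tape w s (int i) = cellat w s i"
  by (auto simp: tape_def)

lemma tape_eq: "0 \<le> i \<Longrightarrow> tape w s i = cellat w s (nat i)"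
  by (auto simp: tape_def)

lemma marked_cellat [simp]: "marked p (cellat w s i) \<longleftrightarrow> pv s p = i"
  by (simp add: cellat_def)

lemma cellat_ne [simp]: "cellat w s i \<noteq> LE" "LE \<noteq> cellat w s i"
  by (auto simp: cellat_def)

lemma mark_LE_iff [simp]:
  "unmark p x = LE \<longleftrightarrow> x = LE" "mark M x = LE \<longleftrightarrow> x = LE" "wrcell f g x = LE \<longleftrightarrow> x = LE"
  by (cases x; simp)+

text \<open>The configurations between two commands.\<close>

definition cfg :: "sym list \<Rightarrow> bool \<Rightarrow> com list \<Rightarrow> st \<Rightarrow> acfg" where
  "cfg w m k s = ((m,0,k), tape w s, -1)"

lemma kind_next: "ph < 4 \<Longrightarrow> kindA (m,ph,k) \<in> {if m then Exist else Univ, Accept, Reject}"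
  by (auto split: list.split com.split)

definition simple :: "com \<Rightarrow> bool" where
  "simple c \<longleftrightarrow> (\<forall>v. c \<noteq> Halt v)"

lemma kind_simple: "simple c \<Longrightarrow> ph < 4 \<Longrightarrow> kindA (m,ph,c # k) = (if m then Exist else Univ)"
  by (cases c) (auto simp: simple_def)

lemma simple_simps [simp]:
  "simple Skip" "simple (a ;; b)" "simple (Zero p)" "simple (Inc p)" "simple (Wr p f g)"
  "simple (Cond p t a b)" "simple (Choice a b)" "simple (Mode m)" "simple (For i y b)"
  "simple (Loop i y b)" "\<not> simple (Halt v)"
  by (auto simp: simple_def)

lemma runs_micro:
  assumes "runs t a ((m,ph',k'), tp(h := g), h + mv d) v" "simple c" "ph < 4" "ph' < 4"
    "dl c m ph k (tp h) = {((m,ph',k'),g,d)}"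
  shows "runs (Suc t) a ((m,ph,c # k), tp, h) v"
  using assms kind_next[of ph' m k'] kind_simple[of c ph m k]
  by (intro runs_det[OF assms(1)]) (auto simp del: kindA.simps)

lemma runs_find:
  assumes "runs t a ((m,1,c # k), tape w s, int (pv s p)) v" "simple c"
    "\<And>x. dl c m 0 k x = {((m,1,c # k),x,Right)}"
    "\<And>x. \<not> marked p x \<Longrightarrow> dl c m 1 k x = {((m,1,c # k),x,Right)}"
  shows "runs (t + pv s p + 1) a (cfg w m (c # k) s) v"
proof -
  have "runs (t + pv s p) a ((m,1,c # k), tape w s, 0) v"
    using assms kind_simple[of c 1 m k]
    by (intro runs_scan_right) (auto simp: tape_eq simp del: kindA.simps)
  then show ?thesis
    unfolding cfg_def using assms(2,3) 
    by (auto intro!: runs_micro[where ph' = 1 and d = Right and g = LE] simp: fun_upd_idem)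
qed

lemma runs_return:
  assumes "runs t a ((m,ph,c # k), tp, -1) v" "simple c" "ph < 4" "h < int d"
    "\<And>i. 0 \<le> i \<Longrightarrow> i \<le> h \<Longrightarrow> dl c m ph k (tp i) = {((m,ph,c # k),tp i,Left)}" "-1 \<le> h"
  shows "runs (t + d) a ((m,ph,c # k), tp, h) v"
proof -
  have "runs (t + nat (h + 1)) a ((m,ph,c # k), tp, int (nat (h + 1)) - 1) v"
    using assms kind_simple[of c ph m k]
    by (intro runs_scan_left) (auto simp del: kindA.simps)
  moreover have "int (nat (h + 1)) - 1 = h" using assms by simp
  ultimately show ?thesis using assms(4,6) by (auto elim!: runs_mono)
qed

section \<open>Cost of the primitive commands\<close>

text \<open>One scan to the mark and one back, plus a constant; the other primitive commands are
  treated in the same way.\<close>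

lemma runs_Wr:
  assumes "runs t a (cfg w m k (wr p f g s)) v"
  shows "runs (t + 2 * pv s p + 5) a (cfg w m (Wr p f g # k) s) v"
proof -
  let ?tp = "(tape w s)(int (pv s p) := wrcell f g (cellat w s (pv s p)))"
  have tp: "?tp = tape w (wr p f g s)"
    by (auto simp: fun_eq_iff tape_def wr_def cellat_def)
  have "runs (Suc t) a ((m,2,Wr p f g # k), ?tp, -1) v"
    using assms unfolding cfg_def tp
    by (auto intro!: runs_micro[where ph' = 0 and d = Stay and g = LE] simp: fun_upd_idem)
  then have "runs (Suc t + pv s p) a ((m,2,Wr p f g # k), ?tp, int (pv s p) - 1) v"
    by (rule runs_return) (auto simp: tape_eq)
  then have "runs (Suc (Suc t + pv s p)) a ((m,1,Wr p f g # k), tape w s, int (pv s p)) v"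
    by (auto intro!: runs_micro[where ph' = 2 and d = Left and g = "wrcell f g (cellat w s (pv s p))"])
  then have "runs (Suc (Suc t + pv s p) + pv s p + 1) a (cfg w m (Wr p f g # k) s) v"
    by (rule runs_find) auto
  then show ?thesis by (rule runs_mono) auto
qed

lemma runs_Cond:
  assumes "runs t a (cfg w m ((if T (cellat w s (pv s p)) then c1 else c2) # k) s) v"
  shows "runs (t + 2 * pv s p + 5) a (cfg w m (Cond p T c1 c2 # k) s) v"
proof -
  define ph :: nat where "ph = (if T (cellat w s (pv s p)) then 2 else 3)"
  have ph: "ph = 2 \<or> ph = 3" "ph = 2 \<longleftrightarrow> T (cellat w s (pv s p))" by (auto simp: ph_def)
  have "runs (Suc t) a ((m,ph,Cond p T c1 c2 # k), tape w s, -1) v"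
    using assms ph unfolding cfg_def 
    by (intro runs_micro[where ph' = 0 and d = Stay and g = LE and k' = "(if ph = 2 then c1 else c2) # k"])
       (auto simp: fun_upd_idem)
  then have "runs (Suc t + pv s p) a ((m,ph,Cond p T c1 c2 # k), tape w s, int (pv s p) - 1) v"
    by (rule runs_return) (use ph in \<open>auto simp: tape_eq\<close>)
  then have "runs (Suc (Suc t + pv s p)) a ((m,1,Cond p T c1 c2 # k), tape w s, int (pv s p)) v"
    using ph by (intro runs_micro[where ph' = ph and d = Left and g = "cellat w s (pv s p)"
       and k' = "Cond p T c1 c2 # k"]) (auto simp: ph_def fun_upd_idem)
  then have "runs (Suc (Suc t + pv s p) + pv s p + 1) a (cfg w m (Cond p T c1 c2 # k) s) v"
    by (rule runs_find) auto
  then show ?thesis by (rule runs_mono) auto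
qed

lemma runs_Zero:
  assumes "runs t a (cfg w m k (upd p 0 s)) v"
  shows "runs (t + 2 * pv s p + 7) a (cfg w m (Zero p # k) s) v"
proof -
  \<comment> \<open>In \<open>?tp\<close> the mark of \<open>p\<close> is lifted and not yet put
    down again, so this tape represents no store.\<close>
  let ?tp = "(tape w s)(int (pv s p) := unmark p (cellat w s (pv s p)))"
  have tp: "?tp(0 := mark {p} (?tp 0)) = tape w (upd p 0 s)"
    by (auto simp: fun_eq_iff tape_def wr_def cellat_def)
  have "runs (Suc t) a ((m,3,Zero p # k), ?tp, 0) v"
    using assms unfolding cfg_def tp[symmetric]
    by (auto intro!: runs_micro[where ph' = 0 and d = Left and g = "mark {p} (?tp 0)"])
  then have "runs (Suc (Suc t)) a ((m,2,Zero p # k), ?tp, -1) v"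
    by (auto intro!: runs_micro[where ph' = 3 and d = Right and g = "LE"] simp: fun_upd_idem)
  then have "runs (Suc (Suc t) + pv s p) a ((m,2,Zero p # k), ?tp, int (pv s p) - 1) v"
    by (rule runs_return) (auto simp: tape_eq)
  then have "runs (Suc (Suc (Suc t) + pv s p)) a ((m,1,Zero p # k), tape w s, int (pv s p)) v"
    by (auto intro!: runs_micro[where ph' = 2 and d = Left and g = "unmark p (cellat w s (pv s p))"])
  then have "runs (Suc (Suc (Suc t) + pv s p) + pv s p + 1) a (cfg w m (Zero p # k) s) v"
    by (rule runs_find) auto
  then show ?thesis by (rule runs_mono) auto
qed

lemma runs_Inc:
  assumes "runs t a (cfg w m k (incp p s)) v"
  shows "runs (t + 2 * pv s p + 9) a (cfg w m (Inc p # k) s) v"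
proof -
  have "runs (Suc (Suc (Suc (Suc t)) + pv s p)) a ((m,1,Inc p # k), tape w s, int (pv s p)) v"
  proof (cases "p \<noteq> PE \<and> pv s p = pv s PE")
    case True
    then have "runs (Suc t) a ((m,2,Inc p # k), tape w s, -1) v"
      using assms unfolding cfg_def 
      by (intro runs_micro[where ph' = 0 and d = Stay and g = LE]) (auto simp: fun_upd_idem incp_def)
    then have "runs (Suc t + pv s p) a ((m,2,Inc p # k), tape w s, int (pv s p) - 1) v"
      by (rule runs_return) (auto simp: tape_eq)
    then have "runs (Suc (Suc t + pv s p)) a ((m,1,Inc p # k), tape w s, int (pv s p)) v"
      using True
      by (auto intro!: runs_micro[where ph' = 2 and d = Left and g = "cellat w s (pv s p)"] simp: fun_upd_idem)
    then show ?thesis by (rule runs_mono) auto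
  next
    case False
    let ?tp = "(tape w s)(int (pv s p) := unmark p (cellat w s (pv s p)))"
    let ?h = "int (pv s p) + 1"
    have h: "?h = int (Suc (pv s p))" by simp
    have tp: "?tp(?h := mark {p} (?tp ?h)) = tape w (upd p (Suc (pv s p)) s)"
      by (auto simp: fun_eq_iff tape_def wr_def cellat_def)
    have inc: "incp p s = upd p (Suc (pv s p)) s" using False by (auto simp: incp_def)
    have "runs (Suc t) a ((m,2,Inc p # k), ?tp(?h := mark {p} (?tp ?h)), -1) v"
      using assms unfolding cfg_def tp inc
      by (intro runs_micro[where ph' = 0 and d = Stay and g = LE]) (auto simp: fun_upd_idem)
    then have "runs (Suc t + Suc (pv s p)) a ((m,2,Inc p # k), ?tp(?h := mark {p} (?tp ?h)), int (pv s p)) v"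
      by (rule runs_return) (auto simp: tape_eq tp)
    then have "runs (Suc (Suc t + Suc (pv s p))) a ((m,3,Inc p # k), ?tp, ?h) v"
      by (intro runs_micro[where ph' = 2 and d = Left and g = "mark {p} (?tp ?h)" and tp = "?tp"
            and h = "?h" and k' = "Inc p # k"]) auto
    then have "runs (Suc (Suc (Suc t + Suc (pv s p)))) a ((m,1,Inc p # k), tape w s, int (pv s p)) v"
      using False
      by - (rule runs_micro[where ph' = 3 and d = Right and g = "unmark p (cellat w s (pv s p))"
            and k' = "Inc p # k"]; auto)
    then show ?thesis by (rule runs_mono) auto
  qed
  then have "runs (Suc (Suc (Suc (Suc t)) + pv s p) + pv s p + 1) a (cfg w m (Inc p # k) s) v"
    by (rule runs_find) auto
  then show ?thesis by (rule runs_mono) auto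
qed

section \<open>Programs over pointers\<close>

text \<open>\<^term>\<open>wp w c Q m s\<close> tells whether the existential player wins when \<^term>\<open>c\<close> runs on store
  \<^term>\<open>s\<close> and he makes the choices iff \<^term>\<open>m\<close> holds; \<^term>\<open>Q\<close> tells this for the continuation.\<close>
primrec wp :: "sym list \<Rightarrow> com \<Rightarrow> (bool \<Rightarrow> st \<Rightarrow> bool) \<Rightarrow> bool \<Rightarrow> st \<Rightarrow> bool" where
  "wp w Skip Q = Q"
| "wp w (a ;; b) Q = wp w a (wp w b Q)"
| "wp w (Zero p) Q = (\<lambda>m s. Q m (upd p 0 s))"
| "wp w (Inc p) Q = (\<lambda>m s. Q m (incp p s))"
| "wp w (Wr p f g) Q = (\<lambda>m s. Q m (wr p f g s))"
| "wp w (Cond p T a b) Q =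
     (\<lambda>m s. if T (cellat w s (pv s p)) then wp w a Q m s else wp w b Q m s)"
| "wp w (Choice a b) Q =
     (\<lambda>m s. if m then wp w a Q m s \<or> wp w b Q m s else wp w a Q m s \<and> wp w b Q m s)"
| "wp w (Mode m') Q = (\<lambda>m s. Q m' s)"
| "wp w (Halt v) Q = (\<lambda>m s. v)"
| "wp w (For i y b) Q =
     (\<lambda>m s. ((\<lambda>Q'. wp w b (\<lambda>m s. Q' m (incp i s))) ^^ pv s y) Q m (upd i 0 s))"
| "wp w (Loop i y b) Q = (\<lambda>m s. False)"

section \<open>Well-formed programs and their resource bounds\<close>

primrec mods :: "com \<Rightarrow> ptr set" where
  "mods Skip = {}"
| "mods (a ;; b) = mods a \<union> mods b"
| "mods (Zero p) = {p}"
| "mods (Inc p) = {p}"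
| "mods (Wr p f g) = {}"
| "mods (Cond p T a b) = mods a \<union> mods b"
| "mods (Choice a b) = mods a \<union> mods b"
| "mods (Mode m) = {}"
| "mods (Halt v) = {}"
| "mods (For i y b) = insert i (mods b)"
| "mods (Loop i y b) = insert i (mods b)"

text \<open>The conditions on \<open>For\<close> leave counter and limit to the loop itself, so the
  number of rounds is the value of \<open>y\<close> at the start. \<open>Pn\<close> never moves and
  \<open>PE\<close> is never reset, which keeps the input length available and all pointers at or
  below \<open>PE\<close>.\<close>

primrec wfc :: "com \<Rightarrow> bool" where
  "wfc Skip = True"
| "wfc (a ;; b) = (wfc a \<and> wfc b)"
| "wfc (Zero p) = (p \<noteq> Pn \<and> p \<noteq> PE)"
| "wfc (Inc p) = (p \<noteq> Pn)"
| "wfc (Wr p f g) = True"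
| "wfc (Cond p T a b) = (wfc a \<and> wfc b)"
| "wfc (Choice a b) = (wfc a \<and> wfc b)"
| "wfc (Mode m) = True"
| "wfc (Halt v) = True"
| "wfc (For i y b) = (i \<noteq> y \<and> i \<noteq> Pn \<and> i \<noteq> PE \<and> i \<notin> mods b \<and> y \<notin> mods b \<and> wfc b)"
| "wfc (Loop i y b) = False"

text \<open>The bound on the position of the end pointer PE after a command, given one before it.\<close>
primrec grow :: "nat \<Rightarrow> com \<Rightarrow> nat \<Rightarrow> nat" where
  "grow n Skip = (\<lambda>l. l)"
| "grow n (a ;; b) = (\<lambda>l. grow n b (grow n a l))"
| "grow n (Zero p) = (\<lambda>l. l)"
| "grow n (Inc p) = (\<lambda>l. if p = PE then Suc l else l)"
| "grow n (Wr p f g) = (\<lambda>l. l)"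
| "grow n (Cond p T a b) = (\<lambda>l. max (grow n a l) (grow n b l))"
| "grow n (Choice a b) = (\<lambda>l. max (grow n a l) (grow n b l))"
| "grow n (Mode m) = (\<lambda>l. l)"
| "grow n (Halt v) = (\<lambda>l. l)"
| "grow n (For i y b) = (\<lambda>l. (grow n b ^^ (if y = Pn then n else l)) l)"
| "grow n (Loop i y b) = (\<lambda>l. l)"

text \<open>Since increments stop at PE, every loop runs at most L times when PE is at most L. Hence
  running times are bounded by a function of the program text and L alone.\<close>
primrec tm :: "nat \<Rightarrow> com \<Rightarrow> nat" where
  "tm L Skip = 1"
| "tm L (a ;; b) = 1 + tm L a + tm L b"
| "tm L (Zero p) = 2 * L + 9"
| "tm L (Inc p) = 2 * L + 9"
| "tm L (Wr p f g) = 2 * L + 9"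
| "tm L (Cond p T a b) = 2 * L + 9 + tm L a + tm L b"
| "tm L (Choice a b) = 1 + tm L a + tm L b"
| "tm L (Mode m) = 1"
| "tm L (Halt v) = 1"
| "tm L (For i y b) = L * (tm L b + 4 * L + 20) + 4 * L + 30"
| "tm L (Loop i y b) = 1"

text \<open>Only \<open>Mode\<close> costs alternations; all other commands keep the kind of the
  state or halt. A loop over \<open>Pn\<close> has n rounds, while L is all that is known for other
  limits.\<close>

primrec al :: "nat \<Rightarrow> nat \<Rightarrow> com \<Rightarrow> nat" where
  "al n L Skip = 0"
| "al n L (a ;; b) = al n L a + al n L b"
| "al n L (Zero p) = 0"
| "al n L (Inc p) = 0"
| "al n L (Wr p f g) = 0"
| "al n L (Cond p T a b) = al n L a + al n L b"
| "al n L (Choice a b) = al n L a + al n L b"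
| "al n L (Mode m) = 1"
| "al n L (Halt v) = 0"
| "al n L (For i y b) = (if y = Pn then n else L) * al n L b"
| "al n L (Loop i y b) = 0"

definition Inv :: "sym list \<Rightarrow> nat \<Rightarrow> st \<Rightarrow> bool" where
  "Inv w l s \<longleftrightarrow> pv s Pn = length w \<and> (\<forall>p. pv s p \<le> pv s PE) \<and> pv s PE \<le> l"

lemma Inv_mono: "Inv w l s \<Longrightarrow> l \<le> l' \<Longrightarrow> Inv w l' s"
  by (auto simp: Inv_def)

lemma Inv_le: "Inv w l s \<Longrightarrow> l \<le> L \<Longrightarrow> pv s p \<le> L"
  by (meson Inv_def le_trans)

lemma grow_ge: "l \<le> grow n c l"
proof (induction c arbitrary: l)
  case (For i y b)
  have "l \<le> (grow n b ^^ j) l" for j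
    by (induction j) (auto intro: le_trans[OF _ For])
  then show ?case by auto
qed (auto intro: le_trans simp: le_max_iff_disj)

lemma grow_iter_mono: "j \<le> j' \<Longrightarrow> (grow n c ^^ j) l \<le> (grow n c ^^ j') l"
  by (rule lift_Suc_mono_le[of "\<lambda>j. (grow n c ^^ j) l"]) (auto simp: grow_ge)

lemma pv_incp: "pv (incp p s) q = (if q = p \<and> (p = PE \<or> pv s p \<noteq> pv s PE) then Suc (pv s p) else pv s q)"
  by (auto simp: incp_def)

lemma incp_other [simp]: "fl (incp p s) = fl s" "gl (incp p s) = gl s"
  by (auto simp: incp_def)

lemma wr_pv [simp]: "pv (wr p f g s) = pv s"
  by (auto simp: wr_def)

lemma Inv_incp: "Inv w l s \<Longrightarrow> p \<noteq> Pn \<Longrightarrow> Inv w (if p = PE then Suc l else l) (incp p s)"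
  unfolding Inv_def
  by (auto simp: pv_incp intro: le_SucI Suc_leI le_neq_trans)

lemma runs_jump:
  assumes "runs t a (cfg w m k' s) v" "simple c" "dl c m 0 k LE = {((m,0,k'),LE,Stay)}"
  shows "runs (Suc t) a (cfg w m (c # k) s) v"
  unfolding cfg_def
  by (rule runs_micro[where ph' = 0 and d = Stay and g = LE and k' = k'])
     (use assms in \<open>auto simp: cfg_def fun_upd_idem\<close>)

lemma runs_Mode:
  assumes "runs t a (cfg w m' k s) v"
  shows "runs (Suc t) (Suc a) (cfg w m (Mode m' # k) s) v"
  by (rule runs_alt[where c' = "cfg w m' k s"])
     (use assms in \<open>auto simp: cfg_def fun_upd_idem\<close>)

text \<open>If the branches coincide, the two successors are one configuration, which has to receive
  a single value; this is the third assumption.\<close>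

lemma runs_Choice:
  assumes "runs t a (cfg w m (c1 # k) s) v1" "runs t a (cfg w m (c2 # k) s) v2"
    "c1 = c2 \<Longrightarrow> v1 = v2"
  shows "runs (Suc t) a (cfg w m (Choice c1 c2 # k) s) (if m then v1 \<or> v2 else v1 \<and> v2)"
proof (rule runs_step)
  let ?c = "cfg w m (Choice c1 c2 # k) s"
  let ?V = "\<lambda>c'. if c' = cfg w m (c1 # k) s then v1 else v2"
  show K: "kindA (fst ?c) \<in> {Exist, Univ}" by (auto simp: cfg_def)
  have S: "succA ?c = {cfg w m (c1 # k) s, cfg w m (c2 # k) s}"
    by (auto simp: cfg_def fun_upd_idem)
  have A: "\<not> alternA ?c c'" if "c' \<in> succA ?c" for c'
    using that kind_next[of 0 m "c1 # k"] kind_next[of 0 m "c2 # k"] unfolding S alternA_def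
    by (auto simp: cfg_def simp del: kindA.simps) (auto simp: split: if_splits)
  show "runs t (a - (if alternA ?c c' then 1 else 0)) c' (?V c')" if "c' \<in> succA ?c" for c'
    using that assms A[OF that] unfolding S by (auto simp: cfg_def)
  show "alternA ?c c' \<Longrightarrow> 0 < a" if "c' \<in> succA ?c" for c' using A[OF that] by simp
  show "(if m then v1 \<or> v2 else v1 \<and> v2) = 
    (if kindA (fst ?c) = Exist then \<exists>c'\<in>succA ?c. ?V c' else \<forall>c'\<in>succA ?c. ?V c')"
    using assms(3) unfolding S by (auto simp: cfg_def)
qed

text \<open>The bridge from \<open>wp\<close> to the machine, by induction on the program in
  continuation-passing form. The continuation meets its budget only on stores that satisfy the
  invariant for the grown bound and agree with \<open>s\<close> outside \<open>mods c\<close>; the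
  agreement is what tells a loop that its limit has not moved.\<close>

lemma sim:
  assumes "wfc c" "Inv w l s" "grow (length w) c l \<le> L"
    "\<And>m s'. Inv w (grow (length w) c l) s' \<Longrightarrow> (\<And>p. p \<notin> mods c \<Longrightarrow> pv s' p = pv s p) \<Longrightarrow>
       runs t a (cfg w m k s') (Q m s')"
  shows "runs (t + tm L c) (a + al (length w) L c) (cfg w m (c # k) s) (wp w c Q m s)"
  using assms
proof (induction c arbitrary: l s t a k Q m)
  case Skip
  then show ?case by (auto intro!: runs_jump)
next
  case (Seq c1 c2)
  have "runs (t + tm L c2 + tm L c1) (a + al (length w) L c2 + al (length w) L c1)
    (cfg w m (c1 # c2 # k) s) (wp w c1 (wp w c2 Q) m s)"
  proof (rule Seq.IH(1)[OF _ Seq.prems(2)])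
    show "wfc c1" using Seq.prems by simp
    show "grow (length w) c1 l \<le> L" using Seq.prems(3) by (auto intro: le_trans[OF grow_ge])
    fix m s1 assume s1: "Inv w (grow (length w) c1 l) s1" "\<And>p. p \<notin> mods c1 \<Longrightarrow> pv s1 p = pv s p"
    show "runs (t + tm L c2) (a + al (length w) L c2) (cfg w m (c2 # k) s1) (wp w c2 Q m s1)"
      by (rule Seq.IH(2)[OF _ s1(1)]) (use Seq.prems s1(2) in auto)
  qed
  then have "runs (Suc (t + tm L c2 + tm L c1)) (a + al (length w) L c2 + al (length w) L c1)
    (cfg w m ((c1 ;; c2) # k) s) (wp w c1 (wp w c2 Q) m s)"
    by (rule runs_jump) auto
  then show ?case by (auto elim!: runs_mono)
next
  case (Zero p)
  have "runs (t + 2 * pv s p + 7) a (cfg w m (Zero p # k) s) (Q m (upd p 0 s))"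
    by (rule runs_Zero) (use Zero in \<open>auto simp: Inv_def\<close>)
  then show ?case using Inv_le[OF Zero(2), of L p] Zero(3) by (auto elim!: runs_mono)
next
  case (Inc p)
  have "runs (t + 2 * pv s p + 9) a (cfg w m (Inc p # k) s) (Q m (incp p s))"
    by (rule runs_Inc, rule Inc(4)) (use Inc Inv_incp[OF Inc(2), of p] in \<open>auto simp: pv_incp\<close>)
  then show ?case using Inv_le[OF Inc(2), of L p] Inc(3)
    by (auto elim!: runs_mono split: if_splits)
next
  case (Wr p f g)
  have "runs (t + 2 * pv s p + 5) a (cfg w m (Wr p f g # k) s) (Q m (wr p f g s))"
    by (rule runs_Wr) (use Wr in \<open>auto simp: Inv_def\<close>)
  then show ?case using Inv_le[OF Wr(2), of L p] Wr(3) by (auto elim!: runs_mono)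
next
  case (Cond p T c1 c2)
  have 1: "runs (t + tm L c1) (a + al (length w) L c1) (cfg w m (c1 # k) s) (wp w c1 Q m s)"
    by (rule Cond.IH(1)[OF _ Cond.prems(2)])
       (use Cond.prems(1,3) in \<open>auto intro!: Cond.prems(4) elim!: Inv_mono\<close>)
  have 2: "runs (t + tm L c2) (a + al (length w) L c2) (cfg w m (c2 # k) s) (wp w c2 Q m s)"
    by (rule Cond.IH(2)[OF _ Cond.prems(2)])
       (use Cond.prems(1,3) in \<open>auto intro!: Cond.prems(4) elim!: Inv_mono\<close>)
  have "runs (t + tm L c1 + tm L c2) (a + al (length w) L c1 + al (length w) L c2)
     (cfg w m ((if T (cellat w s (pv s p)) then c1 else c2) # k) s) (wp w (Cond p T c1 c2) Q m s)"
    using 1 2 by (auto elim!: runs_mono)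
  then have "runs (t + tm L c1 + tm L c2 + 2 * pv s p + 5) (a + al (length w) L c1 + al (length w) L c2)
     (cfg w m (Cond p T c1 c2 # k) s) (wp w (Cond p T c1 c2) Q m s)"
    by (rule runs_Cond)
  moreover have "l \<le> L"
    using Cond.prems(3) grow_ge[of l "length w" c1] by simp
  ultimately show ?case using Inv_le[OF Cond.prems(2), of L p]
    by (auto elim!: runs_mono)
next
  case (Choice c1 c2)
  have 1: "runs (t + tm L c1) (a + al (length w) L c1) (cfg w m (c1 # k) s) (wp w c1 Q m s)"
    by (rule Choice.IH(1)[OF _ Choice.prems(2)])
       (use Choice.prems(1,3) in \<open>auto intro!: Choice.prems(4) elim!: Inv_mono\<close>)
  have 2: "runs (t + tm L c2) (a + al (length w) L c2) (cfg w m (c2 # k) s) (wp w c2 Q m s)"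
    by (rule Choice.IH(2)[OF _ Choice.prems(2)])
       (use Choice.prems(1,3) in \<open>auto intro!: Choice.prems(4) elim!: Inv_mono\<close>)
  have "runs (Suc (t + tm L c1 + tm L c2)) (a + al (length w) L c1 + al (length w) L c2)
     (cfg w m (Choice c1 c2 # k) s)
     (if m then wp w c1 Q m s \<or> wp w c2 Q m s else wp w c1 Q m s \<and> wp w c2 Q m s)"
    by (rule runs_Choice; rule runs_mono[OF 1] runs_mono[OF 2] arg_cong) auto
  then show ?case by (auto elim!: runs_mono)
next
  case (Mode m')
  then show ?case by (auto intro!: runs_Mode)
next
  case (Halt v)
  then show ?case by (cases v) (auto intro!: runs_acc runs_rej simp: cfg_def)
next
  case (For i y b)
  let ?n = "length w"
  let ?F = "\<lambda>Q'. wp w b (\<lambda>m s. Q' m (incp i s))"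
  let ?cnt = "if y = Pn then ?n else l"
  let ?g = "\<lambda>j. (grow ?n b ^^ j) l"
  have wf: "i \<noteq> y" "i \<noteq> Pn" "i \<noteq> PE" "i \<notin> mods b" "y \<notin> mods b" "wfc b"
    using For.prems by auto
  have cnt: "pv s y \<le> ?cnt" using For.prems(2) unfolding Inv_def by (auto intro: le_trans[of _ "pv s PE"])
  have gL: "?g j \<le> L" if "j \<le> pv s y" for j
    using For.prems(3) grow_iter_mono[of j ?cnt ?n b l] cnt that by auto
  \<comment> \<open>Here j rounds are done and r remain. The counter equals j, so the test whether
    \<open>i\<close> and \<open>y\<close> mark the same cell succeeds exactly when r is 0.\<close>
  have loop: "runs (t + r * (tm L b + 4 * L + 20) + 2 * L + 8) (a + r * al ?n L b)
      (cfg w m (Loop i y b # k) s1) ((?F ^^ r) Q m s1)"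
    if "Inv w (?g j) s1" "pv s1 i = j" "j + r = pv s y"
      "\<And>p. p \<notin> insert i (mods b) \<Longrightarrow> pv s1 p = pv s p" for r j s1 m
    using that
  proof (induction r arbitrary: j s1 m)
    case 0
    have "runs t a (cfg w m k s1) (Q m s1)"
      by (rule For.prems(4)) (use 0 cnt grow_iter_mono[of j ?cnt ?n b l] in \<open>auto elim!: Inv_mono\<close>)
    then have "runs (Suc t) a (cfg w m (Skip # k) s1) (Q m s1)"
      by (rule runs_jump) auto
    then have "runs (Suc t + 2 * pv s1 i + 5) a
       (cfg w m (Cond i (marked y) Skip (b ;; Inc i ;; Loop i y b) # k) s1) (Q m s1)"
      by (intro runs_Cond) (use 0 wf in auto)
    then have "runs (Suc (Suc t + 2 * pv s1 i + 5)) a (cfg w m (Loop i y b # k) s1) (Q m s1)"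
      by (rule runs_jump) auto
    moreover have "pv s1 i \<le> L"
      using Inv_le[OF 0(1), of L i] gL[of j] 0 by simp
    ultimately show ?case by (auto elim!: runs_mono)
  next
    case (Suc r)
    have jL: "j \<le> L" using Inv_le[OF Suc.prems(1), of L i] gL[of j] Suc.prems by simp
    let ?t = "t + r * (tm L b + 4 * L + 20) + 2 * L + 8 + 2 * L + 10"
    have "runs (?t + tm L b) (a + r * al ?n L b + al ?n L b)
      (cfg w m (b # (Inc i ;; Loop i y b) # k) s1) (wp w b (\<lambda>m s. (?F ^^ r) Q m (incp i s)) m s1)"
    proof (rule For.IH[OF wf(6) Suc.prems(1)])
      show "grow ?n b (?g j) \<le> L" using gL[of "Suc j"] Suc.prems by simp
      fix m s2 assume s2: "Inv w (grow ?n b (?g j)) s2" "\<And>p. p \<notin> mods b \<Longrightarrow> pv s2 p = pv s1 p"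
      have y2: "pv s2 i = j" "pv s2 y = pv s y" using s2(2) wf Suc.prems by auto
      \<comment> \<open>The counter is below \<open>y\<close> and thus below \<open>PE\<close>, so
        its increment does not saturate.\<close>
      have "pv s2 y \<le> pv s2 PE" using s2(1) by (auto simp: Inv_def)
      then have ne: "pv s2 i \<noteq> pv s2 PE" using y2 Suc.prems(3) by simp
      have "Inv w (?g (Suc j)) (incp i s2)"
        using Inv_incp[OF s2(1), of i] wf by simp
      then have "runs (t + r * (tm L b + 4 * L + 20) + 2 * L + 8) (a + r * al ?n L b)
        (cfg w m (Loop i y b # k) (incp i s2)) ((?F ^^ r) Q m (incp i s2))"
        by (rule Suc.IH) (use ne y2 Suc.prems s2(2) in \<open>auto simp: pv_incp\<close>)
      then have "runs (t + r * (tm L b + 4 * L + 20) + 2 * L + 8 + 2 * pv s2 i + 9) (a + r * al ?n L b)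
        (cfg w m (Inc i # Loop i y b # k) s2) ((?F ^^ r) Q m (incp i s2))"
        by (rule runs_Inc)
      then have "runs (Suc (t + r * (tm L b + 4 * L + 20) + 2 * L + 8 + 2 * pv s2 i + 9)) (a + r * al ?n L b)
        (cfg w m ((Inc i ;; Loop i y b) # k) s2) ((?F ^^ r) Q m (incp i s2))"
        by (rule runs_jump) auto
      then show "runs ?t (a + r * al ?n L b)
        (cfg w m ((Inc i ;; Loop i y b) # k) s2) ((?F ^^ r) Q m (incp i s2))"
        using y2 jL by (auto elim!: runs_mono)
    qed
    then have "runs (Suc (?t + tm L b)) (a + r * al ?n L b + al ?n L b)
      (cfg w m ((b ;; Inc i ;; Loop i y b) # k) s1) (wp w b (\<lambda>m s. (?F ^^ r) Q m (incp i s)) m s1)"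
      by (rule runs_jump) auto
    then have "runs (Suc (?t + tm L b) + 2 * pv s1 i + 5) (a + r * al ?n L b + al ?n L b)
      (cfg w m (Cond i (marked y) Skip (b ;; Inc i ;; Loop i y b) # k) s1)
      (wp w b (\<lambda>m s. (?F ^^ r) Q m (incp i s)) m s1)"
      by (intro runs_Cond) (use Suc wf in auto)
    then have "runs (Suc (Suc (?t + tm L b) + 2 * pv s1 i + 5)) (a + r * al ?n L b + al ?n L b)
      (cfg w m (Loop i y b # k) s1) (wp w b (\<lambda>m s. (?F ^^ r) Q m (incp i s)) m s1)"
      by (rule runs_jump) auto
    then show ?case using Suc.prems jL by (auto elim!: runs_mono)
  qed
  have r: "pv s y \<le> L" using Inv_le[OF For.prems(2), of L y] gL[of 0] by simp
  have "runs (t + pv s y * (tm L b + 4 * L + 20) + 2 * L + 8) (a + pv s y * al ?n L b)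
      (cfg w m (Loop i y b # k) (upd i 0 s)) ((?F ^^ pv s y) Q m (upd i 0 s))"
    by (rule loop[where j = 0]) (use For.prems(2) wf in \<open>auto simp: Inv_def\<close>)
  then have "runs (t + pv s y * (tm L b + 4 * L + 20) + 2 * L + 8 + 2 * pv s i + 7) (a + pv s y * al ?n L b)
      (cfg w m (Zero i # Loop i y b # k) s) ((?F ^^ pv s y) Q m (upd i 0 s))"
    by (rule runs_Zero)
  then have "runs (Suc (t + pv s y * (tm L b + 4 * L + 20) + 2 * L + 8 + 2 * pv s i + 7)) (a + pv s y * al ?n L b)
      (cfg w m (For i y b # k) s) ((?F ^^ pv s y) Q m (upd i 0 s))"
    by (rule runs_jump) auto
  moreover have "pv s y * al ?n L b \<le> al ?n L (For i y b)"
    using cnt gL[of 0] by (auto intro: mult_le_mono)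
  moreover have "pv s i \<le> L" using Inv_le[OF For.prems(2), of L i] gL[of 0] by simp
  moreover have "pv s y * (tm L b + 4 * L + 20) \<le> L * (tm L b + 4 * L + 20)"
    using r by (rule mult_le_mono1)
  ultimately show ?case
    unfolding wp.simps by (elim runs_mono) (unfold tm.simps, linarith, rule add_left_mono)
next
  case (Loop i y b)
  then show ?case by simp
qed

section \<open>Polynomial bounds for time and alternations\<close>

primrec nomode :: "com \<Rightarrow> bool" where
  "nomode Skip = True"
| "nomode (a ;; b) = (nomode a \<and> nomode b)"
| "nomode (Zero p) = True"
| "nomode (Inc p) = True"
| "nomode (Wr p f g) = True"
| "nomode (Cond p T a b) = (nomode a \<and> nomode b)"
| "nomode (Choice a b) = (nomode a \<and> nomode b)"
| "nomode (Mode m) = False"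
| "nomode (Halt v) = True"
| "nomode (For i y b) = nomode b"
| "nomode (Loop i y b) = True"

text \<open>A loop that may run exponentially often must not contain \<open>Mode\<close>; otherwise
  \<open>al\<close> would not be polynomial in the input length.\<close>

primrec awf :: "com \<Rightarrow> bool" where
  "awf Skip = True"
| "awf (a ;; b) = (awf a \<and> awf b)"
| "awf (Zero p) = True"
| "awf (Inc p) = True"
| "awf (Wr p f g) = True"
| "awf (Cond p T a b) = (awf a \<and> awf b)"
| "awf (Choice a b) = (awf a \<and> awf b)"
| "awf (Mode m) = True"
| "awf (Halt v) = True"
| "awf (For i y b) = (nomode b \<or> y = Pn \<and> awf b)"
| "awf (Loop i y b) = True"

lemma nomode_al: "nomode c \<Longrightarrow> al n L c = 0"
  by (induction c) auto

lemma poly_add: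
  fixes f g :: "'a \<Rightarrow> nat" and x :: "'a \<Rightarrow> nat"
  assumes "\<And>z. 1 \<le> x z" "\<exists>C d. \<forall>z. f z \<le> C * x z ^ d" "\<exists>C d. \<forall>z. g z \<le> C * x z ^ d"
  shows "\<exists>C d. \<forall>z. f z + g z \<le> C * x z ^ d"
proof -
  obtain C d where 1: "\<And>z. f z \<le> C * x z ^ d" using assms(2) by auto
  obtain C' d' where 2: "\<And>z. g z \<le> C' * x z ^ d'" using assms(3) by auto
  have "f z + g z \<le> (C + C') * x z ^ (d + d')" for z
  proof -
    have "x z ^ d \<le> x z ^ (d + d')" "x z ^ d' \<le> x z ^ (d + d')"
      using assms(1) by (auto intro!: power_increasing)
    then have "C * x z ^ d \<le> C * x z ^ (d + d')" "C' * x z ^ d' \<le> C' * x z ^ (d + d')"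
      by auto
    then show ?thesis using 1[of z] 2[of z] unfolding distrib_right by linarith
  qed
  then show ?thesis by blast
qed

lemma poly_mult:
  fixes f g :: "'a \<Rightarrow> nat" and x :: "'a \<Rightarrow> nat"
  assumes "\<exists>C d. \<forall>z. f z \<le> C * x z ^ d" "\<exists>C d. \<forall>z. g z \<le> C * x z ^ d"
  shows "\<exists>C d. \<forall>z. f z * g z \<le> C * x z ^ d"
proof -
  obtain C d where 1: "\<And>z. f z \<le> C * x z ^ d" using assms(1) by auto
  obtain C' d' where 2: "\<And>z. g z \<le> C' * x z ^ d'" using assms(2) by auto
  have "f z * g z \<le> (C * C') * x z ^ (d + d')" for z
    using mult_le_mono[OF 1[of z] 2[of z]] by (simp add: power_add mult.assoc mult.left_commute)
  then show ?thesis by blast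
qed

lemma poly_const: "\<exists>C d. \<forall>z. (c::nat) \<le> C * (x z::nat) ^ d"
  by (rule exI[of _ c], rule exI[of _ 0]) simp

lemma poly_self: "\<exists>C d. \<forall>z. (x z::nat) \<le> C * x z ^ d"
  by (rule exI[of _ 1], rule exI[of _ 1]) simp

lemma tm_poly: "\<exists>C d. \<forall>L. tm (Suc L) c \<le> C * Suc L ^ d"
proof (induction c)
  case (Seq c1 c2)
  then show ?case unfolding tm.simps by (intro poly_add poly_const) auto
next
  case (Cond p T c1 c2)
  then show ?case unfolding tm.simps by (intro poly_add poly_mult poly_const poly_self) auto
next
  case (Choice c1 c2)
  then show ?case unfolding tm.simps by (intro poly_add poly_const) auto
next
  case (For i y b)
  then show ?case unfolding tm.simps by (intro poly_add poly_mult poly_const poly_self) auto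
qed (unfold tm.simps, (intro poly_add poly_mult poly_const poly_self; simp)+)

text \<open>The bound is uniform in the second component, the end mark, which is exponential in the
  first: loops over other limits than \<open>Pn\<close> contribute 0.\<close>

lemma al_poly: "awf c \<Longrightarrow> \<exists>C d. \<forall>z. al (fst z) (snd z) c \<le> C * Suc (fst z) ^ d"
proof (induction c)
  case (For i y b)
  show ?case
  proof (cases "nomode b")
    case True
    then show ?thesis by (simp add: nomode_al)
  next
    case False
    then obtain C d where 1: "\<And>z. al (fst z) (snd z) b \<le> C * Suc (fst z) ^ d" and y: "y = Pn"
      using For by auto
    have "n * al n L b \<le> C * Suc n ^ Suc d" for n L
      using mult_le_mono[of n "Suc n" "al n L b" "C * Suc n ^ d"] 1[of "(n, L)"]
      by (simp add: mult.left_commute)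
    then show ?thesis using y by (intro exI[of _ C] exI[of _ "Suc d"]) simp
  qed
next
  case (Mode m)
  show ?case by (rule exI[of _ 1]) auto
qed (simp_all del: split_paired_All, (intro poly_add; simp del: split_paired_All)+)

section \<open>Deterministic programs as store transformers\<close>

primrec det :: "com \<Rightarrow> bool" where
  "det Skip = True"
| "det (a ;; b) = (det a \<and> det b)"
| "det (Zero p) = True"
| "det (Inc p) = True"
| "det (Wr p f g) = True"
| "det (Cond p T a b) = (det a \<and> det b)"
| "det (Choice a b) = False"
| "det (Mode m) = False"
| "det (Halt v) = False"
| "det (For i y b) = det b"
| "det (Loop i y b) = False"

primrec sem :: "sym list \<Rightarrow> com \<Rightarrow> st \<Rightarrow> st" where
  "sem w Skip = (\<lambda>s. s)"
| "sem w (a ;; b) = (\<lambda>s. sem w b (sem w a s))"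
| "sem w (Zero p) = upd p 0"
| "sem w (Inc p) = incp p"
| "sem w (Wr p f g) = wr p f g"
| "sem w (Cond p T a b) = (\<lambda>s. if T (cellat w s (pv s p)) then sem w a s else sem w b s)"
| "sem w (Choice a b) = (\<lambda>s. s)"
| "sem w (Mode m) = (\<lambda>s. s)"
| "sem w (Halt v) = (\<lambda>s. s)"
| "sem w (For i y b) = (\<lambda>s. ((\<lambda>s. incp i (sem w b s)) ^^ pv s y) (upd i 0 s))"
| "sem w (Loop i y b) = (\<lambda>s. s)"

lemma funpow_subst:
  fixes G :: "'s \<Rightarrow> 's" and Q :: "'m \<Rightarrow> 's \<Rightarrow> bool"
  shows "((\<lambda>Q' m s. Q' m (G s)) ^^ r) Q = (\<lambda>m s. Q m ((G ^^ r) s))"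
proof (induction r)
  case (Suc r)
  show ?case by (simp add: Suc funpow_swap1[of G])
qed simp

lemma wp_det: "det c \<Longrightarrow> wp w c Q = (\<lambda>m s. Q m (sem w c s))"
proof (induction c arbitrary: Q)
  case (For i y b)
  have b: "wp w b Q = (\<lambda>m s. Q m (sem w b s))" for Q using For by simp
  show ?case by (simp add: b funpow_subst)
qed auto

lemma det_nomode: "det c \<Longrightarrow> nomode c"
  by (induction c) auto

lemma nomode_awf: "nomode c \<Longrightarrow> awf c"
  by (induction c) auto

lemma sem_frame: "p \<notin> mods c \<Longrightarrow> pv (sem w c s) p = pv s p"
proof (induction c arbitrary: s)
  case (For i y b)
  have "pv (((\<lambda>s. incp i (sem w b s)) ^^ r) s) p = pv s p" for r s
    using For by (induction r arbitrary: s) (auto simp: pv_incp)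
  then show ?case using For by auto
qed (auto simp: pv_incp)

section \<open>From programs to alternating Turing machines\<close>

text \<open>The continuations met while \<open>c\<close> runs in front of \<open>k\<close>. A round
  of a loop ends in the continuation \<open>Loop i y b # k\<close> with which it began, and this is
  why finitely many are enough.\<close>

primrec conts :: "com \<Rightarrow> com list \<Rightarrow> com list set" where
  "conts Skip = (\<lambda>k. {Skip # k, k})"
| "conts (a ;; b) = (\<lambda>k. {(a ;; b) # k} \<union> conts a (b # k) \<union> conts b k)"
| "conts (Zero p) = (\<lambda>k. {Zero p # k, k})"
| "conts (Inc p) = (\<lambda>k. {Inc p # k, k})"
| "conts (Wr p f g) = (\<lambda>k. {Wr p f g # k, k})"
| "conts (Cond p T a b) = (\<lambda>k. {Cond p T a b # k} \<union> conts a k \<union> conts b k)"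
| "conts (Choice a b) = (\<lambda>k. {Choice a b # k} \<union> conts a k \<union> conts b k)"
| "conts (Mode m) = (\<lambda>k. {Mode m # k, k})"
| "conts (Halt v) = (\<lambda>k. {Halt v # k, k})"
| "conts (For i y b) = (\<lambda>k. {For i y b # k, Zero i # Loop i y b # k, Loop i y b # k,
     Cond i (marked y) Skip (b ;; Inc i ;; Loop i y b) # k, Skip # k, (b ;; Inc i ;; Loop i y b) # k,
     Inc i # Loop i y b # k, k} \<union> conts b ((Inc i ;; Loop i y b) # k))"
| "conts (Loop i y b) = (\<lambda>k. {Loop i y b # k,
     Cond i (marked y) Skip (b ;; Inc i ;; Loop i y b) # k, Skip # k, (b ;; Inc i ;; Loop i y b) # k,
     Inc i # Loop i y b # k, k} \<union> conts b ((Inc i ;; Loop i y b) # k))"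

lemma finite_conts: "finite (conts c k)"
  by (induction c arbitrary: k) auto

lemma conts_self: "c # k \<in> conts c k" "k \<in> conts c k"
  by (induction c arbitrary: k) auto

fun nexts :: "com \<Rightarrow> com list \<Rightarrow> com list set" where
  "nexts (a ;; b) k = {a # b # k}"
| "nexts (Choice a b) k = {a # k, b # k}"
| "nexts (Cond p T a b) k = {Cond p T a b # k, a # k, b # k}"
| "nexts (For i y b) k = {Zero i # Loop i y b # k}"
| "nexts (Loop i y b) k = {Cond i (marked y) Skip (b ;; Inc i ;; Loop i y b) # k}"
| "nexts c k = {c # k, k}"

lemma dl_nexts: "((m',ph',k''),g,d) \<in> dl c m ph k x \<Longrightarrow> k'' \<in> nexts c k"
  by (cases c) (auto split: if_splits)

text \<open>At \<open>k\<close> itself control has left \<open>c\<close>, hence the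
  exception.\<close>

lemma conts_closed: "c' # k' \<in> conts c k \<Longrightarrow> c' # k' \<noteq> k \<Longrightarrow> nexts c' k' \<subseteq> conts c k"
proof (induction c arbitrary: k)
  case (Seq a b)
  show ?case using Seq.prems Seq.IH(1)[of "b # k"] Seq.IH(2)[of k]
    by (cases "c' # k' = b # k") (auto simp: conts_self)
next
  case (Cond p T a b)
  show ?case using Cond.prems Cond.IH[of k] by (auto simp: conts_self)
next
  case (Choice a b)
  show ?case using Choice.prems Choice.IH[of k] by (auto simp: conts_self)
next
  case (For i y b)
  show ?case using For.prems For.IH[of "(Inc i ;; Loop i y b) # k"]
    by (cases "c' # k' = (Inc i ;; Loop i y b) # k") (auto simp: conts_self)
next
  case (Loop i y b)
  show ?case using Loop.prems Loop.IH[of "(Inc i ;; Loop i y b) # k"]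
    by (cases "c' # k' = (Inc i ;; Loop i y b) # k") (auto simp: conts_self)
qed auto

definition astates :: "com \<Rightarrow> astate set" where
  "astates c = UNIV \<times> {..8} \<times> conts c []"

lemma finite_astates: "finite (astates c)"
  by (auto simp: astates_def finite_conts)

lemma dl_phase: "((m',ph',k''),g,d) \<in> dl c m ph k x \<Longrightarrow> ph \<le> 8 \<Longrightarrow> ph' \<le> 8"
  by (cases c) (auto split: if_splits)

lemma deltaA_closed:
  assumes "q \<in> astates c" "(q',g,d) \<in> deltaA q x"
  shows "q' \<in> astates c"
proof -
  obtain m ph k m' ph' k' where q: "q = (m,ph,k)" "q' = (m',ph',k')"
    by (cases q, cases q')
  have k: "ph \<le> 8" "k \<in> conts c []" using assms(1) by (auto simp: astates_def q)
  have "ph' \<le> 8 \<and> k' \<in> conts c []"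
  proof (cases "4 \<le> ph \<or> k = []")
    case True
    then show ?thesis using assms(2) k unfolding q by (auto split: if_splits)
  next
    case False
    then obtain c' k1 where k1: "k = c' # k1" by (cases k) auto
    have d: "((m',ph',k'),g,d) \<in> dl c' m ph k1 x"
      using False assms(2) k k1 unfolding q by (auto split: if_splits)
    then show ?thesis using conts_closed[of c' k1 c "[]"] dl_phase[OF d k(1)] dl_nexts[OF d] k(2)
      unfolding k1 by blast
  qed
  then show ?thesis by (auto simp: astates_def q)
qed

lemma finite_cells: "finite (UNIV :: cell set)"
proof -
  have p: "finite (UNIV :: ptr set)"
  proof (rule finite_subset)
    show "(UNIV :: ptr set) \<subseteq> {Pn, PE, PZ, PI, PJ, PM, Ppol, Pph, Pit, Pix, PS, PT, PU, PK, PX, PY,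
      PW, PA, PB, PC, Pl1, Pl2, Pl3, Pl4, Pt1, Pt2, Pt3, Pok, Pdone, Pbad}" (is "_ \<subseteq> ?A")
    proof
      fix p :: ptr
      show "p \<in> ?A" by (cases p) simp_all
    qed
  qed simp
  have s: "finite (UNIV :: sym set)"
  proof (rule finite_subset)
    show "(UNIV :: sym set) \<subseteq> {SP, SNP, SCI, SInc, SAnd, SOr, STil, SB0, SB1, SSep}" (is "_ \<subseteq> ?A")
    proof
      fix p :: sym
      show "p \<in> ?A" by (cases p) simp_all
    qed
  qed simp
  have "(UNIV :: cell set) \<subseteq> insert LE ((\<lambda>(a,f,g,M). Cell a f g M) `
     (insert None (Some ` UNIV) \<times> UNIV \<times> UNIV \<times> Pow UNIV))"
  proof
    fix x :: cell
    show "x \<in> insert LE ((\<lambda>(a,f,g,M). Cell a f g M) `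
     (insert None (Some ` UNIV) \<times> UNIV \<times> UNIV \<times> Pow UNIV))"
      by (cases x) (auto simp: image_iff intro: option.exhaust)
  qed
  moreover have "finite (insert LE ((\<lambda>(a,f,g,M). Cell a f g M) `
     (insert None (Some ` UNIV) \<times> UNIV \<times> UNIV \<times> Pow UNIV)))"
    using p s by (intro finite.insertI finite_imageI finite_cartesian_product)
      (simp_all only: finite_Pow_iff finite_code)
  ultimately show ?thesis by (rule finite_subset)
qed

text \<open>States and symbols of an \<open>atm\<close> are numbers. The control states come from an
  infinite type, so \<open>eq\<close> can be injective only on the finitely many that
  \<open>c\<close> needs.\<close>

locale encoding =
  fixes c :: com and eq :: "astate \<Rightarrow> nat" and ec :: "cell \<Rightarrow> nat"
  assumes eq: "inj_on eq (astates c)" and ec: "inj ec"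
begin

definition M :: atm where
  "M = \<lparr>states = eq ` astates c, tape_alph = range ec, start = eq (True,4,[c]),
     blank = ec (Cell None False False {}), input = (\<lambda>a. ec (Cell (Some a) False False {})),
     kind_of = (\<lambda>q. kindA (inv_into (astates c) eq q)),
     delta = (\<lambda>q x. (\<lambda>(q',g,d). (eq q', ec g, d)) ` deltaA (inv_into (astates c) eq q) (inv ec x))\<rparr>"

definition emb :: "acfg \<Rightarrow> config" where
  "emb = (\<lambda>(q,tp,h). (eq q, ec \<circ> tp, h))"

lemma delta_M:
  "q \<in> astates c \<Longrightarrow> delta M (eq q) (ec x) = (\<lambda>(q',g,d). (eq q', ec g, d)) ` deltaA q x"
  using eq ec by (simp add: M_def)

lemma wf_M: "wf_atm M"
  unfolding wf_atm_def
proof (intro conjI ballI allI)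
  fix q x assume "q \<in> states M" "x \<in> tape_alph M"
  then obtain q0 x0 where q: "q = eq q0" "q0 \<in> astates c" and x: "x = ec x0"
    by (auto simp: M_def)
  have "(eq q', ec g, d) \<in> states M \<times> tape_alph M \<times> UNIV" if "(q',g,d) \<in> deltaA q0 x0" for q' g d
    using deltaA_closed[OF q(2) that] by (simp add: M_def)
  then show "delta M q x \<subseteq> states M \<times> tape_alph M \<times> UNIV"
    unfolding q(1) x delta_M[OF q(2)] by fastforce
next
  show "start M \<in> states M" by (simp add: M_def astates_def conts_self)
  show "input M a \<noteq> blank M" for a by (simp add: M_def inj_eq[OF ec])
qed (simp_all add: M_def finite_astates finite_cells)

lemma kind_emb: "fst k \<in> astates c \<Longrightarrow> kind_of M (fst (emb k)) = kindA (fst k)"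
  by (cases k) (auto simp: M_def emb_def eq)

lemma succs_emb:
  assumes "fst k \<in> astates c"
  shows "succs M (emb k) = emb ` succA k"
proof -
  obtain q tp h where k: "k = (q,tp,h)" by (cases k)
  have d: "delta M (eq q) (ec (tp h)) = (\<lambda>(q',g,d). (eq q', ec g, d)) ` deltaA q (tp h)"
    using assms by (simp add: delta_M k)
  have *: "(ec \<circ> tp)(h := ec g) = ec \<circ> tp(h := g)" for g by (auto simp: fun_eq_iff)
  have "succs M (emb k) = (\<lambda>(q',g,d). (q', (ec \<circ> tp)(h := g), h + mv d)) ` delta M (eq q) (ec (tp h))"
    by (force simp: k emb_def)
  also have "\<dots> = emb ` succA k"
    unfolding d k succA.simps image_image by (simp add: case_prod_unfold emb_def *)
  finally show ?thesis .
qed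

text \<open>Successors stay in \<open>astates c\<close>, where \<open>eq\<close> is injective, so
  the embedding preserves kinds, successors and alternations. Both halves come from one induction
  because \<open>runs\<close> carries the budgets and the value together.\<close>

lemma runs_emb:
  "runs t a k v \<Longrightarrow> fst k \<in> astates c \<Longrightarrow> bounded M t a (emb k) \<and> (accepts M t (emb k) \<longleftrightarrow> v)"
proof (induction rule: runs.induct)
  case (runs_acc k t a)
  then show ?case by (cases t) (auto simp: halting_def kind_emb)
next
  case (runs_rej k t a)
  then show ?case by (cases t) (auto simp: halting_def kind_emb)
next
  case (runs_step k t a V v)
  have cl: "fst k' \<in> astates c" if "k' \<in> succA k" for k'
    using that deltaA_closed[OF runs_step.prems] by (cases k) auto
  have alt: "alternation M (emb k) (emb k') \<longleftrightarrow> alternA k k'" if "k' \<in> succA k" for k'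
    using cl[OF that] runs_step.prems by (simp add: alternation_def alternA_def kind_emb)
  have IH: "bounded M t (a - (if alternA k k' then 1 else 0)) (emb k')"
    "accepts M t (emb k') \<longleftrightarrow> V k'" if "k' \<in> succA k" for k'
    using runs_step.IH[OF that cl[OF that]] by auto
  have bd: "if alternA k k' then a > 0 \<and> bounded M t (a - 1) (emb k') else bounded M t a (emb k')"
    if "k' \<in> succA k" for k'
    using IH(1)[OF that] runs_step.hyps(3)[OF that] by (auto split: if_splits)
  have "bounded M (Suc t) a (emb k)"
    unfolding bounded.simps succs_emb[OF runs_step.prems]
  proof (intro disjI2 ballI, elim imageE)
    fix x k' assume x: "x = emb k'" and k': "k' \<in> succA k"
    show "if alternation M (emb k) x then 0 < a \<and> bounded M t (a - 1) x else bounded M t a x"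
      using bd[OF k'] alt[OF k'] unfolding x by simp
  qed
  moreover have "accepts M (Suc t) (emb k) \<longleftrightarrow> v"
    using runs_step.hyps(1,4) IH(2)
    by (auto simp: kind_emb[OF runs_step.prems] succs_emb[OF runs_step.prems])
  ultimately show ?case ..
qed

end

section \<open>Preparation of the tape and resource bounds of the whole machine\<close>

definition s0 :: "sym list \<Rightarrow> st" where
  "s0 w = \<lparr>pv = (\<lambda>p. if p \<in> {Pn,PE} then length w else 0), fl = (\<lambda>_. False), gl = (\<lambda>_. False)\<rparr>"

definition tp0 :: "sym list \<Rightarrow> int \<Rightarrow> cell" where
  "tp0 w i = Cell (if 0 \<le> i \<and> i < int (length w) then Some (w ! nat i) else None) False False {}"

lemma runs_init:
  assumes "runs t a (cfg w True [c] (s0 w)) v" "simple c"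
  shows "runs (t + 2 * length w + 10) a ((True,4,[c]), tp0 w, 0) v"
proof -
  let ?t1 = "(tp0 w)(-1 := LE)"
  let ?t2 = "?t1(0 := mark (-{Pn,PE}) (?t1 0))"
  let ?n = "int (length w)"
  \<comment> \<open>For the empty input all pointers meet in cell 0, where the second marking adds
    to the first.\<close>
  have t: "?t2(?n := mark {Pn,PE} (?t2 ?n)) = tape w (s0 w)"
    by (auto simp: fun_eq_iff tp0_def tape_def cellat_def s0_def)
  have sym2: "symc (?t2 i) = (if i < ?n then Some (w ! nat i) else None)" if "0 \<le> i" for i
    using that by (auto simp: tp0_def)
  have "runs t a ((True,0,[c]), tape w (s0 w), -1) v" using assms(1) by (simp add: cfg_def)
  then have "runs (Suc t) a ((True,8,[c]), tape w (s0 w), -1) v"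
    by (rule runs_det) (use kind_simple[OF assms(2), of 0 True "[]"] in \<open>auto simp: fun_upd_idem\<close>)
  then have "runs (Suc t + length w) a ((True,8,[c]), tape w (s0 w), int (length w) - 1) v"
    by (rule runs_scan_left) (auto simp: tape_eq)
  then have "runs (Suc (Suc t + length w)) a ((True,7,[c]), ?t2, ?n) v"
    
    by (rule runs_det) (use sym2[of ?n] in \<open>auto simp: t simp del: fun_upd_apply\<close>)
  then have "runs (Suc (Suc t + length w)) a ((True,7,[c]), ?t2, 0 + ?n) v" by simp
  then have "runs (Suc (Suc t + length w) + length w) a ((True,7,[c]), ?t2, 0) v"
    by (rule runs_scan_right) (use sym2 in \<open>auto simp del: fun_upd_apply\<close>)
  then have "runs (Suc (Suc (Suc t + length w) + length w)) a ((True,6,[c]), ?t1, 0) v"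
    by (rule runs_det) (auto)
  then have "runs (Suc (Suc (Suc (Suc t + length w) + length w))) a ((True,5,[c]), tp0 w, -1) v"
    by (rule runs_det) (auto)
  then have "runs (Suc (Suc (Suc (Suc (Suc t + length w) + length w)))) a ((True,4,[c]), tp0 w, 0) v"
    by (rule runs_det) (auto simp: fun_upd_idem)
  then show ?thesis by (rule runs_mono) auto
qed

text \<open>If the end mark stays below L = 2^(e*n + e), the running time is polynomial in L, that
  is, 2 to a linear function of n, while the alternations are polynomial in n independently of
  L.\<close>

theorem AEXPTIME_polyI:
  assumes "wfc c" "awf c" "simple c"
    and "\<And>n. grow n c n \<le> 2 ^ (e * n + e)"
    and "\<And>w. wp w c (\<lambda>_ _. False) True (s0 w) \<longleftrightarrow> w \<in> A"
  shows "AEXPTIME_poly A"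
proof -
  obtain eq :: "astate \<Rightarrow> nat" where eq: "inj_on eq (astates c)"
    using finite_imp_inj_to_nat_seg[OF finite_astates] by blast
  obtain ec :: "cell \<Rightarrow> nat" where ec: "inj ec"
    using finite_imp_inj_to_nat_seg[OF finite_cells] by blast
  interpret encoding c eq ec by unfold_locales (fact eq ec)+
  obtain C d where tm: "\<And>L. tm (Suc L) c \<le> C * Suc L ^ d" using tm_poly by blast
  obtain C' d' where al: "\<And>n L. al n L c \<le> C' * Suc n ^ d'" using al_poly[OF assms(2)] by auto
  \<comment> \<open>One pair of constants has to serve for time and alternations. The exponent is
    positive, so that n is at most n^k, and exceeds the degree of \<open>al\<close>. The summands of
    \<open>b\<close> are the coefficients of the exponent of the running time, those of the
    alternations after replacing n + 1 by 2*n, and room for the preparation of the tape.\<close>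
  define k where "k = Suc d'"
  define b where "b = C + d * e + C' * 2 ^ d' + 12"
  have "bounded M (2 ^ (b * length w ^ k + b)) (b * length w ^ k + b) (init_conf M w) \<and>
     (w \<in> A \<longleftrightarrow> accepts M (2 ^ (b * length w ^ k + b)) (init_conf M w))" for w
  proof -
    let ?n = "length w"
    let ?L = "2 ^ (e * ?n + e) :: nat"
    have nk1: "?n \<le> ?n ^ k"
    proof (cases "?n = 0")
      case False
      then show ?thesis by (intro self_le_power) (auto simp: k_def Suc_le_eq)
    qed simp
    have nk2: "?n ^ d' \<le> ?n ^ k" if "?n \<noteq> 0"
      using that by (intro power_increasing) (auto simp: k_def Suc_le_eq)
    \<comment> \<open>Behind \<open>c\<close> the empty continuation rejects at once; hence the zero
      budgets and the post-condition \<open>False\<close>.\<close>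
    have "runs (0 + tm ?L c) (0 + al ?n ?L c) (cfg w True (c # []) (s0 w)) (wp w c (\<lambda>_ _. False) True (s0 w))"
    proof (rule sim[OF assms(1) _ assms(4)])
      show "Inv w ?n (s0 w)" by (auto simp: Inv_def s0_def)
      show "runs 0 0 (cfg w m [] s') False" for m s' by (rule runs_rej) (simp add: cfg_def)
    qed
    then have "runs (tm ?L c + 2 * ?n + 10) (al ?n ?L c) ((True,4,[c]), tp0 w, 0) (w \<in> A)"
      using assms(3,5) by (intro runs_init) auto
    then have R: "runs (2 ^ (b * ?n ^ k + b)) (b * ?n ^ k + b) ((True,4,[c]), tp0 w, 0) (w \<in> A)"
    proof (rule runs_mono)
      have "al ?n ?L c \<le> C' * Suc ?n ^ d'" by (rule al)
      also have "\<dots> \<le> C' * 2 ^ d' * ?n ^ k + C' * 2 ^ d'"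
      proof (cases "?n = 0")
        case False
        have "Suc ?n ^ d' \<le> (2 * ?n) ^ d'" using False by (intro power_mono) linarith+
        also have "\<dots> \<le> 2 ^ d' * ?n ^ k" using nk2[OF False] by (simp add: power_mult_distrib)
        finally have "C' * Suc ?n ^ d' \<le> C' * (2 ^ d' * ?n ^ k)" by (rule mult_le_mono2)
        then show ?thesis unfolding mult.assoc[symmetric] by (rule trans_le_add1)
      qed (simp add: trans_le_add2)
      also have "\<dots> \<le> b * ?n ^ k + b" by (intro add_mono mult_le_mono1) (auto simp: b_def)
      finally show "al ?n ?L c \<le> b * ?n ^ k + b" .
      have "tm ?L c \<le> C * ?L ^ d" using tm[of "?L - 1"] by simp
      also have "\<dots> \<le> 2 ^ C * ?L ^ d" by (intro mult_le_mono1) (simp add: less_imp_le)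
      also have "\<dots> = 2 ^ (C + (e * ?n + e) * d)" by (simp add: power_add power_mult)
      finally have 1: "tm ?L c \<le> 2 ^ (C + (e * ?n + e) * d)" .
      have "2 * ?n + 10 \<le> 2 * (?n + 5)" by simp
      also have "\<dots> \<le> 2 * 2 ^ (?n + 5)" by (intro mult_le_mono2 less_imp_le less_exp)
      also have "\<dots> = 2 ^ (?n + 6)" by (simp add: power_add)
      finally have 2: "2 * ?n + 10 \<le> 2 ^ (?n + 6)" .
      let ?x = "C + (e * ?n + e) * d" and ?y = "?n + 6"
      have "tm ?L c + 2 * ?n + 10 \<le> 2 ^ ?x + 2 ^ ?y" using 1 2 by simp
      also have "\<dots> \<le> 2 ^ (?x + ?y) + 2 ^ (?x + ?y)"
        by (intro add_mono power_increasing le_add1 le_add2) simp_all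
      also have "\<dots> = 2 ^ (?x + ?y + 1)" by (simp only: power_add power_one_right mult_2_right)
      also have "\<dots> \<le> 2 ^ (b * ?n ^ k + b)"
      proof (rule power_increasing)
        have "?x + ?y + 1 = (d * e + 1) * ?n + (C + e * d + 7)" by (simp add: algebra_simps)
        also have "\<dots> \<le> b * ?n ^ k + b"
          by (intro add_mono mult_le_mono nk1) (auto simp: b_def)
        finally show "?x + ?y + 1 \<le> b * ?n ^ k + b" .
      qed simp
      finally show "tm ?L c + 2 * ?n + 10 \<le> 2 ^ (b * ?n ^ k + b)" .
    qed
    have "init_conf M w = emb ((True,4,[c]), tp0 w, 0)"
      by (auto simp: init_conf_def emb_def M_def tp0_def fun_eq_iff)
    then show ?thesis
      using runs_emb[OF R] by (auto simp: astates_def conts_self)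
  qed
  then show ?thesis unfolding AEXPTIME_poly_def using wf_M by blast
qed

section \<open>First-order formulas over pointers\<close>

datatype fo = Tst ptr "cell \<Rightarrow> bool" | Neg fo | And fo fo | Ex ptr fo | Exec com fo

text \<open>The existential player claims that the formula has truth value \<open>v\<close>, so a
  negation just flips \<open>v\<close>. A witness is picked by him iff \<open>v\<close> holds, a
  conjunct iff \<open>v\<close> fails.\<close>

primrec ev :: "fo \<Rightarrow> bool \<Rightarrow> com" where
  "ev (Tst p T) = (\<lambda>v. Cond p T (Halt v) (Halt (\<not> v)))"
| "ev (Neg a) = (\<lambda>v. ev a (\<not> v))"
| "ev (And a b) = (\<lambda>v. Mode (\<not> v) ;; Choice (ev a v) (ev b v))"
| "ev (Ex x a) = (\<lambda>v. Mode v ;; Zero x ;; For Pix PE (Choice Skip (Inc x)) ;; ev a v)"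
| "ev (Exec c a) = (\<lambda>v. c ;; ev a v)"

text \<open>The semantics records the side effects of the evaluation: \<open>Exec\<close> changes
  the store, and the loop that picks a value leaves its counter \<open>Pix\<close> at
  \<open>PE\<close>. This makes the correspondence with \<open>ev\<close> exact.\<close>

primrec sat :: "sym list \<Rightarrow> fo \<Rightarrow> st \<Rightarrow> bool" where
  "sat w (Tst p T) = (\<lambda>s. T (cellat w s (pv s p)))"
| "sat w (Neg a) = (\<lambda>s. \<not> sat w a s)"
| "sat w (And a b) = (\<lambda>s. sat w a s \<and> sat w b s)"
| "sat w (Ex x a) = (\<lambda>s. \<exists>j\<le>pv s PE. sat w a (upd Pix (pv s PE) (upd x j s)))"
| "sat w (Exec c a) = (\<lambda>s. sat w a (sem w c s))"

primrec wff :: "fo \<Rightarrow> bool" where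
  "wff (Tst p T) = True"
| "wff (Neg a) = wff a"
| "wff (And a b) = (wff a \<and> wff b)"
| "wff (Ex x a) = (x \<notin> {Pix,PE,Pn} \<and> wff a)"
| "wff (Exec c a) = (det c \<and> wfc c \<and> wff a)"

definition Or :: "fo \<Rightarrow> fo \<Rightarrow> fo" where "Or a b = Neg (And (Neg a) (Neg b))"
definition All :: "ptr \<Rightarrow> fo \<Rightarrow> fo" where "All x a = Neg (Ex x (Neg a))"

lemma sat_derived [simp]:
  "sat w (Or a b) s \<longleftrightarrow> sat w a s \<or> sat w b s"
  "sat w (All x a) s \<longleftrightarrow> (\<forall>j\<le>pv s PE. sat w a (upd Pix (pv s PE) (upd x j s)))"
  by (auto simp: Or_def All_def)

lemma wff_derived [simp]:
  "wff (Or a b) \<longleftrightarrow> wff a \<and> wff b"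
  "wff (All x a) \<longleftrightarrow> x \<notin> {Pix,PE,Pn} \<and> wff a"
  by (auto simp: Or_def All_def)

definition pick :: "ptr \<Rightarrow> com" where
  "pick x = Zero x ;; For Pix PE (Choice Skip (Inc x))"

lemma incp_lt: "pv s p < pv s PE \<Longrightarrow> incp p s = upd p (Suc (pv s p)) s"
  by (auto simp: incp_def)

lemma pv_incp_other [simp]: "q \<noteq> p \<Longrightarrow> pv (incp p s) q = pv s q"
  by (simp add: pv_incp)

text \<open>In each of L rounds the player in charge skips or increments, so every value up to L can
  be reached and no increment saturates.\<close>

lemma wp_pick:
  assumes "x \<noteq> Pix" "x \<noteq> PE"
  shows "wp w (pick x) Q m s \<longleftrightarrow>
    (if m then \<exists>j\<le>pv s PE. Q m (upd Pix (pv s PE) (upd x j s))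
     else \<forall>j\<le>pv s PE. Q m (upd Pix (pv s PE) (upd x j s)))"
proof -
  let ?F = "\<lambda>Q'. wp w (Choice Skip (Inc x)) (\<lambda>m s. Q' m (incp Pix s))"
  let ?L = "pv s PE"
  have loop: "(?F ^^ r) Q m (upd Pix i (upd x j s)) \<longleftrightarrow>
    (if m then \<exists>j'. j \<le> j' \<and> j' \<le> j + r \<and> Q m (upd Pix ?L (upd x j' s))
     else \<forall>j'. j \<le> j' \<and> j' \<le> j + r \<longrightarrow> Q m (upd Pix ?L (upd x j' s)))"
    if "i + r = ?L" "j \<le> i" for r i j
    using that
  proof (induction r arbitrary: i j)
    case 0
    then show ?case by (auto simp: le_antisym)
  next
    case (Suc r)
    let ?s = "upd Pix i (upd x j s)"
    have 1: "incp Pix ?s = upd Pix (Suc i) (upd x j s)"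
      using Suc.prems assms by (auto simp: incp_lt)
    have 2: "incp Pix (incp x ?s) = upd Pix (Suc i) (upd x (Suc j) s)"
      using Suc.prems assms by (simp add: incp_lt upd_twist[of x Pix])
    \<comment> \<open>The values reachable in r + 1 rounds are those reachable in r rounds after
      skipping together with those after incrementing.\<close>
    have le: "j \<le> j' \<and> j' \<le> j + Suc r \<longleftrightarrow> (j \<le> j' \<and> j' \<le> j + r) \<or> (Suc j \<le> j' \<and> j' \<le> Suc j + r)" for j'
      by auto
    have le2: "j \<le> j' \<and> j' \<le> j + Suc r \<and> X \<longleftrightarrow>
      (j \<le> j' \<and> j' \<le> j + r \<and> X) \<or> (Suc j \<le> j' \<and> j' \<le> Suc j + r \<and> X)" for j' X
      using le[of j'] by blast
    have "(?F ^^ Suc r) Q m ?s \<longleftrightarrow>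
      (if m then (?F ^^ r) Q m (upd Pix (Suc i) (upd x j s)) \<or> (?F ^^ r) Q m (upd Pix (Suc i) (upd x (Suc j) s))
       else (?F ^^ r) Q m (upd Pix (Suc i) (upd x j s)) \<and> (?F ^^ r) Q m (upd Pix (Suc i) (upd x (Suc j) s)))"
      by (simp only: funpow.simps o_apply wp.simps 1 2)
    also have "\<dots> \<longleftrightarrow> (if m then \<exists>j'. j \<le> j' \<and> j' \<le> j + Suc r \<and> Q m (upd Pix ?L (upd x j' s))
     else \<forall>j'. j \<le> j' \<and> j' \<le> j + Suc r \<longrightarrow> Q m (upd Pix ?L (upd x j' s)))"
    proof -
      have IH: "(?F ^^ r) Q m (upd Pix (Suc i) (upd x j s)) \<longleftrightarrow>
          (if m then \<exists>j'. j \<le> j' \<and> j' \<le> j + r \<and> Q m (upd Pix ?L (upd x j' s))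
           else \<forall>j'. j \<le> j' \<and> j' \<le> j + r \<longrightarrow> Q m (upd Pix ?L (upd x j' s)))"
        "(?F ^^ r) Q m (upd Pix (Suc i) (upd x (Suc j) s)) \<longleftrightarrow>
          (if m then \<exists>j'. Suc j \<le> j' \<and> j' \<le> Suc j + r \<and> Q m (upd Pix ?L (upd x j' s))
           else \<forall>j'. Suc j \<le> j' \<and> j' \<le> Suc j + r \<longrightarrow> Q m (upd Pix ?L (upd x j' s)))"
        by (rule Suc.IH; use Suc.prems in linarith)+
      show ?thesis unfolding IH le le2 by (cases m; simp only: if_True if_False; blast)
    qed
    finally show ?case .
  qed
  have "wp w (pick x) Q m s = (?F ^^ ?L) Q m (upd Pix 0 (upd x 0 s))"
    using assms(2) by (auto simp: pick_def)
  then show ?thesis using loop[of 0 ?L 0] by (simp only: add_0 le0 simp_thms)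
qed

text \<open>Every branch of \<open>ev\<close> ends in \<open>Halt\<close>, and every choice is
  preceded by a \<open>Mode\<close>; so the value depends on the formula and the store
  alone.\<close>

lemma wp_ev: "wff F \<Longrightarrow> wp w (ev F v) Q m s \<longleftrightarrow> (sat w F s \<longleftrightarrow> v)"
proof (induction F arbitrary: v m s Q)
  case (Ex x a)
  then have x: "x \<noteq> Pix" "x \<noteq> PE" and a: "wff a" by auto
  have "wp w (ev (Ex x a) v) Q m s \<longleftrightarrow> wp w (pick x) (wp w (ev a v) Q) v s"
    by (simp add: pick_def)
  also have "\<dots> \<longleftrightarrow> (sat w (Ex x a) s \<longleftrightarrow> v)"
    unfolding wp_pick[OF x] Ex.IH[OF a] by auto
  finally show ?case .
qed (auto simp: wp_det)

lemma wfc_ev: "wff F \<Longrightarrow> wfc (ev F v)"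
  by (induction F arbitrary: v) auto

lemma awf_ev: "wff F \<Longrightarrow> awf (ev F v)"
  by (induction F arbitrary: v) (auto simp: det_nomode nomode_awf)

lemma grow_id: "PE \<notin> mods c \<Longrightarrow> grow n c l = l"
proof (induction c arbitrary: l)
  case (For i y b)
  have "(grow n b ^^ j) l = l" for j using For by (induction j) auto
  then show ?case by simp
qed auto

section \<open>Invariants of stores and loops\<close>

text \<open>\<open>PZ\<close> serves as the constant for tests against zero. The strict inequality
  makes \<open>PE\<close> positive even for the empty input, so that flags can be raised.\<close>

definition good :: "sym list \<Rightarrow> st \<Rightarrow> bool" where
  "good w s \<longleftrightarrow> pv s Pn = length w \<and> pv s PZ = 0 \<and> length w < pv s PE \<and> (\<forall>p. pv s p \<le> pv s PE)"

abbreviation "reserved \<equiv> {Pn, PZ, PE}"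

lemma sem_le:
  "PE \<notin> mods c \<Longrightarrow> (\<And>p. pv s p \<le> pv s PE) \<Longrightarrow> pv (sem w c s) p \<le> pv s PE"
proof (induction c arbitrary: s p)
  case (Seq c1 c2)
  then show ?case using sem_frame[of PE c1 w s] by (metis UnI1 UnI2 mods.simps(2) sem.simps(2))
next
  case (For i y b)
  have "pv (((\<lambda>s. incp i (sem w b s)) ^^ r) t) p \<le> pv s PE \<and>
     pv (((\<lambda>s. incp i (sem w b s)) ^^ r) t) PE = pv s PE"
    if "\<And>p. pv t p \<le> pv s PE" "pv t PE = pv s PE" for r p t
    using that
  proof (induction r arbitrary: t p)
    case (Suc r)
    have "pv (incp i (sem w b t)) q \<le> pv s PE" for q
      using For.IH[of t] Suc.prems For.prems sem_frame[of PE b w t]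
      by (auto simp: pv_incp Suc_leI le_neq_implies_less)
    moreover have "pv (incp i (sem w b t)) PE = pv s PE"
      using Suc.prems For.prems sem_frame[of PE b w t] by (auto simp: pv_incp)
    ultimately show ?case using Suc.IH[of "incp i (sem w b t)"]
      by (simp add: funpow_Suc_right del: funpow.simps)
  qed simp
  moreover have "pv (upd i 0 s) p \<le> pv s PE" "pv (upd i 0 s) PE = pv s PE" for p
    using For.prems by auto
  ultimately show ?case by simp
qed (auto simp: pv_incp Suc_leI le_neq_implies_less)

lemma good_sem: "good w s \<Longrightarrow> mods c \<inter> reserved = {} \<Longrightarrow> good w (sem w c s)"
  unfolding good_def using sem_le[of c s w] sem_frame[of _ c w s] by auto

lemma good_upd: "good w s \<Longrightarrow> x \<notin> reserved \<Longrightarrow> j \<le> pv s PE \<Longrightarrow> good w (upd x j s)"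
  by (auto simp: good_def)

lemma good_incp: "good w s \<Longrightarrow> x \<notin> reserved \<Longrightarrow> good w (incp x s)"
  using good_sem[of w s "Inc x"] by auto

lemma goodD: "good w s \<Longrightarrow> pv s Pn = length w" "good w s \<Longrightarrow> pv s PZ = 0"
  "good w s \<Longrightarrow> length w < pv s PE" "good w s \<Longrightarrow> pv s p \<le> pv s PE" "good w s \<Longrightarrow> 0 < pv s PE"
  by (auto simp: good_def)

text \<open>The invariant rule for deterministic loops, with \<open>P j\<close> for the store after
  j rounds. That \<open>good\<close> and the values of the other pointers persist follows from
  \<open>mods b\<close>, and the invariant step may use it.\<close>

lemma For_inv:
  assumes "good w s" "insert i (mods b) \<inter> reserved = {}"
    "P 0 (upd i 0 s)"
    "\<And>j t. j < pv s y \<Longrightarrow> good w t \<Longrightarrow> (\<And>p. p \<notin> insert i (mods b) \<Longrightarrow> pv t p = pv s p) \<Longrightarrow> P j t \<Longrightarrow>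
       P (Suc j) (incp i (sem w b t))"
  shows "P (pv s y) (sem w (For i y b) s)"
proof -
  have "j \<le> pv s y \<Longrightarrow> good w (((\<lambda>s. incp i (sem w b s)) ^^ j) (upd i 0 s)) \<and>
     (\<forall>p. p \<notin> insert i (mods b) \<longrightarrow> pv (((\<lambda>s. incp i (sem w b s)) ^^ j) (upd i 0 s)) p = pv s p) \<and>
     P j (((\<lambda>s. incp i (sem w b s)) ^^ j) (upd i 0 s))" for j
  proof (induction j)
    case 0
    then show ?case using assms by (auto intro: good_upd)
  next
    case (Suc j)
    let ?t = "((\<lambda>s. incp i (sem w b s)) ^^ j) (upd i 0 s)"
    have "good w (incp i (sem w b ?t))"
      using Suc assms(2) by (intro good_incp good_sem) auto
    moreover have "P (Suc j) (incp i (sem w b ?t))"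
      using Suc by (intro assms(4)) auto
    moreover have "pv (incp i (sem w b ?t)) p = pv s p" if "p \<notin> insert i (mods b)" for p
      using Suc that by (auto simp: sem_frame)
    ultimately show ?case by simp
  qed
  then show ?thesis by auto
qed

primrec nowr :: "com \<Rightarrow> bool" where
  "nowr Skip = True"
| "nowr (a ;; b) = (nowr a \<and> nowr b)"
| "nowr (Zero p) = True"
| "nowr (Inc p) = True"
| "nowr (Wr p f g) = False"
| "nowr (Cond p T a b) = (nowr a \<and> nowr b)"
| "nowr (Choice a b) = (nowr a \<and> nowr b)"
| "nowr (Mode m) = True"
| "nowr (Halt v) = True"
| "nowr (For i y b) = nowr b"
| "nowr (Loop i y b) = True"

lemma sem_fl: "nowr c \<Longrightarrow> fl (sem w c s) = fl s"
proof (induction c arbitrary: s)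
  case (For i y b)
  have "fl (((\<lambda>s. incp i (sem w b s)) ^^ r) s) = fl s" for r s
    using For by (induction r arbitrary: s) auto
  then show ?case using For by auto
qed auto

section \<open>Occurrences of words in the input\<close>

definition symat :: "sym list \<Rightarrow> nat \<Rightarrow> sym option" where
  "symat w i = (if i < length w then Some (w ! i) else None)"

lemma symc_cellat [simp]: "symc (cellat w s i) = symat w i"
  by (simp add: symat_def cellat_def)

lemma symat_less: "symat w i = Some a \<Longrightarrow> i < length w"
  by (auto simp: symat_def split: if_splits)

primrec occ :: "sym list \<Rightarrow> nat \<Rightarrow> sym list \<Rightarrow> bool" where
  "occ w i [] = True"
| "occ w i (x # u) = (symat w i = Some x \<and> occ w (Suc i) u)"

lemma occ_append [simp]: "occ w i (u @ v) \<longleftrightarrow> occ w i u \<and> occ w (i + length u) v"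
  by (induction u arbitrary: i) auto

lemma occ_drop: "occ w i u \<longleftrightarrow> u = [] \<or> (\<exists>v. drop i w = u @ v)"
proof (induction u arbitrary: i)
  case (Cons x u)
  show ?case
  proof (cases "i < length w")
    case True
    then have "drop i w = w ! i # drop (Suc i) w" by (simp add: Cons_nth_drop_Suc)
    moreover have "occ w i (x # u) \<longleftrightarrow> w ! i = x \<and> occ w (Suc i) u"
      using True by (simp add: symat_def)
    moreover have "occ w (Suc i) u \<longleftrightarrow> (\<exists>v. drop (Suc i) w = u @ v)"
      using Cons.IH[of "Suc i"] by (cases "u = []") simp_all
    ultimately show ?thesis by auto
  qed (auto simp: symat_def)
qed simp

lemma occ_length: "occ w i u \<Longrightarrow> u \<noteq> [] \<Longrightarrow> i + length u \<le> length w"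
proof -
  assume "occ w i u" "u \<noteq> []"
  then obtain v where "drop i w = u @ v" by (auto simp: occ_drop)
  then have "length w - i = length u + length v" by (metis length_append length_drop)
  then show ?thesis using \<open>u \<noteq> []\<close> by (cases u) auto
qed

lemma occ_whole: "occ w 0 u \<and> length u = length w \<longleftrightarrow> u = w"
  by (auto simp: occ_drop)

definition isym :: "sym \<Rightarrow> cell \<Rightarrow> bool" where "isym a c \<longleftrightarrow> symc c = Some a"
definition nz :: "cell \<Rightarrow> bool" where "nz c \<longleftrightarrow> \<not> marked PZ c"

lemma isym_cellat [simp]: "isym a (cellat w s i) \<longleftrightarrow> symat w i = Some a"
  by (simp add: isym_def)

lemma nz_cellat [simp]: "good w s \<Longrightarrow> nz (cellat w s i) \<longleftrightarrow> i \<noteq> 0"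
  by (auto simp: nz_def goodD)

text \<open>Pointers can only be reset and incremented, so copying means counting.\<close>

definition copy :: "ptr \<Rightarrow> ptr \<Rightarrow> com" where
  "copy x y = Zero x ;; For Pl4 y (Inc x)"

lemma copy_simps [simp]: "mods (copy x y) = {x, Pl4}" "det (copy x y)" "nowr (copy x y)"
  "wfc (copy x y) \<longleftrightarrow> x \<noteq> Pn \<and> x \<noteq> PE \<and> Pl4 \<noteq> y \<and> Pl4 \<noteq> x \<and> y \<noteq> x"
  by (auto simp: copy_def)

lemma sem_copy:
  assumes "good w s" "x \<notin> reserved" "x \<noteq> y" "x \<noteq> Pl4" "y \<noteq> Pl4"
  shows "pv (sem w (copy x y) s) x = pv s y"
proof -
  have g: "good w (upd x 0 s)" using assms by (auto intro: good_upd)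
  have "pv (sem w (For Pl4 y (Inc x)) (upd x 0 s)) x = pv (upd x 0 s) y"
  proof (rule For_inv[OF g, where P = "\<lambda>j t. pv t x = j"])
    fix j t assume "j < pv (upd x 0 s) y" "good w t" "pv t x = j"
      "\<And>p. p \<notin> insert Pl4 (mods (Inc x)) \<Longrightarrow> pv t p = pv (upd x 0 s) p"
    moreover from this(4)[of y] have "pv t y = pv s y" using assms by auto
    ultimately have "j < pv t PE" using assms goodD(4)[of w t y] by auto
    then show "pv (incp Pl4 (sem w (Inc x) t)) x = Suc j"
      using assms \<open>pv t x = j\<close> by (simp add: pv_incp)
  qed (use assms in auto)
  then show ?thesis using assms by (simp add: copy_def)
qed

definition flag :: "ptr \<Rightarrow> com" where "flag p = Zero p ;; Inc p"

lemma flag_simps [simp]: "mods (flag x) = {x}" "det (flag x)" "nowr (flag x)"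
  "wfc (flag x) \<longleftrightarrow> x \<noteq> Pn \<and> x \<noteq> PE"
  by (auto simp: flag_def)

lemma sem_flag: "good w s \<Longrightarrow> p \<notin> reserved \<Longrightarrow> sem w (flag p) s = upd p 1 s"
  by (auto simp: flag_def incp_lt goodD)

section \<open>Tokens and tuples\<close>

declare bits.simps [simp del]

lemma bits_Suc: "0 < n \<Longrightarrow> bits (2 * n) = bits n @ [SB0]" "0 < n \<Longrightarrow> bits (Suc (2 * n)) = bits n @ [SB1]"
  by (subst bits.simps; simp)+

lemma bits_0_1: "bits 0 = [SB0]" "bits (Suc 0) = [SB1]"
  by (subst bits.simps; simp)+

lemma bits_pos: "0 < n \<Longrightarrow> \<exists>l. bits n = SB1 # l \<and> set l \<subseteq> {SB0,SB1}"
proof (induction n rule: less_induct)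
  case (less n)
  show ?case
  proof (cases "n < 2")
    case True
    then have "n = Suc 0" using less by simp
    then show ?thesis by (simp add: bits_0_1)
  next
    case False
    then obtain l where "bits (n div 2) = SB1 # l" "set l \<subseteq> {SB0,SB1}"
      using less(1)[of "n div 2"] by auto
    then show ?thesis using False by (subst bits.simps) auto
  qed
qed

lemma bits_cases:
  obtains "n = 0" "bits n = [SB0]" | l where "bits n = SB1 # l" "set l \<subseteq> {SB0,SB1}"
  using bits_pos[of n] by (cases "n = 0") (auto simp: bits_0_1)

lemma bits_set: "set (bits n) \<subseteq> {SB0,SB1}" "bits n \<noteq> []"
  by (cases n rule: bits_cases; auto)+

text \<open>Together with \<open>bits_pos\<close>: the numerals are exactly \<open>[SB0]\<close> and
  the bit words that begin with \<open>SB1\<close>. This simple shape is what \<open>chktok\<close>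
  tests.\<close>

lemma bits_surj: "set l \<subseteq> {SB0,SB1} \<Longrightarrow> \<exists>n>0. bits n = SB1 # l"
proof (induction l rule: rev_induct)
  case Nil
  show ?case by (rule exI[of _ "Suc 0"]) (simp add: bits_0_1)
next
  case (snoc x l)
  then obtain n where n: "0 < n" "bits n = SB1 # l" by auto
  show ?case
  proof (cases "x = SB0")
    case True
    then show ?thesis using n by (intro exI[of _ "2 * n"]) (simp add: bits_Suc)
  next
    case False
    then show ?thesis using n snoc.prems by (intro exI[of _ "Suc (2 * n)"]) (simp add: bits_Suc)
  qed
qed

lemma bits_val: "foldl (\<lambda>v b. 2 * v + (if b = SB1 then 1 else 0)) 0 (bits n) = n"
proof (induction n rule: less_induct)
  case (less n)
  show ?case
  proof (cases "n < 2")
    case True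
    then show ?thesis by (subst bits.simps) auto
  next
    case False
    then show ?thesis using less[of "n div 2"] by (subst bits.simps) (auto, presburger)
  qed
qed

lemma bits_inj: "bits p = bits q \<Longrightarrow> p = q"
  by (metis bits_val)

text \<open>Numerals consist of bits, so the first separator ends the token: tokens form a prefix
  code.\<close>

lemma enc_nat_inj: "enc_nat p @ v = enc_nat q @ v' \<Longrightarrow> p = q \<and> v = v'"
proof -
  assume eq: "enc_nat p @ v = enc_nat q @ v'"
  have tw: "takeWhile (\<lambda>x. x \<noteq> SSep) (enc_nat p @ v) = bits p" for p v
  proof -
    have "\<forall>x\<in>set (bits p). x \<noteq> SSep" using bits_set(1)[of p] by auto
    then show ?thesis by (simp add: enc_nat_def takeWhile_append2)
  qed
  have "p = q" using tw[of p v] tw[of q v'] eq by (metis bits_inj)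
  then show ?thesis using eq by simp
qed

lemma enc_nat_hd: "\<exists>l. enc_nat p = SB0 # l \<or> enc_nat p = SB1 # l"
  by (cases p rule: bits_cases) (auto simp: enc_nat_def)

lemma enc_nat_ne [simp]: "enc_nat p \<noteq> []"
  by (simp add: enc_nat_def)

lemma occ_inj: "occ w i u \<Longrightarrow> occ w i u' \<Longrightarrow> u \<noteq> [] \<Longrightarrow> u' \<noteq> [] \<Longrightarrow> \<exists>v v'. u @ v = u' @ v'"
  by (metis occ_drop)

lemma occ_enc_nat_inj: "occ w i (enc_nat p) \<Longrightarrow> occ w i (enc_nat q) \<Longrightarrow> p = q"
  using occ_inj enc_nat_inj enc_nat_ne by metis

definition toks :: "nat list \<Rightarrow> sym list" where "toks ps = concat (map enc_nat ps)"

lemma enc_tuple_toks: "enc_tuple ps = toks ps @ [SSep]"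
  by (simp add: enc_tuple_def toks_def)

lemma toks_simps [simp]: "toks [] = []" "toks (p # ps) = enc_nat p @ toks ps" "toks (ps @ qs) = toks ps @ toks qs"
  by (auto simp: toks_def)

text \<open>Every token begins with a bit, so a separator at a token boundary can only be the
  closing one.\<close>

lemma enc_tuple_inj: "enc_tuple ps @ v = enc_tuple qs @ v' \<Longrightarrow> ps = qs \<and> v = v'"
proof (induction ps arbitrary: qs)
  case Nil
  then show ?case
  proof (cases qs)
    case (Cons q qs')
    then show ?thesis using Nil enc_nat_hd[of q] by (auto simp: enc_tuple_toks)
  qed (auto simp: enc_tuple_toks)
next
  case (Cons p ps)
  show ?case
  proof (cases qs)
    case Nil
    then show ?thesis using Cons enc_nat_hd[of p] by (auto simp: enc_tuple_toks)
  next
    case (Cons q qs')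
    then have "enc_nat p @ enc_tuple ps @ v = enc_nat q @ enc_tuple qs' @ v'"
      using Cons.prems by (simp add: enc_tuple_toks)
    then show ?thesis using enc_nat_inj Cons.IH Cons by blast
  qed
qed

lemma enc_tuple_ne [simp]: "enc_tuple ps \<noteq> []"
  by (simp add: enc_tuple_def)

lemma occ_enc_tuple_inj: "occ w i (enc_tuple p) \<Longrightarrow> occ w i (enc_tuple q) \<Longrightarrow> p = q"
  using occ_inj enc_tuple_inj enc_tuple_ne by metis

text \<open>Polish notation: the first symbol determines the constructor, and the codes of the
  arguments can be split off one after the other.\<close>

lemma enc_inj: "enc \<phi> @ v = enc \<psi> @ v' \<Longrightarrow> \<phi> = \<psi> \<and> v = v'"
proof (induction \<phi> arbitrary: \<psi> v v')
  case (Atom p)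
  then show ?case by (cases \<psi>) (auto dest: enc_nat_inj)
next
  case (NegAtom p)
  then show ?case by (cases \<psi>) (auto dest: enc_nat_inj)
next
  case (CondIndep q p r)
  then show ?case by (cases \<psi>) (auto dest!: enc_tuple_inj)
next
  case (Incl p q)
  then show ?case by (cases \<psi>) (auto dest!: enc_tuple_inj)
next
  case (Conj a b)
  from Conj.prems obtain a' b' where \<psi>: "\<psi> = Conj a' b'" by (cases \<psi>) auto
  then have "enc a @ enc b @ v = enc a' @ enc b' @ v'" using Conj.prems by simp
  then show ?case using Conj.IH \<psi> by blast
next
  case (Disj a b)
  from Disj.prems obtain a' b' where \<psi>: "\<psi> = Disj a' b'" by (cases \<psi>) auto
  then have "enc a @ enc b @ v = enc a' @ enc b' @ v'" using Disj.prems by simp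
  then show ?case using Disj.IH \<psi> by blast
next
  case (Tilde a)
  then show ?case by (cases \<psi>) auto
qed

lemma enc_ne [simp]: "enc \<phi> \<noteq> []"
  by (cases \<phi>) auto

lemma occ_enc_inj: "occ w i (enc p) \<Longrightarrow> occ w i (enc q) \<Longrightarrow> p = q"
  using occ_inj enc_inj enc_ne by metis

definition isbit :: "cell \<Rightarrow> bool" where "isbit c \<longleftrightarrow> isym SB0 c \<or> isym SB1 c"

lemma isbit_cellat [simp]: "isbit (cellat w s i) \<longleftrightarrow> symat w i = Some SB0 \<or> symat w i = Some SB1"
  by (simp add: isbit_def)

section \<open>Parsing tokens and tuples on the tape\<close>

definition sepstep :: "ptr \<Rightarrow> com" where
  "sepstep x = Cond x (isym SSep) (Inc x) (flag Pbad)"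

definition chktok :: "ptr \<Rightarrow> com" where
  "chktok x = Cond x (isym SB0) (Inc x ;; sepstep x)
     (Cond x (isym SB1) (Inc x ;; For Pl1 Pn (Cond x isbit (Inc x) Skip) ;; sepstep x) (flag Pbad))"

text \<open>At the closing separator of a tuple it rests, so it may be iterated more often than the
  tuple has entries.\<close>

definition gtok :: "ptr \<Rightarrow> com" where
  "gtok x = Cond x (isym SSep) Skip (chktok x)"

definition chktup :: "ptr \<Rightarrow> com" where
  "chktup x = For Pl2 Pn (gtok x) ;; sepstep x"

lemma chk_simps [simp]:
  "mods (sepstep x) = {x,Pbad}" "det (sepstep x)" "nowr (sepstep x)" "wfc (sepstep x) \<longleftrightarrow> x \<noteq> Pn"
  "mods (chktok x) = {x,Pbad,Pl1}" "det (chktok x)" "nowr (chktok x)"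
  "wfc (chktok x) \<longleftrightarrow> x \<noteq> Pn \<and> x \<noteq> Pl1"
  "mods (gtok x) = {x,Pbad,Pl1}" "det (gtok x)" "nowr (gtok x)"
  "wfc (gtok x) \<longleftrightarrow> x \<noteq> Pn \<and> x \<noteq> Pl1"
  "mods (chktup x) = {x,Pbad,Pl1,Pl2}" "det (chktup x)" "nowr (chktup x)"
  "wfc (chktup x) \<longleftrightarrow> x \<noteq> Pn \<and> x \<noteq> Pl1 \<and> x \<noteq> Pl2"
  by (auto simp: sepstep_def chktok_def gtok_def chktup_def)

lemma inc_symat:
  assumes "good w s" "symat w (pv s x) = Some a"
  shows "incp x s = upd x (Suc (pv s x)) s"
  using assms symat_less[OF assms(2)] goodD(3)[OF assms(1)] by (intro incp_lt) auto

lemma sem_sepstep: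
  assumes "good w s" "x \<notin> reserved \<union> {Pbad}"
  shows "pv (sem w (sepstep x) s) x = (if symat w (pv s x) = Some SSep then Suc (pv s x) else pv s x)"
    "pv (sem w (sepstep x) s) Pbad = (if symat w (pv s x) = Some SSep then pv s Pbad else 1)"
  using assms by (auto simp: sepstep_def inc_symat sem_flag)

text \<open>Both words are the maximal block of letters from \<open>B\<close> that starts at
  \<open>i\<close>.\<close>

lemma occ_bits_max:
  "occ w i l \<Longrightarrow> occ w i l' \<Longrightarrow> set l \<subseteq> B \<Longrightarrow> set l' \<subseteq> B \<Longrightarrow>
   symat w (i + length l) \<notin> Some ` B \<Longrightarrow> symat w (i + length l') \<notin> Some ` B \<Longrightarrow> l = l'"
proof (induction l arbitrary: l' i)
  case Nil
  then show ?case by (cases l') auto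
next
  case (Cons x l)
  then show ?case by (cases l') auto
qed

lemma sem_bitloop:
  assumes "good w s" "x \<notin> reserved \<union> {Pbad,Pl1}" "pv s x \<le> length w"
  defines "s' \<equiv> sem w (For Pl1 Pn (Cond x isbit (Inc x) Skip)) s"
  shows "\<exists>l. set l \<subseteq> {SB0,SB1} \<and> occ w (pv s x) l \<and> pv s' x = pv s x + length l \<and>
     symat w (pv s' x) \<notin> Some ` {SB0,SB1}"
proof -
  \<comment> \<open>Either every round so far has advanced \<open>x\<close>, or the block of bits
    has ended and \<open>x\<close> rests.\<close>
  let ?P = "\<lambda>j t. \<exists>l. set l \<subseteq> {SB0,SB1} \<and> occ w (pv s x) l \<and> pv t x = pv s x + length l \<and>
     (length l = j \<or> symat w (pv t x) \<notin> Some ` {SB0,SB1})"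
  have "?P (pv s Pn) s'" unfolding s'_def
  proof (rule For_inv[OF assms(1), where P = ?P])
    fix j t assume t: "good w t" "?P j t"
    then obtain l where l: "set l \<subseteq> {SB0,SB1}" "occ w (pv s x) l" "pv t x = pv s x + length l"
      "length l = j \<or> symat w (pv t x) \<notin> Some ` {SB0,SB1}" by blast
    show "?P (Suc j) (incp Pl1 (sem w (Cond x isbit (Inc x) Skip) t))"
    proof (cases "symat w (pv t x) \<in> Some ` {SB0,SB1}")
      case True
      then obtain b where b: "symat w (pv t x) = Some b" "b \<in> {SB0,SB1}" by auto
      have "sem w (Cond x isbit (Inc x) Skip) t = upd x (Suc (pv t x)) t"
        using b inc_symat[OF t(1) b(1)] by auto
      then show ?thesis using l b assms by (intro exI[of _ "l @ [b]"]) auto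
    next
      case False
      then have "sem w (Cond x isbit (Inc x) Skip) t = t" by auto
      then show ?thesis using l False assms by (intro exI[of _ l]) auto
    qed
  qed (use assms in auto)
  then obtain l where l: "set l \<subseteq> {SB0,SB1}" "occ w (pv s x) l" "pv s' x = pv s x + length l"
      "length l = length w \<or> symat w (pv s' x) \<notin> Some ` {SB0,SB1}" using goodD(1)[OF assms(1)] by auto
  \<comment> \<open>A block as long as the whole input ends behind the input, where there is no
    symbol.\<close>
  have "symat w (pv s' x) \<notin> Some ` {SB0,SB1}" if "length l = length w"
    using that l(3) by (auto simp: symat_def)
  then show ?thesis using l by blast
qed

lemma sem_chktok:
  assumes "good w s" "x \<notin> reserved \<union> {Pbad,Pl1}"
  defines "s' \<equiv> sem w (chktok x) s"
  shows "pv s' Pbad = pv s Pbad \<and>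
      (\<exists>p. occ w (pv s x) (enc_nat p) \<and> pv s' x = pv s x + length (enc_nat p)) \<or>
    pv s' Pbad = 1 \<and> (\<forall>p. \<not> occ w (pv s x) (enc_nat p))"
proof -
  let ?i = "pv s x"
  have ne: "x \<noteq> Pbad" "Pbad \<noteq> x" "x \<noteq> Pl1" "Pl1 \<noteq> x" "x \<notin> reserved \<union> {Pbad}" using assms(2) by auto
  consider "symat w ?i = Some SB0" | "symat w ?i = Some SB1" | "symat w ?i \<notin> Some ` {SB0,SB1}"
    by auto
  then show ?thesis
  proof cases
    case 1
    let ?t = "upd x (Suc ?i) s"
    have t: "good w ?t" using assms 1 symat_less[OF 1] goodD(3)[OF assms(1)] by (intro good_upd) auto
    have s': "s' = sem w (sepstep x) ?t" using 1 by (simp add: s'_def chktok_def inc_symat[OF assms(1) 1])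
    show ?thesis
    proof (cases "symat w (Suc ?i) = Some SSep")
      case True
      then have "occ w ?i (enc_nat 0)" "length (enc_nat 0) = 2" using 1 by (simp_all add: enc_nat_def bits_0_1)
      moreover have "pv s' x = ?i + 2" "pv s' Pbad = pv s Pbad"
        using True sem_sepstep[OF t, of x] ne unfolding s' by simp_all
      ultimately show ?thesis by metis
    next
      case False
      have "\<not> occ w ?i (enc_nat p)" for p
        using 1 False by (cases p rule: bits_cases) (auto simp: enc_nat_def)
      moreover have "pv s' Pbad = 1" using False sem_sepstep(2)[OF t, of x] ne unfolding s' by simp
      ultimately show ?thesis by metis
    qed
  next
    case 2
    let ?t = "upd x (Suc ?i) s"
    let ?u = "sem w (For Pl1 Pn (Cond x isbit (Inc x) Skip)) ?t"
    have t: "good w ?t" using assms 2 symat_less[OF 2] goodD(3)[OF assms(1)] by (intro good_upd) auto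
    have u: "good w ?u" by (rule good_sem[OF t]) (use assms in auto)
    obtain l where l: "set l \<subseteq> {SB0,SB1}" "occ w (Suc ?i) l" "pv ?u x = Suc ?i + length l"
      "symat w (pv ?u x) \<notin> Some ` {SB0,SB1}"
      using sem_bitloop[OF t assms(2)] symat_less[OF 2] by auto
    have ub: "pv ?u Pbad = pv s Pbad" using ne by (subst sem_frame) auto
    have s': "s' = sem w (sepstep x) ?u" using 2 by (simp add: s'_def chktok_def inc_symat[OF assms(1) 2])
    show ?thesis
    proof (cases "symat w (pv ?u x) = Some SSep")
      case True
      obtain p where "bits p = SB1 # l" using bits_surj[OF l(1)] by auto
      then have "occ w ?i (enc_nat p)" "length (enc_nat p) = length l + 2"
        using 2 l True by (simp_all add: enc_nat_def)
      moreover have "pv s' x = ?i + (length l + 2)" "pv s' Pbad = pv s Pbad"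
        using True sem_sepstep[OF u, of x] ne l(3) ub unfolding s' by simp_all
      ultimately show ?thesis by metis
    next
      case False
      have "\<not> occ w ?i (enc_nat p)" for p
      proof
        assume o: "occ w ?i (enc_nat p)"
        obtain l' where l': "bits p = SB1 # l'" "set l' \<subseteq> {SB0,SB1}"
          using o 2 by (cases p rule: bits_cases) (auto simp: enc_nat_def)
        have "l = l'" by (rule occ_bits_max[OF l(2) _ l(1) l'(2)]) (use o l l' in \<open>auto simp: enc_nat_def\<close>)
        then show False using False o l l' by (auto simp: enc_nat_def)
      qed
      moreover have "pv s' Pbad = 1" using False sem_sepstep(2)[OF u, of x] ne unfolding s' by simp
      ultimately show ?thesis by metis
    qed
  next
    case 3
    have "\<not> occ w ?i (enc_nat p)" for p
      using 3 by (cases p rule: bits_cases) (auto simp: enc_nat_def)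
    moreover have "s' = upd Pbad 1 s" using 3 assms(1) by (auto simp: s'_def chktok_def sem_flag)
    then have "pv s' Pbad = 1" by simp
    ultimately show ?thesis by metis
  qed
qed

text \<open>For \<open>j\<close> beyond the length, \<open>take\<close> yields the whole list and
  the position is that of the closing separator; at all earlier boundaries a bit stands.\<close>

lemma toks_occ_nth:
  assumes "occ w i (enc_tuple ps)"
  shows "symat w (i + length (toks (take j ps))) = Some SSep \<longleftrightarrow> length ps \<le> j"
    "j < length ps \<Longrightarrow> occ w (i + length (toks (take j ps))) (enc_nat (ps ! j))"
proof -
  show 1: "occ w (i + length (toks (take j ps))) (enc_nat (ps ! j))" if "j < length ps" for j
  proof -
    have "ps = take j ps @ ps ! j # drop (Suc j) ps" using that by (simp add: id_take_nth_drop)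
    then have "enc_tuple ps = toks (take j ps) @ enc_nat (ps ! j) @ toks (drop (Suc j) ps) @ [SSep]"
      by (metis append.assoc enc_tuple_toks toks_simps(2,3))
    then show ?thesis using assms by simp
  qed
  show "symat w (i + length (toks (take j ps))) = Some SSep \<longleftrightarrow> length ps \<le> j"
  proof (cases "j < length ps")
    case True
    then show ?thesis using 1[OF True] enc_nat_hd[of "ps ! j"] by auto
  next
    case False
    then show ?thesis using assms by (simp add: enc_tuple_toks)
  qed
qed

lemma sem_gtok:
  assumes "good w s" "x \<notin> reserved \<union> {Pbad,Pl1}" "occ w i (enc_tuple ps)"
    "pv s x = i + length (toks (take j ps))"
  shows "pv (sem w (gtok x) s) x = i + length (toks (take (Suc j) ps))"
    "pv (sem w (gtok x) s) Pbad = pv s Pbad"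
proof -
  have "pv (sem w (gtok x) s) x = i + length (toks (take (Suc j) ps)) \<and>
    pv (sem w (gtok x) s) Pbad = pv s Pbad"
  proof (cases "j < length ps")
    case True
    note o = toks_occ_nth(2)[OF assms(3) True]
    have ns: "symat w (pv s x) \<noteq> Some SSep"
      using toks_occ_nth(1)[OF assms(3), of j] True assms(4) by simp
    from sem_chktok[OF assms(1,2)] o obtain p where p: "occ w (pv s x) (enc_nat p)"
      "pv (sem w (chktok x) s) x = pv s x + length (enc_nat p)"
      "pv (sem w (chktok x) s) Pbad = pv s Pbad"
      unfolding assms(4) by blast
    have "p = ps ! j" using p(1) o assms(4) occ_enc_nat_inj by metis
    then show ?thesis using p ns True by (simp add: gtok_def take_Suc_conv_app_nth assms(4))
  next
    case False
    then have "symat w (pv s x) = Some SSep"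
      using toks_occ_nth(1)[OF assms(3), of j] assms(4) by simp
    then show ?thesis using False assms(4) by (simp add: gtok_def)
  qed
  then show "pv (sem w (gtok x) s) x = i + length (toks (take (Suc j) ps))"
    "pv (sem w (gtok x) s) Pbad = pv s Pbad" by auto
qed

lemma length_toks: "length ps \<le> length (toks ps)"
proof (induction ps)
  case (Cons p ps)
  have "1 \<le> length (enc_nat p)" by (cases "enc_nat p") auto
  then show ?case using Cons unfolding toks_simps length_append list.size by linarith
qed simp

lemma sem_chktup_occ:
  assumes "good w s" "x \<notin> reserved \<union> {Pbad,Pl1,Pl2}" "occ w (pv s x) (enc_tuple ps)"
  shows "pv (sem w (chktup x) s) x = pv s x + length (enc_tuple ps)"
    "pv (sem w (chktup x) s) Pbad = pv s Pbad"
proof -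
  let ?t = "sem w (For Pl2 Pn (gtok x)) s"
  let ?P = "\<lambda>j t. pv t x = pv s x + length (toks (take j ps)) \<and> pv t Pbad = pv s Pbad"
  have "?P (pv s Pn) ?t"
  proof (rule For_inv[OF assms(1), where P = ?P])
    fix j t assume "good w t" "?P j t"
    then show "?P (Suc j) (incp Pl2 (sem w (gtok x) t))"
      using sem_gtok[of w t x "pv s x" ps j] assms by auto
  qed (use assms in auto)
  \<comment> \<open>Each entry occupies at least one symbol of the input, so \<open>Pn\<close>
    rounds are enough.\<close>
  moreover have "length ps \<le> pv s Pn"
    using occ_length[OF assms(3)] length_toks[of ps] goodD(1)[OF assms(1)] by (simp add: enc_tuple_toks)
  ultimately have t: "pv ?t x = pv s x + length (toks ps)" "pv ?t Pbad = pv s Pbad" by auto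
  have "good w ?t" by (rule good_sem[OF assms(1)]) (use assms in auto)
  moreover have "symat w (pv ?t x) = Some SSep" using assms(3) t by (simp add: enc_tuple_toks)
  ultimately show "pv (sem w (chktup x) s) x = pv s x + length (enc_tuple ps)"
    "pv (sem w (chktup x) s) Pbad = pv s Pbad"
    using assms(2) t by (simp_all add: chktup_def sem_sepstep enc_tuple_toks)
qed

text \<open>If no error was flagged, the tokens passed so far are those of some list, and the
  separator found at the end completes the code of a tuple.\<close>

lemma sem_chktup_bad:
  assumes "good w s" "x \<notin> reserved \<union> {Pbad,Pl1,Pl2}" "pv s Pbad \<noteq> 0 \<or> (\<forall>ps. \<not> occ w (pv s x) (enc_tuple ps))"
  shows "pv (sem w (chktup x) s) Pbad \<noteq> 0"
proof
  assume z: "pv (sem w (chktup x) s) Pbad = 0"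
  let ?t = "sem w (For Pl2 Pn (gtok x)) s"
  let ?P = "\<lambda>j t. pv t Pbad \<noteq> 0 \<or> pv s Pbad = 0 \<and> (\<exists>ps. occ w (pv s x) (toks ps) \<and> pv t x = pv s x + length (toks ps))"
  have "?P (pv s Pn) ?t"
  proof (rule For_inv[OF assms(1), where P = ?P])
    show "?P 0 (upd Pl2 0 s)" using assms(2) by (auto intro!: exI[of _ "[]"])
    fix j t assume t: "good w t" "?P j t"
    have x: "x \<notin> reserved \<union> {Pbad,Pl1}" using assms(2) by auto
    show "?P (Suc j) (incp Pl2 (sem w (gtok x) t))"
    proof (cases "symat w (pv t x) = Some SSep")
      case True
      then have "sem w (gtok x) t = t" by (simp add: gtok_def)
      then show ?thesis using t assms(2) by auto
    next
      case False
      then have g: "sem w (gtok x) t = sem w (chktok x) t" by (simp add: gtok_def)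
      show ?thesis
      proof (cases "pv (sem w (chktok x) t) Pbad = 0")
        case True
        with sem_chktok[OF t(1) x] obtain p where p: "pv t Pbad = 0"
          "occ w (pv t x) (enc_nat p)" "pv (sem w (chktok x) t) x = pv t x + length (enc_nat p)" by auto
        then obtain ps where ps: "pv s Pbad = 0" "occ w (pv s x) (toks ps)" "pv t x = pv s x + length (toks ps)"
          using t(2) by auto
        then show ?thesis unfolding g using p assms(2)
          by (intro disjI2 conjI exI[of _ "ps @ [p]"]) auto
      next
        case False
        then show ?thesis unfolding g by simp
      qed
    qed
  qed (use assms in auto)
  moreover have gt: "good w ?t" by (rule good_sem[OF assms(1)]) (use assms in auto)
  moreover have "symat w (pv ?t x) = Some SSep" "pv ?t Pbad = 0"
    using z sem_sepstep[OF gt, of x] assms(2) by (auto simp: chktup_def split: if_splits)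
  ultimately obtain ps where "pv s Pbad = 0" "occ w (pv s x) (enc_tuple ps)" by (auto simp: enc_tuple_toks)
  then show False using assms(3) by blast
qed

definition walk :: "ptr \<Rightarrow> ptr \<Rightarrow> com" where
  "walk x y = copy PA x ;; copy PB y ;; For Pl3 PK (gtok PA ;; gtok PB)"

lemma walk_simps [simp]: "mods (walk x y) = {PA,PB,Pl1,Pl3,Pl4,Pbad}" "det (walk x y)" "nowr (walk x y)"
  "wfc (walk x y) \<longleftrightarrow> x \<notin> {PA,Pl4} \<and> y \<notin> {PB,Pl4}"
  by (auto simp: walk_def)

lemma sem_walk:
  assumes "good w s" "x \<notin> {PA,PB,Pl4}" "y \<notin> {PA,PB,Pl4}"
    "occ w (pv s x) (enc_tuple ps)" "occ w (pv s y) (enc_tuple qs)"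
  shows "pv (sem w (walk x y) s) PA = pv s x + length (toks (take (pv s PK) ps))"
    "pv (sem w (walk x y) s) PB = pv s y + length (toks (take (pv s PK) qs))"
proof -
  let ?s1 = "sem w (copy PA x) s"
  let ?s2 = "sem w (copy PB y) ?s1"
  have g1: "good w ?s1" by (rule good_sem[OF assms(1)]) auto
  have g2: "good w ?s2" by (rule good_sem[OF g1]) auto
  have s2: "pv ?s2 PA = pv s x" "pv ?s2 PB = pv s y" "pv ?s2 PK = pv s PK"
    using assms sem_copy[OF assms(1), of PA x] sem_copy[OF g1, of PB y] by (auto simp: sem_frame)
  let ?P = "\<lambda>j t. pv t PA = pv s x + length (toks (take j ps)) \<and> pv t PB = pv s y + length (toks (take j qs))"
  have "?P (pv ?s2 PK) (sem w (For Pl3 PK (gtok PA ;; gtok PB)) ?s2)"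
  proof (rule For_inv[OF g2, where P = ?P])
    fix j t assume t: "good w t" "?P j t"
    let ?t = "sem w (gtok PA) t"
    have "good w ?t" by (rule good_sem[OF t(1)]) auto
    moreover have "pv ?t PA = pv s x + length (toks (take (Suc j) ps))"
      using sem_gtok(1)[OF t(1), of PA "pv s x" ps j] assms t by auto
    moreover have "pv ?t PB = pv s y + length (toks (take j qs))"
      using t(2) by (simp add: sem_frame)
    ultimately show "?P (Suc j) (incp Pl3 (sem w (gtok PA ;; gtok PB) t))"
      using sem_gtok(1)[of w ?t PB "pv s y" qs j] assms by (simp add: sem_frame)
  qed (use s2 in auto)
  then show "pv (sem w (walk x y) s) PA = pv s x + length (toks (take (pv s PK) ps))"
    "pv (sem w (walk x y) s) PB = pv s y + length (toks (take (pv s PK) qs))"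
    using s2 by (simp_all add: walk_def)
qed

section \<open>Assignments as numbers\<close>

definition tokstep :: com where
  "tokstep = Cond Pt2 (isym SSep) (Cond Pt1 (isym SSep) (flag Pok ;; flag Pdone) (flag Pdone))
     (Cond Pt2 (isym SB0) (Cond Pt1 (isym SB0) (Inc Pt1 ;; Inc Pt2) (flag Pdone))
       (Cond Pt1 (isym SB1) (Inc Pt1 ;; Inc Pt2) (flag Pdone)))"

text \<open>\<open>y\<close> points at a genuine token while \<open>PC\<close> may be anywhere; so
  the comparison runs along the token at \<open>y\<close>, up to a mismatch or to its
  separator.\<close>

definition tokeq :: "ptr \<Rightarrow> com" where
  "tokeq y = copy Pt1 PC ;; copy Pt2 y ;; Zero Pok ;; Zero Pdone ;; For Pl1 Pn (Cond Pdone nz Skip tokstep)"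

lemma tokeq_simps [simp]: "mods tokstep = {Pok,Pdone,Pt1,Pt2}" "det tokstep" "nowr tokstep" "wfc tokstep"
  "mods (tokeq y) = {Pok,Pdone,Pt1,Pt2,Pl1,Pl4}" "det (tokeq y)" "nowr (tokeq y)"
  "wfc (tokeq y) \<longleftrightarrow> y \<noteq> Pl4 \<and> y \<noteq> Pt2"
  by (auto simp: tokstep_def tokeq_def)

lemma occ_nth: "occ w c u \<longleftrightarrow> (\<forall>r<length u. symat w (c + r) = Some (u ! r))"
proof (induction u arbitrary: c)
  case (Cons x u)
  show ?case by (auto simp: Cons nth_Cons less_Suc_eq_0_disj)
qed simp

lemma sem_tokstep:
  assumes "good w t" "pv t Pdone = 0" "pv t Pok = 0" "r < length u" "pv t Pt1 = c + r" "pv t Pt2 = i + r"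
    "occ w c (take r u)" "occ w i u" "u = enc_nat p"
  defines "t' \<equiv> sem w tokstep t"
  shows "pv t' Pdone = 0 \<and> pv t' Pok = 0 \<and> Suc r < length u \<and> pv t' Pt1 = c + Suc r \<and>
      pv t' Pt2 = i + Suc r \<and> occ w c (take (Suc r) u) \<or>
    pv t' Pdone \<noteq> 0 \<and> (pv t' Pok \<noteq> 0 \<longleftrightarrow> occ w c u)"
proof -
  have ir: "symat w (i + r) = Some (u ! r)" using assms(4,8) by (simp add: occ_nth)
  have ts: "occ w c (take (Suc r) u) \<longleftrightarrow> symat w (c + r) = Some (u ! r)"
    using assms(4,7) by (simp add: take_Suc_conv_app_nth)
  have imp: "occ w c u \<Longrightarrow> symat w (c + r) = Some (u ! r)" using assms(4) by (simp add: occ_nth)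
  show ?thesis
  proof (cases "r < length (bits p)")
    case True
    then have b: "u ! r = SB0 \<or> u ! r = SB1" "Suc r < length u"
      using subsetD[OF bits_set(1) nth_mem[OF True]] by (auto simp: assms(9) enc_nat_def nth_append)
    show ?thesis
    proof (cases "symat w (c + r) = Some (u ! r)")
      case True
      have "incp Pt1 t = upd Pt1 (Suc (c + r)) t"
        using inc_symat[OF assms(1), of Pt1] True assms(5) by simp
      moreover have "good w (upd Pt1 (Suc (c + r)) t)"
        using symat_less[OF True] goodD(3)[OF assms(1)] assms(1) by (intro good_upd) auto
      then have "incp Pt2 (upd Pt1 (Suc (c + r)) t) = upd Pt2 (Suc (i + r)) (upd Pt1 (Suc (c + r)) t)"
        using inc_symat[of w _ Pt2] ir assms(6) by simp
      ultimately have "t' = upd Pt2 (Suc (i + r)) (upd Pt1 (Suc (c + r)) t)"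
        using b True ir assms(5,6) by (auto simp: t'_def tokstep_def)
      then show ?thesis using b True ts assms(2,3) by simp
    next
      case False
      then have "t' = upd Pdone 1 t"
        using b ir assms(1,5,6) by (auto simp: t'_def tokstep_def sem_flag)
      then show ?thesis using False imp assms(3) by auto
    qed
  next
    case False
    then have r: "r = length (bits p)" using assms(4,9) by (simp add: enc_nat_def)
    have u: "u ! r = SSep" "take (Suc r) u = u" by (simp_all add: r assms(9) enc_nat_def)
    have g: "good w (upd Pok 1 t)" using assms(1) goodD(5)[OF assms(1)] by (intro good_upd) auto
    show ?thesis
    proof (cases "symat w (c + r) = Some SSep")
      case True
      then have "t' = upd Pdone 1 (upd Pok 1 t)"
        using u ir assms(1,5,6) g by (simp add: t'_def tokstep_def sem_flag)
      then show ?thesis using True ts u by simp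
    next
      case False
      then have "t' = upd Pdone 1 t"
        using u ir assms(1,5,6) by (auto simp: t'_def tokstep_def sem_flag)
      then show ?thesis using False imp u assms(3) by auto
    qed
  qed
qed

lemma sem_tokeq:
  assumes "good w s" "y \<notin> {Pok,Pdone,Pt1,Pt2,Pl1,Pl4}" "occ w (pv s y) (enc_nat p)"
  shows "pv (sem w (tokeq y) s) Pok \<noteq> 0 \<longleftrightarrow> occ w (pv s PC) (enc_nat p)"
proof -
  define s1 where "s1 = sem w (copy Pt1 PC) s"
  define s2 where "s2 = sem w (copy Pt2 y) s1"
  let ?s3 = "upd Pdone 0 (upd Pok 0 s2)"
  let ?u = "enc_nat p"
  have g1: "good w s1" unfolding s1_def by (rule good_sem[OF assms(1)]) auto
  have g2: "good w s2" unfolding s2_def by (rule good_sem[OF g1]) auto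
  have g3: "good w ?s3" by (intro good_upd g2) auto
  have v1: "pv s1 Pt1 = pv s PC" "pv s1 y = pv s y"
    unfolding s1_def using sem_copy[OF assms(1), of Pt1 PC] assms(2) by (auto simp: sem_frame)
  have v2: "pv s2 Pt1 = pv s PC" "pv s2 Pt2 = pv s y"
    using v1 sem_copy[OF g1, of Pt2 y] assms(2) unfolding s2_def by (auto simp: sem_frame)
  let ?P = "\<lambda>r t. (pv t Pdone = 0 \<and> pv t Pok = 0 \<and> r < length ?u \<and> pv t Pt1 = pv s PC + r \<and>
      pv t Pt2 = pv s y + r \<and> occ w (pv s PC) (take r ?u)) \<or>
    (pv t Pdone \<noteq> 0 \<and> (pv t Pok \<noteq> 0 \<longleftrightarrow> occ w (pv s PC) ?u))"
  let ?s4 = "sem w (For Pl1 Pn (Cond Pdone nz Skip tokstep)) ?s3"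
  have "?P (pv ?s3 Pn) ?s4"
  proof (rule For_inv[OF g3, where P = ?P])
    show "?P 0 (upd Pl1 0 ?s3)" using v2 by simp
    fix r t assume t: "good w t" "?P r t"
    show "?P (Suc r) (incp Pl1 (sem w (Cond Pdone nz Skip tokstep) t))"
    proof (cases "pv t Pdone = 0")
      case True
      then have "sem w (Cond Pdone nz Skip tokstep) t = sem w tokstep t" using t(1) by simp
      then show ?thesis
        using sem_tokstep[OF t(1) True, of r ?u "pv s PC" "pv s y" p] t(2) True assms(3) by simp
    next
      case False
      then have "sem w (Cond Pdone nz Skip tokstep) t = t" using t(1) by simp
      then show ?thesis using t(2) False by simp
    qed
  qed simp_all
  moreover have "length ?u \<le> pv ?s3 Pn" using occ_length[OF assms(3)] goodD(1)[OF g3] by simp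
  ultimately have "pv ?s4 Pok \<noteq> 0 \<longleftrightarrow> occ w (pv s PC) ?u" by (auto simp del: sem.simps)
  then show ?thesis by (simp add: tokeq_def s1_def s2_def)
qed

section \<open>Binary digits by repeated halving\<close>

text \<open>A number is only the position of a mark, so halving counts up to it: \<open>Pt2\<close>
  counts the pairs and \<open>Pt3\<close> keeps the parity, which remains as the remainder.\<close>

definition half :: com where
  "half = Zero Pt2 ;; Zero Pt3 ;; For Pl2 Pt1 (Cond Pt3 nz (Zero Pt3 ;; Inc Pt2) (Inc Pt3)) ;; copy Pt1 Pt2"

definition bitp :: "ptr \<Rightarrow> com" where
  "bitp r = copy Pt1 r ;; For Pl1 PC half ;; half"

lemma bitp_simps [simp]: "mods half = {Pt1,Pt2,Pt3,Pl2,Pl4}" "det half" "nowr half" "wfc half"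
  "mods (bitp r) = {Pt1,Pt2,Pt3,Pl1,Pl2,Pl4}" "det (bitp r)" "nowr (bitp r)"
  "wfc (bitp r) \<longleftrightarrow> r \<noteq> Pl4 \<and> r \<noteq> Pt1"
  by (auto simp: half_def bitp_def)

lemma sem_half:
  assumes "good w s"
  shows "pv (sem w half s) Pt1 = pv s Pt1 div 2" "pv (sem w half s) Pt3 = pv s Pt1 mod 2"
proof -
  let ?s1 = "upd Pt3 0 (upd Pt2 0 s)"
  let ?b = "Cond Pt3 nz (Zero Pt3 ;; Inc Pt2) (Inc Pt3)"
  have g1: "good w ?s1" by (intro good_upd assms) auto
  let ?P = "\<lambda>j t. pv t Pt2 = j div 2 \<and> pv t Pt3 = j mod 2"
  define s2 where "s2 = sem w (For Pl2 Pt1 ?b) ?s1"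
  have s2: "?P (pv ?s1 Pt1) s2" unfolding s2_def
  proof (rule For_inv[OF g1, where P = ?P])
    fix j t assume j: "j < pv ?s1 Pt1" and t: "good w t" "?P j t"
      and fr: "\<And>p. p \<notin> insert Pl2 (mods ?b) \<Longrightarrow> pv t p = pv ?s1 p"
    have "j < pv t PE" using j fr[of Pt1] goodD(4)[OF t(1), of Pt1] by simp
    then have jj: "j div 2 < pv t PE" by (auto intro: le_less_trans[OF div_le_dividend])
    show "?P (Suc j) (incp Pl2 (sem w ?b t))"
    proof (cases "j mod 2 = 0")
      case True
      then have "sem w ?b t = upd Pt3 1 t" using t goodD(5)[OF t(1)] by (simp add: incp_lt)
      then show ?thesis using t(2) True by (simp add: mod_Suc div_Suc)
    next
      case False
      then have "sem w ?b t = upd Pt2 (Suc (j div 2)) (upd Pt3 0 t)" using t jj by (simp add: incp_lt)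
      then show ?thesis using t(2) False by (simp add: mod_Suc div_Suc)
    qed
  qed simp_all
  have g2: "good w s2" unfolding s2_def by (rule good_sem[OF g1]) auto
  have h: "sem w half s = sem w (copy Pt1 Pt2) s2" by (simp add: half_def s2_def)
  show "pv (sem w half s) Pt1 = pv s Pt1 div 2"
    unfolding h using sem_copy[OF g2, of Pt1 Pt2] s2 by simp
  show "pv (sem w half s) Pt3 = pv s Pt1 mod 2"
    unfolding h using s2 by (simp add: sem_frame)
qed

lemma sem_bitp:
  assumes "good w s" "r \<notin> {Pt1,Pl4}"
  shows "pv (sem w (bitp r) s) Pt3 = (pv s r div 2 ^ pv s PC) mod 2"
proof -
  define s1 where "s1 = sem w (copy Pt1 r) s"
  have g1: "good w s1" unfolding s1_def by (rule good_sem[OF assms(1)]) auto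
  have v1: "pv s1 Pt1 = pv s r" "pv s1 PC = pv s PC"
    unfolding s1_def using sem_copy[OF assms(1), of Pt1 r] assms(2) by (auto simp: sem_frame)
  define s2 where "s2 = sem w (For Pl1 PC half) s1"
  let ?P = "\<lambda>j t. pv t Pt1 = pv s r div 2 ^ j"
  have s2: "?P (pv s1 PC) s2" unfolding s2_def
  proof (rule For_inv[OF g1, where P = ?P])
    fix j t assume "good w t" "?P j t"
    then show "?P (Suc j) (incp Pl1 (sem w half t))"
      using sem_half[of w t] div_mult2_eq[of "pv s r" "2 ^ j" 2] by (simp add: mult.commute)
  qed (use v1 in simp_all)
  have g2: "good w s2" unfolding s2_def by (rule good_sem[OF g1]) auto
  have "sem w (bitp r) s = sem w half s2" by (simp add: bitp_def s1_def s2_def)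
  then show ?thesis using sem_half[OF g2] s2 v1 by simp
qed

text \<open>Row number x stands for the assignment that makes p true iff some bit of x is set whose
  index is a position where the token of p occurs in the input.\<close>
definition asg :: "sym list \<Rightarrow> nat \<Rightarrow> nat \<Rightarrow> bool" where
  "asg w x p \<longleftrightarrow> (\<exists>c. occ w c (enc_nat p) \<and> odd (x div 2 ^ c))"

definition valf :: "ptr \<Rightarrow> ptr \<Rightarrow> fo" where
  "valf r y = Ex PC (And (Exec (tokeq y) (Tst Pok nz)) (Exec (bitp r) (Tst Pt3 nz)))"

abbreviation "vtemps \<equiv> {PC,Pix,Pt1,Pt2,Pt3,Pok,Pdone,Pl1,Pl2,Pl4}"

lemma wff_valf [simp]: "r \<notin> vtemps \<Longrightarrow> y \<notin> vtemps \<Longrightarrow> wff (valf r y)"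
  by (auto simp: valf_def)

lemma sat_valf:
  assumes "good w s" "r \<notin> vtemps" "y \<notin> vtemps" "occ w (pv s y) (enc_nat p)"
  shows "sat w (valf r y) s \<longleftrightarrow> asg w (pv s r) p"
proof -
  have "sat w (And (Exec (tokeq y) (Tst Pok nz)) (Exec (bitp r) (Tst Pt3 nz))) (upd Pix (pv s PE) (upd PC j s))
    \<longleftrightarrow> occ w j (enc_nat p) \<and> odd (pv s r div 2 ^ j)" if "j \<le> pv s PE" for j
  proof -
    let ?t = "upd Pix (pv s PE) (upd PC j s)"
    have g: "good w ?t" using assms(1) that by (intro good_upd) auto
    have g': "good w (sem w (tokeq y) ?t)" "good w (sem w (bitp r) ?t)"
      by (rule good_sem[OF g]; simp)+
    have "pv (sem w (tokeq y) ?t) Pok \<noteq> 0 \<longleftrightarrow> occ w j (enc_nat p)"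
      using sem_tokeq[OF g, of y p] assms(3,4) by auto
    moreover have "pv (sem w (bitp r) ?t) Pt3 = (pv s r div 2 ^ j) mod 2"
      using sem_bitp[OF g, of r] assms(2) by auto
    ultimately show ?thesis using g' by (simp add: odd_iff_mod_2_eq_one)
  qed
  \<comment> \<open>An occurrence of a token lies inside the input and hence in the range of the
    quantifier.\<close>
  moreover have "j \<le> pv s PE" if "occ w j (enc_nat p)" for j
    using occ_length[OF that] goodD(3)[OF assms(1)] by simp
  ultimately show ?thesis by (auto simp: valf_def asg_def simp del: sat.simps(3,5))
qed

definition Iff :: "fo \<Rightarrow> fo \<Rightarrow> fo" where "Iff a b = Or (And a b) (And (Neg a) (Neg b))"

lemma Iff_simps [simp]: "sat w (Iff a b) s \<longleftrightarrow> (sat w a s \<longleftrightarrow> sat w b s)"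
  "wff (Iff a b) \<longleftrightarrow> wff a \<and> wff b"
  by (auto simp: Iff_def)

section \<open>Comparison of tuples\<close>

text \<open>Meant for tuples of equal length, so that \<open>PA\<close> and \<open>PB\<close> reach
  their closing separators together.\<close>

definition eqt :: "ptr \<Rightarrow> ptr \<Rightarrow> ptr \<Rightarrow> ptr \<Rightarrow> fo" where
  "eqt r x t y = All PK (Exec (walk x y) (Or (Tst PA (isym SSep)) (Iff (valf r PA) (valf t PB))))"

definition lenf :: "ptr \<Rightarrow> ptr \<Rightarrow> fo" where
  "lenf x y = All PK (Exec (walk x y) (Iff (Tst PA (isym SSep)) (Tst PB (isym SSep))))"

abbreviation "wtemps \<equiv> {PA,PB,Pl3,Pbad,PK}"

lemma wff_eqt [simp]:
  "r \<notin> vtemps \<Longrightarrow> t \<notin> vtemps \<Longrightarrow> x \<notin> {PA,Pl4} \<Longrightarrow> y \<notin> {PB,Pl4} \<Longrightarrow> wff (eqt r x t y)"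
  "x \<notin> {PA,Pl4} \<Longrightarrow> y \<notin> {PB,Pl4} \<Longrightarrow> wff (lenf x y)"
  by (auto simp: eqt_def lenf_def)

lemma walk_at:
  assumes "good w s" "x \<notin> {PA,PB,Pl4,Pix,PK}" "y \<notin> {PA,PB,Pl4,Pix,PK}"
    "occ w (pv s x) (enc_tuple ps)" "occ w (pv s y) (enc_tuple qs)" "j \<le> pv s PE"
  defines "t \<equiv> sem w (walk x y) (upd Pix (pv s PE) (upd PK j s))"
  shows "good w t" "pv t PA = pv s x + length (toks (take j ps))" "pv t PB = pv s y + length (toks (take j qs))"
    "\<And>q. q \<notin> {PA,PB,Pl1,Pl3,Pl4,Pbad,PK,Pix} \<Longrightarrow> pv t q = pv s q"
proof -
  let ?s = "upd Pix (pv s PE) (upd PK j s)"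
  have g: "good w ?s" using assms by (intro good_upd) auto
  show "good w t" unfolding t_def by (rule good_sem[OF g]) auto
  show "pv t PA = pv s x + length (toks (take j ps))" "pv t PB = pv s y + length (toks (take j qs))"
    using sem_walk[OF g, of x y ps qs] assms(2-6) unfolding t_def by auto
  show "pv t q = pv s q" if "q \<notin> {PA,PB,Pl1,Pl3,Pl4,Pbad,PK,Pix}" for q
    using that unfolding t_def by (subst sem_frame) auto
qed

lemma sat_eqt:
  assumes "good w s" "x \<notin> {PA,PB,Pl4,Pix,PK}" "y \<notin> {PA,PB,Pl4,Pix,PK}"
    "occ w (pv s x) (enc_tuple ps)" "occ w (pv s y) (enc_tuple qs)" "length ps = length qs"
    "r \<notin> vtemps \<union> wtemps" "t \<notin> vtemps \<union> wtemps"
  shows "sat w (eqt r x t y) s \<longleftrightarrow> map (asg w (pv s r)) ps = map (asg w (pv s t)) qs"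
proof -
  have "sat w (Exec (walk x y) (Or (Tst PA (isym SSep)) (Iff (valf r PA) (valf t PB)))) (upd Pix (pv s PE) (upd PK j s))
    \<longleftrightarrow> (j < length ps \<longrightarrow> asg w (pv s r) (ps ! j) = asg w (pv s t) (qs ! j))" if j: "j \<le> pv s PE" for j
  proof -
    define t' where "t' = sem w (walk x y) (upd Pix (pv s PE) (upd PK j s))"
    note W = walk_at[OF assms(1-5) j, folded t'_def]
    have sep: "symat w (pv t' PA) = Some SSep \<longleftrightarrow> length ps \<le> j"
      unfolding W(2) by (rule toks_occ_nth(1)[OF assms(4)])
    have "sat w (valf r PA) t' = asg w (pv s r) (ps ! j)" "sat w (valf t PB) t' = asg w (pv s t) (qs ! j)"
      if "j < length ps"
      using sat_valf[OF W(1), of r PA "ps ! j"] sat_valf[OF W(1), of t PB "qs ! j"] assms(6-8) that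
        toks_occ_nth(2)[OF assms(4), of j] toks_occ_nth(2)[OF assms(5), of j] W by auto
    then show ?thesis using sep by (auto simp: t'_def[symmetric])
  qed
  moreover have "length ps \<le> pv s PE"
    using occ_length[OF assms(4)] length_toks[of ps] goodD(3)[OF assms(1)] by (simp add: enc_tuple_toks)
  ultimately show ?thesis using assms(6)
    by (auto simp: eqt_def list_eq_iff_nth_eq simp del: sat.simps(5))
qed

text \<open>At index j the walk stands at the closing separator iff the length is at most j; two
  lengths agree if these conditions agree for all j up to a common bound.\<close>

lemma sat_lenf:
  assumes "good w s" "x \<notin> {PA,PB,Pl4,Pix,PK}" "y \<notin> {PA,PB,Pl4,Pix,PK}"
    "occ w (pv s x) (enc_tuple ps)" "occ w (pv s y) (enc_tuple qs)"
  shows "sat w (lenf x y) s \<longleftrightarrow> length ps = length qs"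
proof -
  have "sat w (Exec (walk x y) (Iff (Tst PA (isym SSep)) (Tst PB (isym SSep)))) (upd Pix (pv s PE) (upd PK j s))
    \<longleftrightarrow> (length ps \<le> j \<longleftrightarrow> length qs \<le> j)" if j: "j \<le> pv s PE" for j
  proof -
    define t' where "t' = sem w (walk x y) (upd Pix (pv s PE) (upd PK j s))"
    note W = walk_at[OF assms(1-5) j, folded t'_def]
    show ?thesis
      using toks_occ_nth(1)[OF assms(4), of j] toks_occ_nth(1)[OF assms(5), of j] W(2,3)
      by (simp add: t'_def[symmetric])
  qed
  then have "sat w (lenf x y) s \<longleftrightarrow> (\<forall>j\<le>pv s PE. length ps \<le> j \<longleftrightarrow> length qs \<le> j)"
    by (simp add: lenf_def del: sat.simps(5))
  moreover have "length ps \<le> pv s PE" "length qs \<le> pv s PE"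
    using occ_length[OF assms(4)] length_toks[of ps] occ_length[OF assms(5)] length_toks[of qs]
      goodD(3)[OF assms(1)] by (simp_all add: enc_tuple_toks)
  ultimately show ?thesis by (metis le_antisym order_refl)
qed

definition prX :: com where "prX = copy PX PI ;; Inc PX"
definition prXY :: com where "prXY = prX ;; copy PY PX ;; chktup PY"
definition prXYW :: com where "prXYW = prXY ;; copy PW PY ;; chktup PW"

lemma pr_simps [simp]: "mods prX = {PX,Pl4}" "det prX" "nowr prX" "wfc prX"
  "mods prXY = {PX,PY,Pl4,Pbad,Pl1,Pl2}" "det prXY" "nowr prXY" "wfc prXY"
  "mods prXYW = {PX,PY,PW,Pl4,Pbad,Pl1,Pl2}" "det prXYW" "nowr prXYW" "wfc prXYW"
  by (auto simp: prX_def prXY_def prXYW_def)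

lemma sem_prX:
  assumes "good w s" "pv s PI < length w"
  shows "pv (sem w prX s) PX = Suc (pv s PI)"
proof -
  have g: "good w (sem w (copy PX PI) s)" by (rule good_sem[OF assms(1)]) auto
  show ?thesis
    using sem_copy[OF assms(1), of PX PI] goodD(3)[OF g] assms(2) by (auto simp: prX_def incp_lt)
qed

lemma chktup_iff:
  assumes "good w s" "x \<notin> reserved \<union> {Pbad,Pl1,Pl2}"
  shows "pv (sem w (chktup x) s) Pbad = 0 \<longleftrightarrow> pv s Pbad = 0 \<and> (\<exists>ps. occ w (pv s x) (enc_tuple ps))"
  using sem_chktup_bad[OF assms] sem_chktup_occ(2)[OF assms] by metis

lemma sem_prXY:
  assumes "good w s" "pv s PI < length w"
  shows "pv (sem w prXY s) PX = Suc (pv s PI)"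
    "pv (sem w prXY s) Pbad = 0 \<longleftrightarrow> pv s Pbad = 0 \<and> (\<exists>ps. occ w (Suc (pv s PI)) (enc_tuple ps))"
    "occ w (Suc (pv s PI)) (enc_tuple ps) \<Longrightarrow> pv (sem w prXY s) PY = Suc (pv s PI) + length (enc_tuple ps)"
proof -
  define s1 where "s1 = sem w prX s"
  define s2 where "s2 = sem w (copy PY PX) s1"
  have g1: "good w s1" unfolding s1_def by (rule good_sem[OF assms(1)]) auto
  have g2: "good w s2" unfolding s2_def by (rule good_sem[OF g1]) auto
  have v1: "pv s1 PX = Suc (pv s PI)" "pv s1 Pbad = pv s Pbad"
    unfolding s1_def using sem_prX[OF assms] by (simp_all add: sem_frame)
  have v2: "pv s2 PX = Suc (pv s PI)" "pv s2 PY = Suc (pv s PI)" "pv s2 Pbad = pv s Pbad"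
    unfolding s2_def using sem_copy[OF g1, of PY PX] v1 by (simp_all add: sem_frame)
  have e: "sem w prXY s = sem w (chktup PY) s2" by (simp add: prXY_def s1_def s2_def)
  show "pv (sem w prXY s) PX = Suc (pv s PI)" unfolding e using v2 by (simp add: sem_frame)
  show "pv (sem w prXY s) Pbad = 0 \<longleftrightarrow> pv s Pbad = 0 \<and> (\<exists>ps. occ w (Suc (pv s PI)) (enc_tuple ps))"
    unfolding e using chktup_iff[OF g2, of PY] v2 by simp
  show "pv (sem w prXY s) PY = Suc (pv s PI) + length (enc_tuple ps)" if "occ w (Suc (pv s PI)) (enc_tuple ps)"
    unfolding e using sem_chktup_occ(1)[OF g2, of PY ps] v2 that by simp
qed

lemma sem_prXYW:
  assumes "good w s" "pv s PI < length w"
  shows "pv (sem w prXYW s) PX = Suc (pv s PI)"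
    "pv (sem w prXYW s) Pbad = 0 \<longleftrightarrow> pv s Pbad = 0 \<and> (\<exists>ps qs. occ w (Suc (pv s PI)) (enc_tuple ps @ enc_tuple qs))"
    "occ w (Suc (pv s PI)) (enc_tuple ps @ enc_tuple qs) \<Longrightarrow>
       pv (sem w prXYW s) PY = Suc (pv s PI) + length (enc_tuple ps) \<and>
       pv (sem w prXYW s) PW = Suc (pv s PI) + length (enc_tuple ps) + length (enc_tuple qs)"
proof -
  define s1 where "s1 = sem w prXY s"
  define s2 where "s2 = sem w (copy PW PY) s1"
  note P = sem_prXY[OF assms, folded s1_def]
  have g1: "good w s1" unfolding s1_def by (rule good_sem[OF assms(1)]) auto
  have g2: "good w s2" unfolding s2_def by (rule good_sem[OF g1]) auto
  have v2: "pv s2 PX = pv s1 PX" "pv s2 PY = pv s1 PY" "pv s2 PW = pv s1 PY" "pv s2 Pbad = pv s1 Pbad"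
    unfolding s2_def using sem_copy[OF g1, of PW PY] by (simp_all add: sem_frame)
  have e: "sem w prXYW s = sem w (chktup PW) s2" by (simp add: prXYW_def s1_def s2_def)
  show "pv (sem w prXYW s) PX = Suc (pv s PI)" unfolding e using v2 P(1) by (simp add: sem_frame)
  show "pv (sem w prXYW s) Pbad = 0 \<longleftrightarrow> pv s Pbad = 0 \<and> (\<exists>ps qs. occ w (Suc (pv s PI)) (enc_tuple ps @ enc_tuple qs))"
  proof (cases "\<exists>ps. occ w (Suc (pv s PI)) (enc_tuple ps)")
    case True
    then obtain ps where ps: "occ w (Suc (pv s PI)) (enc_tuple ps)" by blast
    have "ps' = ps" if "occ w (Suc (pv s PI)) (enc_tuple ps')" for ps'
      using occ_enc_tuple_inj[OF that ps] .
    then have "(\<exists>ps qs. occ w (Suc (pv s PI)) (enc_tuple ps @ enc_tuple qs)) \<longleftrightarrow>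
      (\<exists>qs. occ w (Suc (pv s PI) + length (enc_tuple ps)) (enc_tuple qs))"
      using ps unfolding occ_append by blast
    moreover have "pv s1 Pbad = 0 \<longleftrightarrow> pv s Pbad = 0" using P(2) ps by blast
    ultimately show ?thesis unfolding e using chktup_iff[OF g2, of PW] v2 P(3)[OF ps] by simp
  next
    case False
    then have "pv s1 Pbad \<noteq> 0" using P(2) by blast
    then show ?thesis unfolding e using chktup_iff[OF g2, of PW] v2 False by simp
  qed
  show "pv (sem w prXYW s) PY = Suc (pv s PI) + length (enc_tuple ps) \<and>
       pv (sem w prXYW s) PW = Suc (pv s PI) + length (enc_tuple ps) + length (enc_tuple qs)"
    if "occ w (Suc (pv s PI)) (enc_tuple ps @ enc_tuple qs)"
    unfolding e using sem_chktup_occ(1)[OF g2, of PW qs] v2 that P(3)[of ps] by (simp add: sem_frame)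
qed

section \<open>Atomic formulas\<close>

fun flagged :: "cell \<Rightarrow> bool" where
  "flagged LE = False"
| "flagged (Cell a f g M) = f"

fun flagged2 :: "cell \<Rightarrow> bool" where
  "flagged2 LE = False"
| "flagged2 (Cell a f g M) = g"

lemma flagged_cellat [simp]: "flagged (cellat w s i) = fl s i" "flagged2 (cellat w s i) = gl s i"
  by (simp_all add: cellat_def)

definition inT :: "ptr \<Rightarrow> fo" where "inT r = Tst r flagged"

lemma sat_inT [simp]: "sat w (inT r) s \<longleftrightarrow> fl s (pv s r)" "wff (inT r)"
  by (simp_all add: inT_def)

fun leaf :: "fml \<Rightarrow> bool" where
  "leaf (Conj a b) = False"
| "leaf (Disj a b) = False"
| "leaf (Tilde a) = False"
| "leaf _ = True"

definition valid :: "sym list \<Rightarrow> nat \<Rightarrow> nat \<Rightarrow> bool" where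
  "valid w i j \<longleftrightarrow> (\<exists>\<phi>. wf_fml \<phi> \<and> occ w i (enc \<phi>) \<and> j = i + length (enc \<phi>))"

definition prTok :: com where "prTok = Zero Pbad ;; prX ;; chktok PX"
definition prI :: com where "prI = Zero Pbad ;; prXYW"
definition prC :: com where "prC = prI ;; chktup PW"

lemma pr2_simps [simp]:
  "mods prTok = {Pbad,PX,Pl4,Pl1}" "det prTok" "wfc prTok"
  "mods prI = {Pbad,PX,PY,PW,Pl4,Pl1,Pl2}" "det prI" "wfc prI"
  "mods prC = {Pbad,PX,PY,PW,Pl4,Pl1,Pl2}" "det prC" "wfc prC"
  by (auto simp: prTok_def prI_def prC_def)

definition okJ :: "ptr \<Rightarrow> fo" where
  "okJ x = And (Tst Pbad (marked PZ)) (Tst x (marked PJ))"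

text \<open>The challenge at an atom: parse the arguments and compare the place where parsing ends
  with \<open>PJ\<close>. On a symbol that starts no formula, or behind the input, all disjuncts
  fail.\<close>

definition VAL :: fo where
  "VAL = Or (And (Or (Tst PI (isym SP)) (Tst PI (isym SNP))) (Exec prTok (okJ PX)))
    (Or (And (Tst PI (isym SInc)) (Exec prI (And (okJ PW) (lenf PX PY))))
      (And (Tst PI (isym SCI)) (Exec prC (okJ PW))))"

text \<open>The clauses of team semantics with row quantifiers relativised to the team. For an
  independence atom the code lists q, p, r at \<open>PX\<close>, \<open>PY\<close>,
  \<open>PW\<close>, so the condition p is found at \<open>PY\<close>.\<close>

definition EVAL :: fo where
  "EVAL = Or (And (Tst PI (isym SP)) (Exec prX (All PS (Or (Neg (inT PS)) (valf PS PX)))))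
    (Or (And (Tst PI (isym SNP)) (Exec prX (All PS (Or (Neg (inT PS)) (Neg (valf PS PX))))))
    (Or (And (Tst PI (isym SInc))
          (Exec prXY (All PS (Or (Neg (inT PS)) (Ex PT (And (inT PT) (eqt PS PX PT PY)))))))
        (And (Tst PI (isym SCI))
          (Exec prXYW (All PS (All PT (Or (Neg (inT PS)) (Or (Neg (inT PT)) (Or (Neg (eqt PS PY PT PY))
             (Ex PU (And (inT PU) (And (eqt PU PY PS PY) (And (eqt PU PX PS PX) (eqt PU PW PT PW))))))))))))))"

lemma wff_VAL: "wff VAL"
  by (simp add: VAL_def okJ_def)

lemma wff_EVAL: "wff EVAL"
  by (simp add: EVAL_def)

lemma sat_okJ: "good w s \<Longrightarrow> sat w (okJ x) s \<longleftrightarrow> pv s Pbad = 0 \<and> pv s x = pv s PJ"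
  by (auto simp: okJ_def goodD)

lemma sem_prTok:
  assumes "good w s" "pv s PI < length w"
  shows "sat w (Exec prTok (okJ PX)) s \<longleftrightarrow>
    (\<exists>p. occ w (Suc (pv s PI)) (enc_nat p) \<and> pv s PJ = Suc (pv s PI) + length (enc_nat p))"
proof -
  define s1 where "s1 = sem w prX (upd Pbad 0 s)"
  have g0: "good w (upd Pbad 0 s)" by (intro good_upd assms) auto
  have g1: "good w s1" unfolding s1_def by (rule good_sem[OF g0]) auto
  have v1: "pv s1 PX = Suc (pv s PI)" "pv s1 Pbad = 0"
    unfolding s1_def using sem_prX[OF g0] assms(2) by (simp_all add: sem_frame)
  have e: "sem w prTok s = sem w (chktok PX) s1" by (simp add: prTok_def s1_def)
  have g: "good w (sem w prTok s)" by (rule good_sem[OF assms(1)]) auto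
  have J: "pv (sem w prTok s) PJ = pv s PJ" by (simp add: sem_frame)
  have C: "pv (sem w prTok s) Pbad = 0 \<and>
      (\<exists>p. occ w (Suc (pv s PI)) (enc_nat p) \<and> pv (sem w prTok s) PX = Suc (pv s PI) + length (enc_nat p)) \<or>
    pv (sem w prTok s) Pbad = 1 \<and> (\<forall>p. \<not> occ w (Suc (pv s PI)) (enc_nat p))"
    using sem_chktok[OF g1, of PX] v1 unfolding e by auto
  have "sat w (Exec prTok (okJ PX)) s \<longleftrightarrow> pv (sem w prTok s) Pbad = 0 \<and> pv (sem w prTok s) PX = pv s PJ"
    using sat_okJ[OF g] J by simp
  also have "\<dots> \<longleftrightarrow> (\<exists>p. occ w (Suc (pv s PI)) (enc_nat p) \<and> pv s PJ = Suc (pv s PI) + length (enc_nat p))"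
    using C occ_enc_nat_inj[of w "Suc (pv s PI)"] by (metis zero_neq_one)
  finally show ?thesis .
qed

lemma sem_prI:
  assumes "good w s" "pv s PI < length w"
  shows "good w (sem w prI s)" "pv (sem w prI s) PX = Suc (pv s PI)" "pv (sem w prI s) PJ = pv s PJ"
    "pv (sem w prI s) Pbad = 0 \<longleftrightarrow> (\<exists>ps qs. occ w (Suc (pv s PI)) (enc_tuple ps @ enc_tuple qs))"
    "occ w (Suc (pv s PI)) (enc_tuple ps @ enc_tuple qs) \<Longrightarrow>
       pv (sem w prI s) PY = Suc (pv s PI) + length (enc_tuple ps) \<and>
       pv (sem w prI s) PW = Suc (pv s PI) + length (enc_tuple ps) + length (enc_tuple qs)"
proof -
  have g0: "good w (upd Pbad 0 s)" by (intro good_upd assms) auto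
  have l0: "pv (upd Pbad 0 s) PI < length w" using assms(2) by simp
  have e: "sem w prI s = sem w prXYW (upd Pbad 0 s)" by (simp add: prI_def)
  show "good w (sem w prI s)" by (rule good_sem[OF assms(1)]) auto
  show "pv (sem w prI s) PJ = pv s PJ" by (simp add: sem_frame)
  show "pv (sem w prI s) PX = Suc (pv s PI)" using sem_prXYW(1)[OF g0 l0] by (simp add: e)
  show "pv (sem w prI s) Pbad = 0 \<longleftrightarrow> (\<exists>ps qs. occ w (Suc (pv s PI)) (enc_tuple ps @ enc_tuple qs))"
    using sem_prXYW(2)[OF g0 l0] by (simp add: e)
  show "occ w (Suc (pv s PI)) (enc_tuple ps @ enc_tuple qs) \<Longrightarrow>
       pv (sem w prI s) PY = Suc (pv s PI) + length (enc_tuple ps) \<and>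
       pv (sem w prI s) PW = Suc (pv s PI) + length (enc_tuple ps) + length (enc_tuple qs)"
    using sem_prXYW(3)[OF g0 l0, of ps qs] by (simp add: e)
qed

lemma enc_tuple2_inj:
  "occ w i (enc_tuple ps @ enc_tuple qs) \<Longrightarrow> occ w i (enc_tuple ps' @ enc_tuple qs') \<Longrightarrow> ps = ps' \<and> qs = qs'"
  using occ_enc_tuple_inj[of w i ps ps'] occ_enc_tuple_inj[of w _ qs qs'] by auto

text \<open>The symbol at \<open>PI\<close> admits only atomic formulas. The machine finds one
  parse, and as tokens and tuples are prefix codes, any other formula at this position has the same
  arguments and thus the same end.\<close>

lemma sat_VAL:
  assumes "good w s" "symat w (pv s PI) \<notin> {Some SAnd, Some SOr, Some STil}"
  shows "sat w VAL s \<longleftrightarrow> valid w (pv s PI) (pv s PJ)"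
proof -
  let ?i = "pv s PI" and ?j = "pv s PJ"
  have V: "valid w ?i ?j \<longleftrightarrow> (\<exists>\<phi>. leaf \<phi> \<and> wf_fml \<phi> \<and> occ w ?i (enc \<phi>) \<and> ?j = ?i + length (enc \<phi>))"
  proof -
    have "leaf \<phi>" if "occ w ?i (enc \<phi>)" for \<phi>
      using that assms(2) by (cases \<phi>) auto
    then show ?thesis unfolding valid_def by blast
  qed
  consider (tok) "symat w ?i \<in> {Some SP, Some SNP}" | (inc) "symat w ?i = Some SInc"
    | (ci) "symat w ?i = Some SCI" | (other) "symat w ?i \<notin> {Some SP, Some SNP, Some SInc, Some SCI}" by blast
  then show ?thesis
  proof cases
    case tok
    then have l: "?i < length w" by (auto dest: symat_less)
    have "(\<exists>\<phi>. leaf \<phi> \<and> wf_fml \<phi> \<and> occ w ?i (enc \<phi>) \<and> ?j = ?i + length (enc \<phi>)) \<longleftrightarrow>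
      (\<exists>p. occ w (Suc ?i) (enc_nat p) \<and> ?j = Suc ?i + length (enc_nat p))" (is "?A \<longleftrightarrow> ?B")
    proof
      assume ?A
      then obtain \<phi> where "leaf \<phi>" "occ w ?i (enc \<phi>)" "?j = ?i + length (enc \<phi>)" by blast
      then show ?B using tok by (cases \<phi>) auto
    next
      assume ?B
      then obtain p where p: "occ w (Suc ?i) (enc_nat p)" "?j = Suc ?i + length (enc_nat p)" by blast
      show ?A
      proof (cases "symat w ?i = Some SP")
        case True
        then show ?thesis using p by (intro exI[of _ "Atom p"]) auto
      next
        case False
        then show ?thesis using p tok by (intro exI[of _ "NegAtom p"]) auto
      qed
    qed
    moreover have "sat w VAL s \<longleftrightarrow> sat w (Exec prTok (okJ PX)) s"
      using tok by (auto simp: VAL_def simp del: sat.simps(5))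
    ultimately show ?thesis unfolding V using sem_prTok[OF assms(1) l] by simp
  next
    case inc
    then have l: "?i < length w" by (auto dest: symat_less)
    note P = sem_prI[OF assms(1) l]
    have A: "sat w VAL s \<longleftrightarrow> pv (sem w prI s) Pbad = 0 \<and> pv (sem w prI s) PW = ?j \<and> sat w (lenf PX PY) (sem w prI s)"
      using inc sat_okJ[OF P(1)] P(3) by (auto simp: VAL_def)
    show ?thesis
    proof (cases "\<exists>ps qs. occ w (Suc ?i) (enc_tuple ps @ enc_tuple qs)")
      case True
      then obtain ps qs where o: "occ w (Suc ?i) (enc_tuple ps @ enc_tuple qs)" by blast
      have "sat w (lenf PX PY) (sem w prI s) \<longleftrightarrow> length ps = length qs"
        by (rule sat_lenf[OF P(1)]) (use P(2) P(5)[OF o] o in auto)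
      then have "sat w VAL s \<longleftrightarrow> ?j = Suc ?i + length (enc_tuple ps) + length (enc_tuple qs) \<and> length ps = length qs"
        using A P(4) P(5)[OF o] o by auto
      also have "\<dots> \<longleftrightarrow> valid w ?i ?j"
      proof
        assume "?j = Suc ?i + length (enc_tuple ps) + length (enc_tuple qs) \<and> length ps = length qs"
        then show "valid w ?i ?j" unfolding valid_def using inc o
          by (intro exI[of _ "Incl ps qs"]) auto
      next
        assume "valid w ?i ?j"
        then obtain \<phi> where f: "leaf \<phi>" "wf_fml \<phi>" "occ w ?i (enc \<phi>)" "?j = ?i + length (enc \<phi>)" unfolding V by blast
        then obtain ps' qs' where "\<phi> = Incl ps' qs'" using inc by (cases \<phi>) auto
        then show "?j = Suc ?i + length (enc_tuple ps) + length (enc_tuple qs) \<and> length ps = length qs"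
          using f enc_tuple2_inj[OF o, of ps' qs'] by auto
      qed
      finally show ?thesis .
    next
      case False
      have "\<not> valid w ?i ?j"
      proof
        assume "valid w ?i ?j"
        then obtain \<phi> where f: "leaf \<phi>" "occ w ?i (enc \<phi>)" unfolding V by blast
        then show False using inc False by (cases \<phi>) auto
      qed
      then show ?thesis using A P(4) False by auto
    qed
  next
    case ci
    then have l: "?i < length w" by (auto dest: symat_less)
    note P = sem_prI[OF assms(1) l]
    let ?s = "sem w prI s"
    have e: "sem w prC s = sem w (chktup PW) ?s" by (simp add: prC_def)
    have g: "good w (sem w prC s)" by (rule good_sem[OF assms(1)]) auto
    have "pv (sem w prC s) PJ = ?j" by (simp add: sem_frame)
    then have A: "sat w VAL s \<longleftrightarrow> pv (sem w prC s) Pbad = 0 \<and> pv (sem w prC s) PW = ?j"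
      using ci sat_okJ[OF g] by (auto simp: VAL_def)
    have B: "pv (sem w prC s) Pbad = 0 \<longleftrightarrow> pv ?s Pbad = 0 \<and> (\<exists>rs. occ w (pv ?s PW) (enc_tuple rs))"
      unfolding e by (rule chktup_iff[OF P(1)]) auto
    show ?thesis
    proof (cases "\<exists>ps qs rs. occ w (Suc ?i) (enc_tuple ps @ enc_tuple qs @ enc_tuple rs)")
      case True
      then obtain ps qs rs where o: "occ w (Suc ?i) (enc_tuple ps @ enc_tuple qs @ enc_tuple rs)" by blast
      then have o2: "occ w (Suc ?i) (enc_tuple ps @ enc_tuple qs)" and
        o3: "occ w (pv ?s PW) (enc_tuple rs)" using P(5)[of ps qs] by auto
      have "pv (sem w prC s) PW = pv ?s PW + length (enc_tuple rs)"
        unfolding e by (rule sem_chktup_occ[OF P(1)]) (use o3 in auto)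
      moreover have "pv (sem w prC s) Pbad = 0" using B P(4) o2 o3 by blast
      ultimately have "sat w VAL s \<longleftrightarrow> ?j = Suc ?i + length (enc_tuple ps) + length (enc_tuple qs) + length (enc_tuple rs)"
        using A P(5)[OF o2] by auto
      also have "\<dots> \<longleftrightarrow> valid w ?i ?j"
      proof
        assume "?j = Suc ?i + length (enc_tuple ps) + length (enc_tuple qs) + length (enc_tuple rs)"
        then show "valid w ?i ?j" unfolding valid_def using ci o
          by (intro exI[of _ "CondIndep ps qs rs"]) auto
      next
        assume "valid w ?i ?j"
        then obtain \<phi> where f: "leaf \<phi>" "wf_fml \<phi>" "occ w ?i (enc \<phi>)" "?j = ?i + length (enc \<phi>)" unfolding V by blast
        then obtain ps' qs' rs' where \<phi>: "\<phi> = CondIndep ps' qs' rs'" using ci by (cases \<phi>) auto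
        then have "ps = ps' \<and> qs = qs'" using f enc_tuple2_inj[OF o2, of ps' qs'] by auto
        moreover from this have "rs = rs'" using \<phi> f o by (auto dest: occ_enc_tuple_inj)
        ultimately show "?j = Suc ?i + length (enc_tuple ps) + length (enc_tuple qs) + length (enc_tuple rs)"
          using f \<phi> by auto
      qed
      finally show ?thesis .
    next
      case False
      have "\<not> valid w ?i ?j"
      proof
        assume "valid w ?i ?j"
        then obtain \<phi> where f: "leaf \<phi>" "occ w ?i (enc \<phi>)" unfolding V by blast
        then obtain ps qs rs where "\<phi> = CondIndep ps qs rs" using ci by (cases \<phi>) auto
        then show False using f False by (auto simp del: occ_append)
      qed
      moreover have "pv (sem w prC s) Pbad \<noteq> 0"
      proof
        assume "pv (sem w prC s) Pbad = 0"
        then obtain ps qs rs where o: "occ w (Suc ?i) (enc_tuple ps @ enc_tuple qs)" "occ w (pv ?s PW) (enc_tuple rs)"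
          using B P(4) by blast
        then have "occ w (Suc ?i) (enc_tuple ps @ enc_tuple qs @ enc_tuple rs)" using P(5)[OF o(1)] by auto
        then show False using False by blast
      qed
      ultimately show ?thesis using A by auto
    qed
  next
    case other
    have "\<not> valid w ?i ?j"
    proof
      assume "valid w ?i ?j"
      then obtain \<phi> where f: "leaf \<phi>" "occ w ?i (enc \<phi>)" unfolding V by blast
      then show False using other by (cases \<phi>) auto
    qed
    moreover have "\<not> sat w VAL s" using other by (auto simp: VAL_def simp del: sat.simps(5))
    ultimately show ?thesis by simp
  qed
qed

definition team :: "st \<Rightarrow> nat set" where "team s = {r. fl s r}"
definition teamok :: "st \<Rightarrow> bool" where "teamok s \<longleftrightarrow> team s \<subseteq> {..<pv s PE}"

text \<open>All rows of the team lie below \<open>PE\<close>, so a quantifier up to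
  \<open>PE\<close> relativised to the team ranges over the whole team. Several rows may denote the
  same assignment, which does no harm since only the image under \<open>asg w\<close>
  matters.\<close>

lemma sat_EVAL:
  assumes g: "good w s" and ok: "teamok s" and lf: "leaf \<phi>" "wf_fml \<phi>" and o: "occ w (pv s PI) (enc \<phi>)"
  shows "sat w EVAL s \<longleftrightarrow> tsat (asg w ` team s) \<phi>"
proof -
  let ?i = "pv s PI"
  let ?L = "pv s PE"
  have bd: "j \<le> ?L" if "fl s j" for j
    using ok that by (auto simp: teamok_def team_def intro: less_imp_le)
  have ex: "(\<exists>j\<le>?L. fl s j \<and> P j) \<longleftrightarrow> (\<exists>j\<in>team s. P j)" for P
    using bd by (auto simp: team_def)
  have al: "(\<forall>j\<le>?L. \<not> fl s j \<or> P j) \<longleftrightarrow> (\<forall>j\<in>team s. P j)" for P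
    using bd by (auto simp: team_def)
  have il: "?i < length w" using occ_length[OF o] by (cases "enc \<phi>") auto
  have fle: "fl (sem w prX s) = fl s" "fl (sem w prXY s) = fl s" "fl (sem w prXYW s) = fl s"
    by (simp_all add: sem_fl)
  have gX: "good w (sem w prX s)" and gXY: "good w (sem w prXY s)" and gXYW: "good w (sem w prXYW s)"
    by (rule good_sem[OF g]; simp)+
  have PEe: "pv (sem w prX s) PE = ?L" "pv (sem w prXY s) PE = ?L" "pv (sem w prXYW s) PE = ?L"
    by (simp_all add: sem_frame)
  show ?thesis
  proof (cases \<phi>)
    case (Atom p)
    let ?t = "sem w prX s"
    have v: "sat w (valf PS PX) (upd Pix ?L (upd PS j ?t)) \<longleftrightarrow> asg w j p" if "j \<le> ?L" for j
    proof -
      have "good w (upd Pix ?L (upd PS j ?t))" using that PEe by (intro good_upd gX) auto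
      then show ?thesis using sat_valf[of w _ PS PX p] sem_prX[OF g il] Atom o by simp
    qed
    have "sat w EVAL s \<longleftrightarrow> (\<forall>j\<le>?L. \<not> fl s j \<or> asg w j p)"
      using Atom o v by (auto simp: EVAL_def fle PEe)
    then show ?thesis unfolding al using Atom by auto
  next
    case (NegAtom p)
    let ?t = "sem w prX s"
    have v: "sat w (valf PS PX) (upd Pix ?L (upd PS j ?t)) \<longleftrightarrow> asg w j p" if "j \<le> ?L" for j
    proof -
      have "good w (upd Pix ?L (upd PS j ?t))" using that PEe by (intro good_upd gX) auto
      then show ?thesis using sat_valf[of w _ PS PX p] sem_prX[OF g il] NegAtom o by simp
    qed
    have "sat w EVAL s \<longleftrightarrow> (\<forall>j\<le>?L. \<not> fl s j \<or> \<not> asg w j p)"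
      using NegAtom o v by (auto simp: EVAL_def fle PEe)
    then show ?thesis unfolding al using NegAtom by auto
  next
    case (Incl ps qs)
    let ?t = "sem w prXY s"
    have o2: "occ w (Suc ?i) (enc_tuple ps)" "occ w (Suc ?i + length (enc_tuple ps)) (enc_tuple qs)"
      and si: "symat w ?i = Some SInc" using o Incl by auto
    note P = sem_prXY[OF g il]
    have v: "sat w (eqt PS PX PT PY) (upd Pix ?L (upd PT k (upd Pix ?L (upd PS j ?t)))) \<longleftrightarrow>
        map (asg w j) ps = map (asg w k) qs" if "j \<le> ?L" "k \<le> ?L" for j k
    proof -
      have "good w (upd Pix ?L (upd PT k (upd Pix ?L (upd PS j ?t))))"
        using that PEe by (intro good_upd gXY) auto
      then show ?thesis using sat_eqt[of w _ PX PY ps qs PS PT] o2 P(1) P(3)[OF o2(1)] Incl lf(2) by simp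
    qed
    have "sat w EVAL s \<longleftrightarrow> sat w (All PS (Or (Neg (inT PS)) (Ex PT (And (inT PT) (eqt PS PX PT PY))))) ?t"
      using si by (simp add: EVAL_def del: sat_derived(2))
    also have "\<dots> \<longleftrightarrow> (\<forall>j\<le>?L. \<not> fl s j \<or> (\<exists>k\<le>?L. fl s k \<and> map (asg w j) ps = map (asg w k) qs))"
      using v by (simp add: fle PEe cong: conj_cong)
    also have "\<dots> \<longleftrightarrow> (\<forall>j\<in>team s. \<exists>k\<in>team s. map (asg w j) ps = map (asg w k) qs)"
      unfolding ex al ..
    finally show ?thesis using Incl by simp
  next
    case (CondIndep qs ps rs)
    let ?t = "sem w prXYW s"
    have o2: "occ w (Suc ?i) (enc_tuple qs)" "occ w (Suc ?i + length (enc_tuple qs)) (enc_tuple ps)"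
      "occ w (Suc ?i + length (enc_tuple qs) + length (enc_tuple ps)) (enc_tuple rs)"
      and si: "symat w ?i = Some SCI" using o CondIndep by auto
    note P = sem_prXYW[OF g il]
    have P3: "pv ?t PY = Suc ?i + length (enc_tuple qs)"
      "pv ?t PW = Suc ?i + length (enc_tuple qs) + length (enc_tuple ps)"
      using P(3)[of qs ps] o2 by auto
    let ?t2 = "\<lambda>j k. upd Pix ?L (upd PT k (upd Pix ?L (upd PS j ?t)))"
    let ?t3 = "\<lambda>j k l. upd Pix ?L (upd PU l (?t2 j k))"
    have v1: "sat w (eqt PS PY PT PY) (?t2 j k) \<longleftrightarrow> map (asg w j) ps = map (asg w k) ps"
      if "j \<le> ?L" "k \<le> ?L" for j k
    proof -
      have "good w (?t2 j k)" using that PEe by (intro good_upd gXYW) auto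
      then show ?thesis using sat_eqt[of w _ PY PY ps ps PS PT] o2 P3 by simp
    qed
    have v2: "sat w (eqt PU PY PS PY) (?t3 j k l) \<longleftrightarrow> map (asg w l) ps = map (asg w j) ps"
      "sat w (eqt PU PX PS PX) (?t3 j k l) \<longleftrightarrow> map (asg w l) qs = map (asg w j) qs"
      "sat w (eqt PU PW PT PW) (?t3 j k l) \<longleftrightarrow> map (asg w l) rs = map (asg w k) rs"
      if "j \<le> ?L" "k \<le> ?L" "l \<le> ?L" for j k l
    proof -
      have g3: "good w (?t3 j k l)" using that PEe by (intro good_upd gXYW) auto
      show "sat w (eqt PU PY PS PY) (?t3 j k l) \<longleftrightarrow> map (asg w l) ps = map (asg w j) ps"
        using sat_eqt[OF g3, of PY PY ps ps PU PS] o2 P3 by simp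
      show "sat w (eqt PU PX PS PX) (?t3 j k l) \<longleftrightarrow> map (asg w l) qs = map (asg w j) qs"
        using sat_eqt[OF g3, of PX PX qs qs PU PS] o2 P(1) by simp
      show "sat w (eqt PU PW PT PW) (?t3 j k l) \<longleftrightarrow> map (asg w l) rs = map (asg w k) rs"
        using sat_eqt[OF g3, of PW PW rs rs PU PT] o2 P3 by simp
    qed
    let ?B = "\<lambda>j k. map (asg w j) ps \<noteq> map (asg w k) ps \<or> (\<exists>l\<le>?L. fl s l \<and>
        map (asg w l) ps = map (asg w j) ps \<and> map (asg w l) qs = map (asg w j) qs \<and> map (asg w l) rs = map (asg w k) rs)"
    have "sat w EVAL s \<longleftrightarrow> sat w (All PS (All PT (Or (Neg (inT PS)) (Or (Neg (inT PT)) (Or (Neg (eqt PS PY PT PY))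
             (Ex PU (And (inT PU) (And (eqt PU PY PS PY) (And (eqt PU PX PS PX) (eqt PU PW PT PW)))))))))) ?t"
      using si by (simp add: EVAL_def del: sat_derived(2))
    also have "\<dots> \<longleftrightarrow> (\<forall>j\<le>?L. \<forall>k\<le>?L. \<not> fl s j \<or> \<not> fl s k \<or> ?B j k)"
      using v1 v2 by (simp add: fle PEe cong: conj_cong)
    also have "\<dots> \<longleftrightarrow> (\<forall>j\<le>?L. \<not> fl s j \<or> (\<forall>k\<le>?L. \<not> fl s k \<or> ?B j k))" by blast
    also have "\<dots> \<longleftrightarrow> (\<forall>j\<in>team s. \<forall>k\<in>team s. map (asg w j) ps \<noteq> map (asg w k) ps \<or> (\<exists>l\<in>team s.
        map (asg w l) ps = map (asg w j) ps \<and> map (asg w l) qs = map (asg w j) qs \<and> map (asg w l) rs = map (asg w k) rs))"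
      unfolding ex al ..
    also have "\<dots> \<longleftrightarrow> tsat (asg w ` team s) \<phi>"
    proof -
      have "map u (ps @ qs) = map t (ps @ qs) \<longleftrightarrow> map u ps = map t ps \<and> map u qs = map t qs"
        for u t :: "nat \<Rightarrow> bool"
        by (simp del: map_eq_conv)
      then show ?thesis
        unfolding CondIndep tsat.simps by (simp only: ball_simps bex_simps imp_conv_disj conj_assoc)
    qed
    finally show ?thesis .
  qed (use lf in auto)
qed

section \<open>Teams as sets of numbers\<close>

definition eqon :: "nat set \<Rightarrow> (nat \<Rightarrow> bool) \<Rightarrow> (nat \<Rightarrow> bool) \<Rightarrow> bool" where
  "eqon V s t \<longleftrightarrow> (\<forall>p\<in>V. s p = t p)"

lemma eqon_sym: "eqon V s t \<Longrightarrow> eqon V t s"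
  by (auto simp: eqon_def)

text \<open>Equality of the two teams after restriction to \<open>V\<close>, expressed without
  restricting any assignment.\<close>

definition agree :: "nat set \<Rightarrow> (nat \<Rightarrow> bool) set \<Rightarrow> (nat \<Rightarrow> bool) set \<Rightarrow> bool" where
  "agree V X Y \<longleftrightarrow> (\<forall>s\<in>X. \<exists>t\<in>Y. eqon V s t) \<and> (\<forall>t\<in>Y. \<exists>s\<in>X. eqon V s t)"

lemma agree_sym: "agree V X Y \<Longrightarrow> agree V Y X"
  unfolding agree_def by (blast intro: eqon_sym)

text \<open>Each part of \<open>Y\<close> collects the members with a counterpart in the given part
  of \<open>X\<close>; the parts may overlap, as disjunction allows.\<close>

lemma agree_split:
  assumes "agree V (X1 \<union> X2) Y"
  obtains Y1 Y2 where "Y = Y1 \<union> Y2" "agree V X1 Y1" "agree V X2 Y2"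
proof
  let ?Y = "\<lambda>X. {t\<in>Y. \<exists>s\<in>X. eqon V s t}"
  show "Y = ?Y X1 \<union> ?Y X2" using assms unfolding agree_def by blast
  show "agree V X1 (?Y X1)" "agree V X2 (?Y X2)" using assms unfolding agree_def by blast+
qed

lemma tsat_local_leaf:
  assumes "agree V X Y" "vars \<phi> \<subseteq> V" "leaf \<phi>" "tsat X \<phi>"
  shows "tsat Y \<phi>"
proof -
  have m: "map s ps = map t ps" if "eqon V s t" "set ps \<subseteq> V" for s t :: "nat \<Rightarrow> bool" and ps
    using that by (auto simp: eqon_def)
  show ?thesis
  proof (cases \<phi>)
    case (Atom p)
    then show ?thesis using assms unfolding agree_def eqon_def by fastforce
  next
    case (NegAtom p)
    then show ?thesis using assms unfolding agree_def eqon_def by fastforce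
  next
    case (Incl ps qs)
    then have V: "set ps \<subseteq> V" "set qs \<subseteq> V" using assms(2) by auto
    have "\<exists>t'\<in>Y. map s' ps = map t' qs" if s': "s' \<in> Y" for s'
    proof -
      obtain s where s: "s \<in> X" "eqon V s s'" using assms(1) s' unfolding agree_def by blast
      then obtain t where t: "t \<in> X" "map s ps = map t qs" using assms(4) Incl by auto
      then obtain t' where t': "t' \<in> Y" "eqon V t t'" using assms(1) unfolding agree_def by blast
      have "map s' ps = map t' qs" using m[OF s(2) V(1)] m[OF t'(2) V(2)] t(2) by metis
      then show ?thesis using t'(1) by blast
    qed
    then show ?thesis using Incl by simp
  next
    case (CondIndep qs ps rs)
    then have V: "set (ps @ qs) \<subseteq> V" "set rs \<subseteq> V" "set ps \<subseteq> V" using assms(2) by auto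
    have "\<exists>u'\<in>Y. map u' (ps @ qs) = map s' (ps @ qs) \<and> map u' rs = map t' rs"
      if s': "s' \<in> Y" and t': "t' \<in> Y" and eq: "map s' ps = map t' ps" for s' t'
    proof -
      obtain s where s: "s \<in> X" "eqon V s s'" using assms(1) s' unfolding agree_def by blast
      obtain t where t: "t \<in> X" "eqon V t t'" using assms(1) t' unfolding agree_def by blast
      have "map s ps = map t ps" using m[OF s(2) V(3)] m[OF t(2) V(3)] eq by metis
      then obtain u where u: "u \<in> X" "map u (ps @ qs) = map s (ps @ qs)" "map u rs = map t rs"
        using assms(4) s(1) t(1) unfolding CondIndep tsat.simps by blast
      obtain u' where u': "u' \<in> Y" "eqon V u u'" using assms(1) u unfolding agree_def by blast
      have "map u' (ps @ qs) = map s' (ps @ qs)" using m[OF u'(2) V(1)] m[OF s(2) V(1)] u(2) by metis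
      moreover have "map u' rs = map t' rs" using m[OF u'(2) V(2)] m[OF t(2) V(2)] u(3) by metis
      ultimately show ?thesis using u'(1) by blast
    qed
    then show ?thesis unfolding CondIndep tsat.simps by blast
  qed (use assms in auto)
qed

lemma tsat_local_leaf_iff: "agree V X Y \<Longrightarrow> vars \<phi> \<subseteq> V \<Longrightarrow> leaf \<phi> \<Longrightarrow> tsat X \<phi> \<longleftrightarrow> tsat Y \<phi>"
  using tsat_local_leaf agree_sym by blast

text \<open>Disjunction is the case where the team changes: \<open>agree_split\<close> carries a
  split of one team over to the other. By symmetry of \<open>agree\<close> one direction is enough,
  while negation needs the equivalence as induction hypothesis.\<close>

lemma tsat_local: "agree V X Y \<Longrightarrow> vars \<phi> \<subseteq> V \<Longrightarrow> tsat X \<phi> \<longleftrightarrow> tsat Y \<phi>"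
proof (induction \<phi> arbitrary: X Y)
  case (Disj a b)
  have "tsat Y (Disj a b)" if ag: "agree V X Y" and ts: "tsat X (Disj a b)" for X Y
  proof -
    obtain X1 X2 where X: "X = X1 \<union> X2" "tsat X1 a" "tsat X2 b" using ts by auto
    obtain Y1 Y2 where Y: "Y = Y1 \<union> Y2" "agree V X1 Y1" "agree V X2 Y2"
      using ag unfolding X(1) by (rule agree_split)
    then show ?thesis using X Disj.IH(1)[of X1 Y1] Disj.IH(2)[of X2 Y2] Disj.prems(2) by auto
  qed
  then show ?case using Disj.prems(1) agree_sym by blast
next
  case (Conj a b)
  then show ?case using Conj.IH[OF Conj.prems(1)] by simp
next
  case (Tilde a)
  then show ?case using Tilde.IH[OF Tilde.prems(1)] by simp
qed (rule tsat_local_leaf_iff; simp)+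

lemma tuple_vars_occ: "occ w i (enc_tuple ps) \<Longrightarrow> p \<in> set ps \<Longrightarrow> \<exists>c. occ w c (enc_nat p)"
  using toks_occ_nth(2) by (metis in_set_conv_nth)

lemma vars_occ: "occ w i (enc \<phi>) \<Longrightarrow> p \<in> vars \<phi> \<Longrightarrow> \<exists>c. occ w c (enc_nat p)"
proof (induction \<phi> arbitrary: i)
  case (Conj a b)
  from Conj.prems(1) have "occ w (Suc i) (enc a)" "occ w (Suc i + length (enc a)) (enc b)" by auto
  then show ?case using Conj.IH Conj.prems(2) by auto
next
  case (Disj a b)
  from Disj.prems(1) have "occ w (Suc i) (enc a)" "occ w (Suc i + length (enc a)) (enc b)" by auto
  then show ?case using Disj.IH Disj.prems(2) by auto
qed (auto dest: tuple_vars_occ)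

text \<open>Set bit c iff a token of a true proposition occurs at position c. At most one token
  starts at each position, so bits set for one proposition do not affect another.\<close>

lemma row_exists:
  assumes "\<And>p. p \<in> V \<Longrightarrow> \<exists>c. occ w c (enc_nat p)"
  shows "\<exists>x<2 ^ length w. \<forall>p\<in>V. asg w x p = s p"
proof -
  let ?B = "{c. \<exists>p\<in>V. occ w c (enc_nat p) \<and> s p}"
  let ?bs = "map (\<lambda>c. c \<in> ?B) [0..<length w]"
  let ?x = "horner_sum of_bool 2 ?bs :: nat"
  have x: "?x < 2 ^ length w" using horner_sum_of_bool_2_less[of ?bs] by simp
  have bit: "odd (?x div 2 ^ c) \<longleftrightarrow> c < length w \<and> c \<in> ?B" for c
    by (subst bit_iff_odd[symmetric], subst bit_horner_sum_bit_iff) auto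
  have "asg w ?x p = s p" if p: "p \<in> V" for p
  proof
    assume "asg w ?x p"
    then obtain c where c: "occ w c (enc_nat p)" "c \<in> ?B" unfolding asg_def bit by blast
    then show "s p" using occ_enc_nat_inj by blast
  next
    assume sp: "s p"
    obtain c where c: "occ w c (enc_nat p)" using assms[OF p] by blast
    then have "c < length w" using occ_length[OF c] by (cases "enc_nat p") auto
    then show "asg w ?x p" unfolding asg_def bit using c sp p by blast
  qed
  then show ?thesis using x by blast
qed

lemma satisfiable_rows:
  assumes w: "w = enc \<phi>" and L: "2 ^ length w \<le> L"
  shows "satisfiable \<phi> \<longleftrightarrow> (\<exists>R. R \<subseteq> {..<L} \<and> R \<noteq> {} \<and> tsat (asg w ` R) \<phi>)"
proof
  have o: "occ w 0 (enc \<phi>)" unfolding w using occ_whole by blast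
  {
    assume "satisfiable \<phi>"
    then obtain X where X: "X \<noteq> {}" "tsat X \<phi>" unfolding satisfiable_def by blast
    \<comment> \<open>All rows that match some member of \<open>X\<close> on the variables; the
      image of \<open>R\<close> then agrees with \<open>X\<close> there.\<close>
    define R where "R = {x. x < L \<and> (\<exists>s\<in>X. \<forall>p\<in>vars \<phi>. asg w x p = s p)}"
    have ex: "\<exists>x\<in>R. \<forall>p\<in>vars \<phi>. asg w x p = s p" if "s \<in> X" for s
    proof -
      obtain x where "x < 2 ^ length w" "\<forall>p\<in>vars \<phi>. asg w x p = s p"
        using row_exists[of "vars \<phi>" w s] vars_occ[OF o] by blast
      then show ?thesis using that less_le_trans[OF _ L] unfolding R_def by (intro bexI[of _ x]) auto
    qed
    have "agree (vars \<phi>) X (asg w ` R)"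
      unfolding agree_def
    proof (intro conjI ballI)
      fix s assume "s \<in> X"
      then obtain x where "x \<in> R" "\<forall>p\<in>vars \<phi>. asg w x p = s p" using ex by blast
      then show "\<exists>t\<in>asg w ` R. eqon (vars \<phi>) s t"
        by (intro bexI[of _ "asg w x"]) (auto simp: eqon_def)
    next
      fix t assume "t \<in> asg w ` R"
      then obtain x s where "t = asg w x" "s \<in> X" "\<forall>p\<in>vars \<phi>. asg w x p = s p" unfolding R_def by blast
      then show "\<exists>s\<in>X. eqon (vars \<phi>) s t" by (intro bexI[of _ s]) (auto simp: eqon_def)
    qed
    then have "tsat (asg w ` R) \<phi>" using tsat_local X(2) by blast
    moreover have "R \<noteq> {}" using ex X(1) by blast
    ultimately show "\<exists>R. R \<subseteq> {..<L} \<and> R \<noteq> {} \<and> tsat (asg w ` R) \<phi>" by (intro exI[of _ R]) (auto simp: R_def)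
  }
  {
    assume "\<exists>R. R \<subseteq> {..<L} \<and> R \<noteq> {} \<and> tsat (asg w ` R) \<phi>"
    then obtain R where R: "R \<noteq> {}" "tsat (asg w ` R) \<phi>" by blast
    \<comment> \<open>The propositions with a token in the input: finitely many, as each position
      starts at most one token, and every row is false on all others.\<close>
    let ?D = "\<Union>c<length w. {p. occ w c (enc_nat p)}"
    have "finite {p. occ w c (enc_nat p)}" for c
    proof (cases "\<exists>p. occ w c (enc_nat p)")
      case True
      then obtain p where "occ w c (enc_nat p)" by blast
      then have "{p. occ w c (enc_nat p)} \<subseteq> {p}" using occ_enc_nat_inj by blast
      then show ?thesis by (rule finite_subset) simp
    qed simp
    then have D: "finite ?D" by blast
    have cl: "c < length w" if "occ w c (enc_nat p)" for c p
      using occ_length[OF that] by (cases "enc_nat p") auto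
    have "vars \<phi> \<subseteq> ?D" using vars_occ[OF o] cl by blast
    moreover have "team_on ?D (asg w ` R)" unfolding team_on_def asg_def using cl by blast
    ultimately show "satisfiable \<phi>" unfolding satisfiable_def using D R by blast
  }
qed

section \<open>Loops that choose the flags of each row\<close>

text \<open>The store when a loop over \<open>PS\<close> has settled the rows below \<open>i\<close>
  with outcome \<open>h\<close>.\<close>

definition rows :: "st \<Rightarrow> nat \<Rightarrow> (nat \<Rightarrow> bool \<times> bool) \<Rightarrow> st" where
  "rows s i h = s\<lparr>pv := (pv s)(PS := i), fl := (\<lambda>r. if r < i then fst (h r) else fl s r),
     gl := (\<lambda>r. if r < i then snd (h r) else gl s r)\<rparr>"

lemma rows_simps [simp]:
  "pv (rows s i h) p = (if p = PS then i else pv s p)"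
  "fl (rows s i h) r = (if r < i then fst (h r) else fl s r)"
  "gl (rows s i h) r = (if r < i then snd (h r) else gl s r)"
  by (simp_all add: rows_def)

lemma rows_step:
  assumes "i < pv s PE"
  shows "incp PS (wr PS (fst x) (snd x) (rows s i h)) = rows s (Suc i) (h(i := x))"
  using assms by (auto simp: incp_def wr_def rows_def upd_def fun_eq_iff less_Suc_eq)

text \<open>Choices made row by row by the same player amount to one choice of a function
  \<open>h\<close>. When row i is reached its flags are still the original ones, so the admissible
  pairs can be read off the initial store.\<close>

lemma wp_rows:
  assumes body: "\<And>Q m t. wp w b Q m t \<longleftrightarrow>
    (if m then \<exists>x\<in>C (fl t (pv t PS)) (gl t (pv t PS)). Q m (wr PS (fst x) (snd x) t)
     else \<forall>x\<in>C (fl t (pv t PS)) (gl t (pv t PS)). Q m (wr PS (fst x) (snd x) t))"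
  defines "outs \<equiv> \<lambda>s. {rows s (pv s PE) h | h. \<forall>r<pv s PE. h r \<in> C (fl s r) (gl s r)}"
  shows "wp w (For PS PE b) Q m s \<longleftrightarrow> (if m then \<exists>u\<in>outs s. Q m u else \<forall>u\<in>outs s. Q m u)"
proof -
  let ?L = "pv s PE"
  let ?F = "\<lambda>Q'. wp w b (\<lambda>m s. Q' m (incp PS s))"
  \<comment> \<open>\<open>h'\<close> extends the choices already made for the rows below
    \<open>i\<close> by admissible choices for the rest.\<close>
  define cond where "cond i h h' \<longleftrightarrow> (\<forall>r<i. h' r = h r) \<and> (\<forall>r. i \<le> r \<and> r < ?L \<longrightarrow> h' r \<in> C (fl s r) (gl s r))"
    for i h h'
  have key: "cond i h h' \<longleftrightarrow> (\<exists>x\<in>C (fl s i) (gl s i). cond (Suc i) (h(i := x)) h')" if "i < ?L" for i h h'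
  proof
    assume c: "cond i h h'"
    then show "\<exists>x\<in>C (fl s i) (gl s i). cond (Suc i) (h(i := x)) h'"
      using that by (intro bexI[of _ "h' i"]) (auto simp: cond_def less_Suc_eq)
  next
    assume "\<exists>x\<in>C (fl s i) (gl s i). cond (Suc i) (h(i := x)) h'"
    then obtain x where x: "x \<in> C (fl s i) (gl s i)" "cond (Suc i) (h(i := x)) h'" by blast
    have "h' i = x" using x(2) by (simp add: cond_def)
    moreover have "h' r = h r" if "r < i" for r
      using x(2) that less_SucI[OF that] by (auto simp: cond_def)
    moreover have "h' r \<in> C (fl s r) (gl s r)" if "i \<le> r" "r < ?L" for r
      using x that \<open>h' i = x\<close> by (cases "r = i") (auto simp: cond_def)
    ultimately show "cond i h h'" by (auto simp: cond_def)
  qed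
  have "(?F ^^ k) Q m (rows s i h) \<longleftrightarrow>
      (if m then \<exists>h'. cond i h h' \<and> Q m (rows s ?L h') else \<forall>h'. cond i h h' \<longrightarrow> Q m (rows s ?L h'))"
    if "i + k = ?L" for k i h
    using that
  proof (induction k arbitrary: i h)
    case 0
    \<comment> \<open>Only the rows below L enter this store, and on them \<open>h'\<close> agrees
      with \<open>h\<close>.\<close>
    have e: "rows s ?L h' = rows s ?L h" if "cond i h h'" for h'
      using that 0 by (auto simp: cond_def rows_def fun_eq_iff)
    have "cond i h h" using 0 by (auto simp: cond_def)
    moreover have "(?F ^^ 0) Q m (rows s i h) \<longleftrightarrow> Q m (rows s ?L h)" using 0 by simp
    moreover have "(\<exists>h'. cond i h h' \<and> Q m (rows s ?L h')) \<longleftrightarrow> Q m (rows s ?L h)"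
    proof
      assume "\<exists>h'. cond i h h' \<and> Q m (rows s ?L h')"
      then obtain h' where "cond i h h'" "Q m (rows s ?L h')" by blast
      then show "Q m (rows s ?L h)" using e[of h'] by simp
    qed (use \<open>cond i h h\<close> in blast)
    moreover have "(\<forall>h'. cond i h h' \<longrightarrow> Q m (rows s ?L h')) \<longleftrightarrow> Q m (rows s ?L h)"
    proof
      assume q: "Q m (rows s ?L h)"
      show "\<forall>h'. cond i h h' \<longrightarrow> Q m (rows s ?L h')"
      proof (intro allI impI)
        fix h' assume "cond i h h'"
        then show "Q m (rows s ?L h')" using q e[of h'] by simp
      qed
    qed (use \<open>cond i h h\<close> in blast)
    ultimately show ?case by presburger
  next
    case (Suc k)
    let ?C = "C (fl s i) (gl s i)"
    have i: "i < ?L" using Suc.prems by simp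
    have IH: "(?F ^^ k) Q m (rows s (Suc i) (h(i := x))) \<longleftrightarrow>
      (if m then \<exists>h'. cond (Suc i) (h(i := x)) h' \<and> Q m (rows s ?L h')
       else \<forall>h'. cond (Suc i) (h(i := x)) h' \<longrightarrow> Q m (rows s ?L h'))" for x
      by (rule Suc.IH) (use Suc.prems in simp)
    have "(?F ^^ Suc k) Q m (rows s i h) \<longleftrightarrow>
      wp w b (\<lambda>m s. (?F ^^ k) Q m (incp PS s)) m (rows s i h)" by simp
    also have "\<dots> \<longleftrightarrow> (if m then \<exists>x\<in>?C. (?F ^^ k) Q m (rows s (Suc i) (h(i := x)))
        else \<forall>x\<in>?C. (?F ^^ k) Q m (rows s (Suc i) (h(i := x))))"
      unfolding body by (simp add: rows_step[OF i])
    also have "\<dots> \<longleftrightarrow> (if m then \<exists>h'. cond i h h' \<and> Q m (rows s ?L h')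
        else \<forall>h'. cond i h h' \<longrightarrow> Q m (rows s ?L h'))"
      unfolding IH key[OF i] by (cases m; simp only: if_True if_False; blast)
    finally show ?case .
  qed
  note loop = this[of 0 ?L "\<lambda>_. (False,False)"]
  have "rows s 0 (\<lambda>_. (False,False)) = upd PS 0 s" by (simp add: rows_def upd_def)
  then have "wp w (For PS PE b) Q m s \<longleftrightarrow> (?F ^^ ?L) Q m (rows s 0 (\<lambda>_. (False,False)))" by simp
  also have "\<dots> \<longleftrightarrow> (if m then \<exists>u\<in>outs s. Q m u else \<forall>u\<in>outs s. Q m u)"
    using loop by (auto simp: cond_def outs_def simp del: funpow.simps)
  finally show ?thesis .
qed

section \<open>The evaluation game\<close>

text \<open>A row of the team goes to the left part, to the right part or to both, since the parts
  of a split need not be disjoint.\<close>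

definition lab :: com where
  "lab = For PS PE (Cond PS flagged (Choice (Wr PS True False) (Choice (Wr PS False True) (Wr PS True True)))
     (Wr PS False False))"

definition pickteam :: com where
  "pickteam = For PS PE (Choice (Wr PS True False) (Wr PS False False))"

definition right :: com where
  "right = For PS PE (Cond PS flagged2 (Wr PS True False) (Wr PS False False))"

definition labC :: "bool \<Rightarrow> bool \<Rightarrow> (bool \<times> bool) set" where
  "labC f g = (if f then {(True,False),(False,True),(True,True)} else {(False,False)})"

definition louts :: "st \<Rightarrow> st set" where
  "louts s = {rows s (pv s PE) h | h. \<forall>r<pv s PE. h r \<in> labC (fl s r) (gl s r)}"

definition gouts :: "st \<Rightarrow> st set" where
  "gouts s = {rows s (pv s PE) h | h. \<forall>r<pv s PE. h r \<in> {(True,False),(False,False)}}"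

lemma wp_lab: "wp w lab Q m s \<longleftrightarrow> (if m then \<exists>u\<in>louts s. Q m u else \<forall>u\<in>louts s. Q m u)"
  unfolding lab_def louts_def by (rule wp_rows) (auto simp: labC_def)

lemma wp_pickteam: "wp w pickteam Q m s \<longleftrightarrow> (if m then \<exists>u\<in>gouts s. Q m u else \<forall>u\<in>gouts s. Q m u)"
  unfolding pickteam_def gouts_def by (rule wp_rows) auto

lemma good_rows: "good w s \<Longrightarrow> good w (rows s (pv s PE) h)"
  by (auto simp: good_def)

lemma louts_team:
  assumes "teamok s" "u \<in> louts s"
  shows "teamok u" "team u \<union> {r. r < pv s PE \<and> gl u r} = team s"
proof -
  obtain h where h: "u = rows s (pv s PE) h" "\<And>r. r < pv s PE \<Longrightarrow> h r \<in> labC (fl s r) (gl s r)"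
    using assms(2) unfolding louts_def by blast
  have b: "r < pv s PE" if "fl s r" for r using assms(1) that by (auto simp: teamok_def team_def)
  show "teamok u" using b by (auto simp: teamok_def team_def h(1) split: if_splits)
  have "fl u r \<or> r < pv s PE \<and> gl u r \<longleftrightarrow> fl s r" for r
    using b[of r] h(2)[of r] by (cases "r < pv s PE") (auto simp: h(1) labC_def split: if_splits)
  then show "team u \<union> {r. r < pv s PE \<and> gl u r} = team s" by (auto simp: team_def)
qed

lemma louts_ex:
  assumes "teamok s" "R1 \<union> R2 = team s"
  shows "\<exists>u\<in>louts s. team u = R1 \<and> {r. r < pv s PE \<and> gl u r} = R2"
proof -
  let ?h = "\<lambda>r. (r \<in> R1, r \<in> R2)"
  let ?u = "rows s (pv s PE) ?h"
  have b: "r < pv s PE" if "fl s r" for r using assms(1) that by (auto simp: teamok_def team_def)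
  have R: "r \<in> R1 \<or> r \<in> R2 \<longleftrightarrow> fl s r" for r using assms(2) by (auto simp: team_def)
  have "?u \<in> louts s" unfolding louts_def using R by (auto simp: labC_def intro!: exI[of _ ?h])
  moreover have "team ?u = R1" "{r. r < pv s PE \<and> gl ?u r} = R2"
    using b R by (auto simp: team_def)
  ultimately show ?thesis by blast
qed

lemma louts_pv: "u \<in> louts s \<Longrightarrow> p \<noteq> PS \<Longrightarrow> pv u p = pv s p"
  by (auto simp: louts_def)

lemma louts_good: "good w s \<Longrightarrow> u \<in> louts s \<Longrightarrow> good w u"
  by (auto simp: louts_def good_rows)

lemma right_simps [simp]: "mods right = {PS}" "det right" "wfc right"
  by (auto simp: right_def)

lemma sem_right:
  assumes "good w s"
  shows "fl (sem w right s) r \<longleftrightarrow> (if r < pv s PE then gl s r else fl s r)"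
proof -
  let ?b = "Cond PS flagged2 (Wr PS True False) (Wr PS False False)"
  let ?P = "\<lambda>j (t::st). pv t PS = j \<and> (\<forall>r. fl t r \<longleftrightarrow> (if r < j then gl s r else fl s r)) \<and> (\<forall>r\<ge>j. gl t r = gl s r)"
  have "?P (pv s PE) (sem w (For PS PE ?b) s)"
  proof (rule For_inv[OF assms, where P = ?P])
    fix j t assume j: "j < pv s PE" and t: "?P j t" and
      fr: "\<And>p. p \<notin> insert PS (mods ?b) \<Longrightarrow> pv t p = pv s p"
    have "pv t PE = pv s PE" using fr by simp
    then show "?P (Suc j) (incp PS (sem w ?b t))"
      using j t by (auto simp: wr_def pv_incp less_Suc_eq)
  qed auto
  then show ?thesis by (simp add: right_def)
qed

definition left :: com where "left = Inc PI ;; copy PJ PM"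
definition rightc :: "com \<Rightarrow> com" where "rightc rt = rt ;; copy PI PM"
text \<open>Only the left segment is disputed: if the whole is the code of a formula and its first
  argument ends at \<open>PM\<close>, the rest is the code of the second.\<close>

definition chal :: com where "chal = left ;; flag Pph"

lemma branch_simps [simp]:
  "mods left = {PI,PJ,Pl4}" "det left" "wfc left" "nowr left"
  "mods (rightc rt) = mods rt \<union> {PI,Pl4}" "det (rightc rt) = det rt" "wfc (rightc rt) = wfc rt"
  "nowr (rightc rt) = nowr rt"
  "mods chal = {PI,PJ,Pl4,Pph}" "det chal" "wfc chal" "nowr chal"
  by (auto simp: left_def rightc_def chal_def)

lemma sem_left:
  assumes "good w s" "pv s PI < length w"
  shows "pv (sem w left s) PI = Suc (pv s PI)" "pv (sem w left s) PJ = pv s PM"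
proof -
  have i: "incp PI s = upd PI (Suc (pv s PI)) s" using assms goodD(3)[OF assms(1)] by (intro incp_lt) auto
  have g: "good w (upd PI (Suc (pv s PI)) s)" using assms goodD(3)[OF assms(1)] by (intro good_upd) auto
  show "pv (sem w left s) PJ = pv s PM" "pv (sem w left s) PI = Suc (pv s PI)"
    using sem_copy[OF g, of PJ PM] by (simp_all add: left_def i sem_frame)
qed

lemma sem_rightc:
  assumes "good w s" "det rt" "mods rt \<subseteq> {PS}"
  shows "pv (sem w (rightc rt) s) PI = pv s PM" "fl (sem w (rightc rt) s) = fl (sem w rt s)"
proof -
  have g: "good w (sem w rt s)" by (rule good_sem[OF assms(1)]) (use assms in auto)
  have m: "PM \<notin> mods rt" using assms(3) by auto
  show "pv (sem w (rightc rt) s) PI = pv s PM"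
    using sem_copy[OF g, of PI PM] m by (simp add: rightc_def sem_frame)
  show "fl (sem w (rightc rt) s) = fl (sem w rt s)" by (simp add: rightc_def sem_fl)
qed

lemma sem_chal:
  assumes "good w s" "pv s PI < length w"
  shows "pv (sem w chal s) PI = Suc (pv s PI)" "pv (sem w chal s) PJ = pv s PM" "pv (sem w chal s) Pph = 1"
proof -
  have g: "good w (sem w left s)" by (rule good_sem[OF assms(1)]) auto
  show "pv (sem w chal s) PI = Suc (pv s PI)" "pv (sem w chal s) PJ = pv s PM" "pv (sem w chal s) Pph = 1"
    using sem_left[OF assms] g by (simp_all add: chal_def sem_flag)
qed

text \<open>The player who claims that the current formula holds (the existential one iff Ppol is 0)
  guesses where the first subformula ends; the opponent goes on with one of the two subformulas
  or challenges the guess.\<close>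
definition binary :: "com \<Rightarrow> com \<Rightarrow> com" where
  "binary lb rt = Cond Ppol nz (Mode False) (Mode True) ;; pick PM ;; lb ;;
     Cond Ppol nz (Mode True) (Mode False) ;; Choice left (Choice (rightc rt) chal)"

text \<open>The claimant at s wins from t if his opponent is to move there.\<close>
definition cw :: "(bool \<Rightarrow> st \<Rightarrow> bool) \<Rightarrow> st \<Rightarrow> st \<Rightarrow> bool" where
  "cw Q s t \<longleftrightarrow> (Q (pv s Ppol \<noteq> 0) t \<longleftrightarrow> pv s Ppol = 0)"

text \<open>In terms of the claimant both polarities give the same condition: with
  \<open>Ppol\<close> set, quantifiers and connectives are dual, and so is the reading of the
  value.\<close>

lemma wp_binary:
  assumes g: "good w s" and rt: "det rt"
    and lb: "\<And>Q m t. wp w lb Q m t \<longleftrightarrow> (if m then \<exists>u\<in>Lb t. Q m u else \<forall>u\<in>Lb t. Q m u)"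
    and fr: "\<And>t u p. u \<in> Lb t \<Longrightarrow> p \<noteq> PS \<Longrightarrow> pv u p = pv t p"
    and gd: "\<And>t u. good w t \<Longrightarrow> u \<in> Lb t \<Longrightarrow> good w u"
  shows "(wp w (binary lb rt) Q m s \<longleftrightarrow> pv s Ppol = 0) \<longleftrightarrow>
    (\<exists>M\<le>pv s PE. \<exists>u\<in>Lb (upd Pix (pv s PE) (upd PM M s)).
       cw Q s (sem w left u) \<and> cw Q s (sem w (rightc rt) u) \<and> cw Q s (sem w chal u))"
proof -
  define m' where "m' \<longleftrightarrow> pv s Ppol \<noteq> 0"
  let ?s = "\<lambda>M. upd Pix (pv s PE) (upd PM M s)"
  let ?R = "wp w (Cond Ppol nz (Mode True) (Mode False) ;; Choice left (Choice (rightc rt) chal)) Q"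
  have fin: "?R k u \<longleftrightarrow> (if m' then Q m' (sem w left u) \<or> Q m' (sem w (rightc rt) u) \<or> Q m' (sem w chal u)
     else Q m' (sem w left u) \<and> Q m' (sem w (rightc rt) u) \<and> Q m' (sem w chal u))"
    if "M \<le> pv s PE" "u \<in> Lb (?s M)" for M u k
  proof -
    have "good w (?s M)" using that(1) by (intro good_upd g) auto
    then have "good w u" using gd that(2) by blast
    moreover have "pv u Ppol = pv s Ppol" using fr[OF that(2)] by simp
    ultimately show ?thesis using rt by (auto simp: wp_det m'_def)
  qed
  have "wp w (binary lb rt) Q m s \<longleftrightarrow> wp w (pick PM) (wp w lb ?R) (\<not> m') s"
    using g by (simp add: binary_def m'_def)
  also have "\<dots> \<longleftrightarrow> (if \<not> m' then \<exists>M\<le>pv s PE. \<exists>u\<in>Lb (?s M). ?R (\<not> m') u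
      else \<forall>M\<le>pv s PE. \<forall>u\<in>Lb (?s M). ?R (\<not> m') u)"
    by (subst wp_pick) (auto simp: lb simp del: wp.simps)
  also have "\<dots> \<longleftrightarrow> (if \<not> m' then \<exists>M\<le>pv s PE. \<exists>u\<in>Lb (?s M).
        Q m' (sem w left u) \<and> Q m' (sem w (rightc rt) u) \<and> Q m' (sem w chal u)
      else \<forall>M\<le>pv s PE. \<forall>u\<in>Lb (?s M). Q m' (sem w left u) \<or> Q m' (sem w (rightc rt) u) \<or> Q m' (sem w chal u))"
    using fin by (cases m') (simp_all del: wp.simps cong: conj_cong)
  finally have *: "wp w (binary lb rt) Q m s \<longleftrightarrow> \<dots>" .
  show ?thesis
  proof (cases "pv s Ppol = 0")
    case True
    then have "\<not> m'" by (simp add: m'_def)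
    then show ?thesis using * True by (simp add: cw_def)
  next
    case False
    then have m: "m'" by (simp add: m'_def)
    show ?thesis unfolding * using False m by (simp add: cw_def)
  qed
qed

definition leafp :: com where
  "leafp = Cond Pph nz (Cond Ppol nz (ev VAL False) (ev VAL True)) (Cond Ppol nz (ev EVAL False) (ev EVAL True))"

text \<open>During a challenge a negation does not swap the roles, because a word encodes a formula
  iff it does so with a negation in front.\<close>

definition flip :: com where
  "flip = Cond Pph nz Skip (Cond Ppol nz (Zero Ppol) (flag Ppol))"

text \<open>During a challenge a disjunction is treated like a conjunction: both arguments must be
  codes, and there is no team to split.\<close>

definition step :: com where
  "step = Cond PI (isym STil) (Inc PI ;; flip)
    (Cond PI (isym SAnd) (binary Skip Skip)
    (Cond PI (isym SOr) (Cond Pph nz (binary Skip Skip) (binary lab right)) leafp))"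

lemma wp_binary_skip:
  assumes "good w s"
  shows "(wp w (binary Skip Skip) Q m s \<longleftrightarrow> pv s Ppol = 0) \<longleftrightarrow>
    (\<exists>M\<le>pv s PE. let u = upd Pix (pv s PE) (upd PM M s) in
       cw Q s (sem w left u) \<and> cw Q s (sem w (rightc Skip) u) \<and> cw Q s (sem w chal u))"
  using wp_binary[OF assms, of Skip Skip "\<lambda>t. {t}" Q m] by (simp add: Let_def)

lemma wp_leafp:
  assumes "good w s"
  shows "wp w leafp Q m s \<longleftrightarrow>
    (sat w (if pv s Pph \<noteq> 0 then VAL else EVAL) s \<longleftrightarrow> pv s Ppol = 0)"
  using assms by (auto simp: leafp_def wp_ev wff_VAL wff_EVAL)

section \<open>One round of the game\<close>

lemma valid_bounds: "valid w i j \<Longrightarrow> i < j \<and> j \<le> length w"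
proof -
  assume "valid w i j"
  then obtain \<phi> where "occ w i (enc \<phi>)" "j = i + length (enc \<phi>)" unfolding valid_def by blast
  then show ?thesis using occ_length[of w i "enc \<phi>"] by (cases "enc \<phi>") auto
qed

lemma valid_STil:
  assumes "symat w i = Some STil"
  shows "valid w i j \<longleftrightarrow> valid w (Suc i) j"
proof
  assume "valid w i j"
  then obtain \<phi> where f: "wf_fml \<phi>" "occ w i (enc \<phi>)" "j = i + length (enc \<phi>)" unfolding valid_def by blast
  then obtain a where "\<phi> = Tilde a" using assms by (cases \<phi>) auto
  then show "valid w (Suc i) j" using f unfolding valid_def by auto
next
  assume "valid w (Suc i) j"
  then obtain a where "wf_fml a" "occ w (Suc i) (enc a)" "j = Suc i + length (enc a)" unfolding valid_def by blast
  then show "valid w i j" using assms unfolding valid_def by (intro exI[of _ "Tilde a"]) auto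
qed

lemma valid_binary:
  assumes "symat w i = Some SAnd \<or> symat w i = Some SOr"
  shows "valid w i j \<longleftrightarrow> (\<exists>M. valid w (Suc i) M \<and> valid w M j)"
proof
  assume "valid w i j"
  then obtain \<phi> where f: "wf_fml \<phi>" "occ w i (enc \<phi>)" "j = i + length (enc \<phi>)" unfolding valid_def by blast
  then obtain a b where "\<phi> = Conj a b \<or> \<phi> = Disj a b" using assms by (cases \<phi>) auto
  then have "wf_fml a" "wf_fml b" "occ w (Suc i) (enc a)" "occ w (Suc i + length (enc a)) (enc b)"
    "j = Suc i + length (enc a) + length (enc b)" using f by auto
  then have "valid w (Suc i) (Suc i + length (enc a)) \<and> valid w (Suc i + length (enc a)) j"
    unfolding valid_def by blast
  then show "\<exists>M. valid w (Suc i) M \<and> valid w M j" by blast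
next
  assume "\<exists>M. valid w (Suc i) M \<and> valid w M j"
  then obtain a b where ab: "wf_fml a" "wf_fml b" "occ w (Suc i) (enc a)" "occ w (Suc i + length (enc a)) (enc b)"
    "j = Suc i + length (enc a) + length (enc b)" unfolding valid_def by blast
  show "valid w i j"
  proof (cases "symat w i = Some SAnd")
    case True
    then show ?thesis using ab unfolding valid_def by (intro exI[of _ "Conj a b"]) auto
  next
    case False
    then show ?thesis using ab assms unfolding valid_def by (intro exI[of _ "Disj a b"]) auto
  qed
qed

text \<open>The assumption on \<open>Q\<close> is the induction hypothesis of the game: it speaks of
  stores whose current segment starts further to the right.\<close>

lemma step_valid:
  assumes g: "good w s" and ph: "pv s Pph \<noteq> 0"
    and Q: "\<And>m t. good w t \<Longrightarrow> pv t Pph \<noteq> 0 \<Longrightarrow> pv s PI < pv t PI \<Longrightarrow> pv t PI \<le> length w \<Longrightarrow>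
      (Q m t \<longleftrightarrow> pv t Ppol = 0) \<longleftrightarrow> valid w (pv t PI) (pv t PJ)"
  shows "(wp w step Q m s \<longleftrightarrow> pv s Ppol = 0) \<longleftrightarrow> valid w (pv s PI) (pv s PJ)"
proof -
  let ?i = "pv s PI" and ?j = "pv s PJ"
  consider (til) "symat w ?i = Some STil" | (bin) "symat w ?i = Some SAnd \<or> symat w ?i = Some SOr"
    | (leaf) "symat w ?i \<notin> {Some SAnd, Some SOr, Some STil}" by blast
  then show ?thesis
  proof cases
    case til
    let ?t = "upd PI (Suc ?i) s"
    have l: "?i < length w" using til by (rule symat_less)
    have gt: "good w ?t" using l goodD(3)[OF g] by (intro good_upd g) auto
    have "wp w step Q m s = Q m ?t"
      using til ph gt by (simp add: step_def flip_def inc_symat[OF g til])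
    then show ?thesis using Q[of ?t m] gt ph l valid_STil[OF til] by simp
  next
    case bin
    then have l: "?i < length w" by (auto dest: symat_less)
    have e: "wp w step Q m s = wp w (binary Skip Skip) Q m s"
      using bin ph g by (auto simp: step_def)
    let ?u = "\<lambda>M. upd Pix (pv s PE) (upd PM M s)"
    have gu: "good w (?u M)" if "M \<le> pv s PE" for M using that by (intro good_upd g) auto
    have lu: "pv (?u M) PI < length w" for M using l by simp
    have L: "cw Q s (sem w left (?u M)) \<longleftrightarrow> valid w (Suc ?i) M" if M: "M \<le> pv s PE" for M
      using Q[of "sem w left (?u M)" "pv s Ppol \<noteq> 0"] good_sem[OF gu[OF M], of left] sem_left[OF gu[OF M] lu] l ph
      by (simp add: sem_frame cw_def)
    \<comment> \<open>The flag \<open>Pph\<close> is already set, so the challenge repeats the left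
      branch.\<close>
    have C: "cw Q s (sem w chal (?u M)) \<longleftrightarrow> valid w (Suc ?i) M" if M: "M \<le> pv s PE" for M
      using Q[of "sem w chal (?u M)" "pv s Ppol \<noteq> 0"] good_sem[OF gu[OF M], of chal] sem_chal[OF gu[OF M] lu] l ph
      by (simp add: sem_frame cw_def)
    \<comment> \<open>A guess may even lie to the left of \<open>PI\<close>. Outside this range
      nothing is known about the right branch, but there the left branch already refutes the
      guess.\<close>
    have R: "cw Q s (sem w (rightc Skip) (?u M)) \<longleftrightarrow> valid w M ?j"
      if M: "M \<le> pv s PE" "?i < M" "M \<le> length w" for M
      using Q[of "sem w (rightc Skip) (?u M)" "pv s Ppol \<noteq> 0"] good_sem[OF gu[OF M(1)], of "rightc Skip"]
        sem_rightc[OF gu[OF M(1)], of Skip] M ph by (simp add: sem_frame cw_def)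
    have "(wp w step Q m s \<longleftrightarrow> pv s Ppol = 0) \<longleftrightarrow> (\<exists>M\<le>pv s PE. valid w (Suc ?i) M \<and>
      cw Q s (sem w (rightc Skip) (?u M)))"
      unfolding e wp_binary_skip[OF g] Let_def using L C by (simp cong: conj_cong)
    also have "\<dots> \<longleftrightarrow> (\<exists>M. valid w (Suc ?i) M \<and> valid w M ?j)"
    proof -
      have "M \<le> pv s PE \<and> ?i < M \<and> M \<le> length w" if "valid w (Suc ?i) M" for M
        using valid_bounds[OF that] goodD(3)[OF g] by simp
      then show ?thesis using R by metis
    qed
    finally show ?thesis using valid_binary[OF bin] by simp
  next
    case leaf
    then have "wp w step Q m s = wp w leafp Q m s" by (simp add: step_def)
    then show ?thesis using wp_leafp[OF g] ph sat_VAL[OF g leaf] by (cases "pv s Ppol = 0") simp_all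
  qed
qed

text \<open>The challenge defeats every wrong boundary and fails against the right one, so the guess
  of \<open>M\<close> can be replaced by the true end of the first argument; what remains is the
  clause of team semantics.\<close>

lemma step_eval:
  assumes g: "good w s" and ok: "teamok s" and ph: "pv s Pph = 0"
    and \<phi>: "wf_fml \<phi>" "occ w (pv s PI) (enc \<phi>)" "pv s PJ = pv s PI + length (enc \<phi>)"
    and V: "\<And>m t. good w t \<Longrightarrow> pv t Pph \<noteq> 0 \<Longrightarrow> pv s PI < pv t PI \<Longrightarrow> pv t PI \<le> length w \<Longrightarrow>
      (Q m t \<longleftrightarrow> pv t Ppol = 0) \<longleftrightarrow> valid w (pv t PI) (pv t PJ)"
    and E: "\<And>m t \<psi>. good w t \<Longrightarrow> teamok t \<Longrightarrow> pv t Pph = 0 \<Longrightarrow> wf_fml \<psi> \<Longrightarrow> occ w (pv t PI) (enc \<psi>) \<Longrightarrow>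
      pv t PJ = pv t PI + length (enc \<psi>) \<Longrightarrow> pv s PI < pv t PI \<Longrightarrow> pv t PI \<le> length w \<Longrightarrow>
      (Q m t \<longleftrightarrow> pv t Ppol = 0) \<longleftrightarrow> tsat (asg w ` team t) \<psi>"
  shows "(wp w step Q m s \<longleftrightarrow> pv s Ppol = 0) \<longleftrightarrow> tsat (asg w ` team s) \<phi>"
proof -
  let ?i = "pv s PI" and ?j = "pv s PJ" and ?X = "asg w ` team s"
  have l: "?i < length w" using occ_length[OF \<phi>(2)] by (cases "enc \<phi>") auto
  let ?u = "\<lambda>M. upd Pix (pv s PE) (upd PM M s)"
  have gu: "good w (?u M)" if "M \<le> pv s PE" for M using that by (intro good_upd g) auto
  have tu: "team (?u M) = team s" "teamok (?u M)" for M using ok by (auto simp: team_def teamok_def)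
  have C: "cw Q s (sem w chal u) \<longleftrightarrow> valid w (Suc ?i) M"
    if u: "good w u" "\<And>p. p \<noteq> PS \<Longrightarrow> pv u p = pv (?u M) p" for M u
  proof -
    have "pv u PI < length w" using u(2)[of PI] l by simp
    then show ?thesis
      using V[of "sem w chal u" "pv s Ppol \<noteq> 0"] good_sem[OF u(1), of chal] sem_chal[OF u(1)] l u(2)
      by (simp add: sem_frame cw_def)
  qed
  have L: "cw Q s (sem w left u) \<longleftrightarrow> tsat (asg w ` team u) a"
    if u: "good w u" "teamok u" "\<And>p. p \<noteq> PS \<Longrightarrow> pv u p = pv (?u M) p"
      and a: "wf_fml a" "occ w (Suc ?i) (enc a)" "M = Suc ?i + length (enc a)" for M u a
  proof -
    have "pv u PI < length w" using u(3)[of PI] l by simp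
    note S = sem_left[OF u(1) this]
    have t: "team (sem w left u) = team u" "teamok (sem w left u)"
      using u(2) by (simp_all add: team_def teamok_def sem_fl sem_frame)
    show ?thesis
      using E[of "sem w left u" a "pv s Ppol \<noteq> 0"] good_sem[OF u(1), of left] S l u(3) a t ph by (simp add: sem_frame cw_def)
  qed
  have R: "cw Q s (sem w (rightc rt) u) \<longleftrightarrow> tsat (asg w ` team (sem w rt u)) b"
    if u: "good w u" "teamok (sem w rt u)" "\<And>p. p \<noteq> PS \<Longrightarrow> pv u p = pv (?u M) p"
      and rt: "det rt" "mods rt \<subseteq> {PS}"
      and b: "wf_fml b" "occ w M (enc b)" "?j = M + length (enc b)" "?i < M" for M u b rt
  proof -
    note S = sem_rightc[OF u(1) rt]
    have fr: "PE \<notin> mods rt" "Pph \<notin> mods rt" "Ppol \<notin> mods rt" "PJ \<notin> mods rt" using rt(2) by auto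
    have t: "team (sem w (rightc rt) u) = team (sem w rt u)" "teamok (sem w (rightc rt) u)"
      using u(2) S(2) fr(1) by (simp_all add: team_def teamok_def sem_frame)
    have "M \<le> length w" using occ_length[OF b(2)] by simp
    moreover have "mods (rightc rt) \<inter> reserved = {}" using rt(2) by auto
    then have "good w (sem w (rightc rt) u)" by (rule good_sem[OF u(1)])
    ultimately show ?thesis
      using E[of "sem w (rightc rt) u" b "pv s Ppol \<noteq> 0"] S u(3) b t ph fr by (simp add: sem_frame cw_def)
  qed
  have lf: "(wp w step Q m s \<longleftrightarrow> pv s Ppol = 0) \<longleftrightarrow> tsat ?X \<phi>" if "leaf \<phi>"
  proof -
    have "symat w ?i \<notin> {Some SAnd, Some SOr, Some STil}" using that \<phi>(2) by (cases \<phi>) auto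
    then have "wp w step Q m s = wp w leafp Q m s" by (simp add: step_def)
    then have "wp w step Q m s \<longleftrightarrow> (tsat ?X \<phi> \<longleftrightarrow> pv s Ppol = 0)"
      unfolding wp_leafp[OF g] using ph sat_EVAL[OF g ok that \<phi>(1,2)] by simp
    then show ?thesis by (cases "pv s Ppol = 0") simp_all
  qed
  show ?thesis
  proof (cases \<phi>)
    case (Tilde a)
    then have til: "symat w ?i = Some STil" using \<phi> by simp
    \<comment> \<open>Flipping \<open>Ppol\<close> while the value stays the same negates the
      comparison of the two, just as \<open>Tilde\<close> negates the truth value.\<close>
    let ?t = "upd Ppol (if pv s Ppol = 0 then 1 else 0) (upd PI (Suc ?i) s)"
    have g1: "good w (upd PI (Suc ?i) s)" using l goodD(3)[OF g] by (intro good_upd g) auto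
    have gt: "good w ?t" using goodD(5)[OF g] by (intro good_upd g1) auto
    have "wp w step Q m s = Q m ?t"
      using til ph g1 by (auto simp: step_def flip_def inc_symat[OF g til] sem_flag wp_det)
    moreover have "team ?t = team s" "teamok ?t" using ok by (auto simp: team_def teamok_def)
    ultimately show ?thesis using E[of ?t a m] gt ph l \<phi> Tilde by auto
  next
    case (Conj a b)
    then have sy: "symat w ?i = Some SAnd" and a: "wf_fml a" "occ w (Suc ?i) (enc a)"
      and b: "wf_fml b" "occ w (Suc ?i + length (enc a)) (enc b)" "?j = Suc ?i + length (enc a) + length (enc b)"
      using \<phi> by auto
    let ?M = "Suc ?i + length (enc a)"
    have M: "?M \<le> pv s PE" using occ_length[OF a(2)] goodD(3)[OF g] by simp
    \<comment> \<open>Formulas have a prefix code, so the code of \<open>a\<close> is the only one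
      that starts here.\<close>
    have va: "valid w (Suc ?i) M \<longleftrightarrow> M = ?M" for M
      unfolding valid_def using a occ_enc_inj by blast
    have e: "wp w step Q m s = wp w (binary Skip Skip) Q m s" using sy by (simp add: step_def)
    have "(wp w step Q m s \<longleftrightarrow> pv s Ppol = 0) \<longleftrightarrow> (\<exists>M\<le>pv s PE. M = ?M \<and>
       cw Q s (sem w left (?u M)) \<and> cw Q s (sem w (rightc Skip) (?u M)))"
      unfolding e wp_binary_skip[OF g] Let_def using C[OF gu] va by blast
    also have "\<dots> \<longleftrightarrow> tsat ?X a \<and> tsat ?X b"
      using M L[OF gu[OF M] tu(2) _ a, of ?M] R[of "?u ?M" Skip ?M b] gu[OF M] tu b by auto
    finally show ?thesis using Conj by simp
  next
    case (Disj a b)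
    then have sy: "symat w ?i = Some SOr" and a: "wf_fml a" "occ w (Suc ?i) (enc a)"
      and b: "wf_fml b" "occ w (Suc ?i + length (enc a)) (enc b)" "?j = Suc ?i + length (enc a) + length (enc b)"
      using \<phi> by auto
    let ?M = "Suc ?i + length (enc a)"
    have M: "?M \<le> pv s PE" using occ_length[OF a(2)] goodD(3)[OF g] by simp
    have va: "valid w (Suc ?i) M \<longleftrightarrow> M = ?M" for M
      unfolding valid_def using a occ_enc_inj by blast
    have e: "wp w step Q m s = wp w (binary lab right) Q m s" using sy ph g by (simp add: step_def)
    let ?R2 = "\<lambda>u. {r. r < pv s PE \<and> gl u r}"
    have "(wp w step Q m s \<longleftrightarrow> pv s Ppol = 0) \<longleftrightarrow> (\<exists>M\<le>pv s PE. \<exists>u\<in>louts (?u M).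
       cw Q s (sem w left u) \<and> cw Q s (sem w (rightc right) u) \<and>
       cw Q s (sem w chal u))"
      unfolding e by (rule wp_binary[OF g _ wp_lab louts_pv louts_good]) auto
    also have "\<dots> \<longleftrightarrow> (\<exists>M\<le>pv s PE. \<exists>u\<in>louts (?u M). M = ?M \<and>
       cw Q s (sem w left u) \<and> cw Q s (sem w (rightc right) u))"
      using C[OF louts_good[OF gu] louts_pv] va by blast
    also have "\<dots> \<longleftrightarrow> (\<exists>u\<in>louts (?u ?M). cw Q s (sem w left u) \<and>
       cw Q s (sem w (rightc right) u))"
      using M by blast
    also have "\<dots> \<longleftrightarrow> (\<exists>u\<in>louts (?u ?M). tsat (asg w ` team u) a \<and> tsat (asg w ` ?R2 u) b)"
    proof (rule bex_cong[OF refl])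
      fix u assume u: "u \<in> louts (?u ?M)"
      have gd: "good w u" using louts_good[OF gu[OF M] u] .
      have fr: "pv u p = pv (?u ?M) p" if "p \<noteq> PS" for p using louts_pv[OF u that] .
      note T = louts_team[OF tu(2) u]
      \<comment> \<open>The loop in \<open>right\<close> leaves the flags from \<open>PE\<close> on
        alone, but by \<open>T(1)\<close> none is set there.\<close>
      have "team (sem w right u) = ?R2 u"
        using T(1) fr[of PE] sem_right[OF gd] by (auto simp: team_def teamok_def)
      moreover have "teamok (sem w right u)"
        using calculation fr[of PE] by (auto simp: teamok_def sem_frame)
      ultimately show "cw Q s (sem w left u) \<and> cw Q s (sem w (rightc right) u)
        \<longleftrightarrow> tsat (asg w ` team u) a \<and> tsat (asg w ` ?R2 u) b"
        using L[OF gd T(1) fr a refl] R[of u right ?M b] gd fr b by auto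
    qed
    also have "\<dots> \<longleftrightarrow> tsat ?X \<phi>"
    proof
      assume "\<exists>u\<in>louts (?u ?M). tsat (asg w ` team u) a \<and> tsat (asg w ` ?R2 u) b"
      then obtain u where u: "u \<in> louts (?u ?M)" "tsat (asg w ` team u) a" "tsat (asg w ` ?R2 u) b" by blast
      have "team u \<union> ?R2 u = team s" using louts_team(2)[OF tu(2) u(1)] tu(1) by simp
      then have "?X = asg w ` team u \<union> asg w ` ?R2 u" by blast
      then show "tsat ?X \<phi>" unfolding Disj tsat.simps using u by blast
    next
      assume "tsat ?X \<phi>"
      then obtain Y Z where YZ: "?X = Y \<union> Z" "tsat Y a" "tsat Z b" unfolding Disj tsat.simps by blast
      \<comment> \<open>The split of assignments is pulled back to rows: a row goes to each part
        that contains its assignment.\<close>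
      let ?R1 = "{r\<in>team s. asg w r \<in> Y}" and ?R2' = "{r\<in>team s. asg w r \<in> Z}"
      have "?R1 \<union> ?R2' = team (?u ?M)" using YZ(1) tu(1) by auto
      from louts_ex[OF tu(2) this] obtain u where u: "u \<in> louts (?u ?M)" "team u = ?R1"
        "{r. r < pv (?u ?M) PE \<and> gl u r} = ?R2'" by blast
      moreover from u(3) have "?R2 u = ?R2'" by simp
      moreover have "asg w ` {r\<in>R. asg w r \<in> W} = W" if "W \<subseteq> asg w ` R" for R W
        using that by auto
      then have "asg w ` ?R1 = Y" "asg w ` ?R2' = Z" using YZ(1) by simp_all
      ultimately show "\<exists>u\<in>louts (?u ?M). tsat (asg w ` team u) a \<and> tsat (asg w ` ?R2 u) b"
        using YZ by metis
    qed
    finally show ?thesis .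
  qed (rule lf; simp)+
qed

section \<open>The main program\<close>

primrec game :: "sym list \<Rightarrow> nat \<Rightarrow> bool \<Rightarrow> st \<Rightarrow> bool" where
  "game w 0 = wp w step (\<lambda>_ _. False)"
| "game w (Suc k) = wp w step (\<lambda>m s. game w k m (incp Pit s))"

text \<open>As long as the guesses are right, each round halts or moves \<open>PI\<close> strictly
  to the right within the input, so the remaining rounds suffice; plays with a wrong guess are
  decided by another branch.\<close>

lemma game_valid:
  assumes "good w s" "pv s Pph \<noteq> 0" "pv s PI \<le> length w" "length w \<le> pv s PI + k"
  shows "(game w k m s \<longleftrightarrow> pv s Ppol = 0) \<longleftrightarrow> valid w (pv s PI) (pv s PJ)"
  using assms
proof (induction k arbitrary: m s)
  case 0
  \<comment> \<open>Here \<open>PI\<close> has reached the end of the input, no later start is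
    possible, and the assumption on the continuation holds vacuously.\<close>
  then show ?case unfolding game.simps by (intro step_valid) auto
next
  case (Suc k)
  show ?case unfolding game.simps
  proof (rule step_valid)
    fix m t assume t: "good w t" "pv t Pph \<noteq> 0" "pv s PI < pv t PI" "pv t PI \<le> length w"
    have "good w (incp Pit t)" by (rule good_incp[OF t(1)]) auto
    then show "(game w k m (incp Pit t) \<longleftrightarrow> pv t Ppol = 0) \<longleftrightarrow> valid w (pv t PI) (pv t PJ)"
      using Suc.IH[of "incp Pit t" m] t Suc.prems(4) by simp
  qed (use Suc in auto)
qed

lemma game_eval:
  assumes "good w s" "teamok s" "pv s Pph = 0" "wf_fml \<phi>" "occ w (pv s PI) (enc \<phi>)"
    "pv s PJ = pv s PI + length (enc \<phi>)" "length w \<le> pv s PI + k"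
  shows "(game w k m s \<longleftrightarrow> pv s Ppol = 0) \<longleftrightarrow> tsat (asg w ` team s) \<phi>"
  using assms
proof (induction k arbitrary: m s \<phi>)
  case 0
  then show ?case unfolding game.simps by (intro step_eval) auto
next
  case (Suc k)
  show ?case unfolding game.simps
  proof (rule step_eval)
    fix m t assume t: "good w t" "pv t Pph \<noteq> 0" "pv s PI < pv t PI" "pv t PI \<le> length w"
    have "good w (incp Pit t)" by (rule good_incp[OF t(1)]) auto
    then show "(game w k m (incp Pit t) \<longleftrightarrow> pv t Ppol = 0) \<longleftrightarrow> valid w (pv t PI) (pv t PJ)"
      using game_valid[of w "incp Pit t" k m] t Suc.prems(7) by simp
  next
    fix m t \<psi> assume t: "good w t" "teamok t" "pv t Pph = 0" "wf_fml \<psi>" "occ w (pv t PI) (enc \<psi>)"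
      "pv t PJ = pv t PI + length (enc \<psi>)" "pv s PI < pv t PI" "pv t PI \<le> length w"
    have "good w (incp Pit t)" by (rule good_incp[OF t(1)]) auto
    moreover have "team (incp Pit t) = team t" "teamok (incp Pit t)"
      using t(2) by (simp_all add: team_def teamok_def)
    ultimately show "(game w k m (incp Pit t) \<longleftrightarrow> pv t Ppol = 0) \<longleftrightarrow> tsat (asg w ` team t) \<psi>"
      using Suc.IH[of "incp Pit t" \<psi> m] t Suc.prems(7) by simp
  qed (use Suc in auto)
qed

text \<open>The clock \<open>Pit\<close> also stops plays in which a wrong guess moves
  \<open>PI\<close> back. A round more than the input length is played because \<open>PI\<close> may
  take the values 0 to n.\<close>

definition run :: com where
  "run = copy PJ Pn ;; For Pit Pn step ;; step ;; Halt False"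

lemma wp_run:
  assumes "good w s"
  shows "wp w run Q m s = game w (length w) m (upd Pit 0 (sem w (copy PJ Pn) s))"
proof -
  have "((\<lambda>Q'. wp w step (\<lambda>m s. Q' m (incp Pit s))) ^^ k) (game w 0) = game w k" for k
    by (induction k) simp_all
  moreover have "pv (sem w (copy PJ Pn) s) Pn = length w"
    using goodD(1)[OF assms] by (simp add: sem_frame)
  ultimately show ?thesis by (simp add: run_def wp_det del: sem.simps)
qed

section \<open>An exponential end mark\<close>

text \<open>The first increment lifts \<open>PE\<close> above the input length; n doublings follow.
  The value is copied to \<open>PJ\<close> because a loop that moves \<open>PE\<close> cannot have
  it as its limit.\<close>

definition extend :: com where
  "extend = Inc PE ;; For Pit Pn (copy PJ PE ;; For PK PJ (Inc PE))"

lemma extend_simps [simp]: "mods extend = {PE,Pit,PJ,PK,Pl4}" "det extend" "nowr extend" "wfc extend"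
  by (auto simp: extend_def)

lemma sem_double:
  assumes "good w s"
  defines "s' \<equiv> sem w (copy PJ PE ;; For PK PJ (Inc PE)) s"
  shows "good w s'" "pv s' PE = 2 * pv s PE"
proof -
  let ?t = "sem w (copy PJ PE) s"
  have gt: "good w ?t" by (rule good_sem[OF assms(1)]) auto
  have v: "pv ?t PJ = pv s PE" "pv ?t PE = pv s PE"
    using sem_copy[OF assms(1), of PJ PE] by (simp_all add: sem_frame)
  \<comment> \<open>Since this loop moves the reserved pointer \<open>PE\<close>,
    \<open>For_inv\<close> does not apply and the rounds are counted directly.\<close>
  have "good w (((\<lambda>s. incp PK (sem w (Inc PE) s)) ^^ r) (upd PK 0 ?t)) \<and>
    pv (((\<lambda>s. incp PK (sem w (Inc PE) s)) ^^ r) (upd PK 0 ?t)) PE = pv s PE + r" for r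
  proof (induction r)
    case 0
    then show ?case using v by (auto intro: good_upd[OF gt])
  next
    case (Suc r)
    let ?u = "((\<lambda>s. incp PK (sem w (Inc PE) s)) ^^ r) (upd PK 0 ?t)"
    have "good w (incp PE ?u)" using Suc by (auto simp: good_def incp_def le_SucI)
    moreover have "pv (incp PE ?u) PE = pv s PE + Suc r" using Suc by (simp add: pv_incp)
    ultimately show ?case by (simp add: good_incp)
  qed
  from this[of "pv s PE"] show "good w s'" "pv s' PE = 2 * pv s PE"
    unfolding s'_def using v by simp_all
qed

lemma sem_extend:
  fixes w :: "sym list"
  defines "s' \<equiv> sem w extend (s0 w)"
  shows "good w s'" "pv s' PE = 2 ^ length w * Suc (length w)"
    "\<And>p. p \<notin> {Pn,PE,Pit,PJ,PK,Pl4} \<Longrightarrow> pv s' p = 0" "fl s' = (\<lambda>_. False)"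
proof -
  let ?t = "incp PE (s0 w)"
  let ?b = "copy PJ PE ;; For PK PJ (Inc PE)"
  have t: "good w ?t" "pv ?t PE = Suc (length w)" "pv ?t Pn = length w"
    by (auto simp: good_def s0_def incp_def)
  have "good w (((\<lambda>s. incp Pit (sem w ?b s)) ^^ r) (upd Pit 0 ?t)) \<and>
    pv (((\<lambda>s. incp Pit (sem w ?b s)) ^^ r) (upd Pit 0 ?t)) PE = 2 ^ r * Suc (length w)" for r
  proof (induction r)
    case 0
    then show ?case using t by (auto intro: good_upd)
  next
    case (Suc r)
    let ?u = "((\<lambda>s. incp Pit (sem w ?b s)) ^^ r) (upd Pit 0 ?t)"
    show ?case using Suc sem_double[of w ?u] by (simp add: good_incp del: sem.simps)
  qed
  from this[of "length w"] show "good w s'" "pv s' PE = 2 ^ length w * Suc (length w)"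
    unfolding s'_def extend_def using t(3) by simp_all
  show "pv s' p = 0" if "p \<notin> {Pn,PE,Pit,PJ,PK,Pl4}" for p
    using that unfolding s'_def by (subst sem_frame) (auto simp: s0_def)
  show "fl s' = (\<lambda>_. False)" unfolding s'_def by (simp add: sem_fl s0_def)
qed

text \<open>Once the team is guessed, the opponent may doubt that it is non-empty, that the input is
  the code of a formula, or that the team satisfies it. His second option allows the evaluation game
  to presuppose a correct code.\<close>

definition main :: com where
  "main = extend ;; pickteam ;; Mode False ;;
     Choice (ev (Ex PS (inT PS)) True) (Choice (flag Pph ;; run) run)"

lemma gouts_team:
  assumes "fl s = (\<lambda>_. False)"
  shows "{team u | u. u \<in> gouts s} = {R. R \<subseteq> {..<pv s PE}}"
proof (intro equalityI subsetI)
  fix R assume "R \<in> {R. R \<subseteq> {..<pv s PE}}"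
  then have "R = team (rows s (pv s PE) (\<lambda>r. (r \<in> R, False)))" using assms by (auto simp: team_def)
  moreover have "rows s (pv s PE) (\<lambda>r. (r \<in> R, False)) \<in> gouts s" unfolding gouts_def by blast
  ultimately show "R \<in> {team u | u. u \<in> gouts s}" by blast
next
  fix R assume "R \<in> {team u | u. u \<in> gouts s}"
  then show "R \<in> {R. R \<subseteq> {..<pv s PE}}" using assms
    by (auto simp: gouts_def team_def split: if_splits)
qed

lemma valid_whole: "valid w 0 (length w) \<longleftrightarrow> (\<exists>\<phi>. wf_fml \<phi> \<and> w = enc \<phi>)"
  unfolding valid_def using occ_whole[of w] by auto metis

lemma wp_main: "wp w main Q True (s0 w) \<longleftrightarrow> w \<in> SAT_lang"
proof -
  let ?n = "length w"
  define s1 where "s1 = sem w extend (s0 w)"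
  note S = sem_extend[where w = w, folded s1_def]
  let ?L = "pv s1 PE"
  have L: "2 ^ ?n \<le> ?L" unfolding S(2) by simp
  let ?A = "wp w (Choice (ev (Ex PS (inT PS)) True) (Choice (flag Pph ;; run) run)) Q False"
  have A: "?A u \<longleftrightarrow> team u \<noteq> {} \<and> (\<exists>\<phi>. wf_fml \<phi> \<and> w = enc \<phi> \<and> tsat (asg w ` team u) \<phi>)" if u: "u \<in> gouts s1" for u
  proof -
    have gu: "good w u" using u good_rows[OF S(1)] unfolding gouts_def by auto
    have pu: "pv u p = pv s1 p" if "p \<noteq> PS" for p using u that unfolding gouts_def by auto
    have "team u \<subseteq> {..<?L}" using gouts_team[OF S(4)] u by blast
    then have ok: "teamok u" using pu[of PE] by (simp add: teamok_def)
    have ne: "wp w (ev (Ex PS (inT PS)) True) Q False u \<longleftrightarrow> team u \<noteq> {}"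
      using ok by (auto simp: wp_ev team_def teamok_def simp del: ev.simps) (meson less_imp_le lessThan_iff mem_Collect_eq subsetD)
    let ?u1 = "upd Pph 1 u"
    have g1: "good w ?u1" using goodD(5)[OF gu] by (intro good_upd gu) auto
    let ?v1 = "upd Pit 0 (sem w (copy PJ Pn) ?u1)" and ?v = "upd Pit 0 (sem w (copy PJ Pn) u)"
    have gv1: "good w ?v1" and gv: "good w ?v"
      by (intro good_upd good_sem g1 gu; simp)+
    have v1: "pv ?v1 PI = 0" "pv ?v1 Ppol = 0" "pv ?v1 Pph = 1" "pv ?v1 PJ = ?n"
      using sem_copy[OF g1, of PJ Pn] goodD(1)[OF gu] pu S(3) by (simp_all add: sem_frame)
    have v: "pv ?v PI = 0" "pv ?v Ppol = 0" "pv ?v Pph = 0" "pv ?v PJ = ?n" "pv ?v PE = pv u PE"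
      using sem_copy[OF gu, of PJ Pn] goodD(1)[OF gu] pu S(3) by (simp_all add: sem_frame)
    have tv: "team ?v = team u" "teamok ?v" using ok v(5) by (simp_all add: team_def teamok_def sem_fl)
    have val: "wp w (flag Pph ;; run) Q False u \<longleftrightarrow> (\<exists>\<phi>. wf_fml \<phi> \<and> w = enc \<phi>)"
    proof -
      have "wp w (flag Pph ;; run) Q False u = game w ?n False ?v1"
        using gu g1 by (simp add: wp_det sem_flag wp_run)
      then show ?thesis using game_valid[OF gv1, of ?n False] v1 valid_whole[of w] by simp
    qed
    have evl: "wp w run Q False u \<longleftrightarrow> tsat (asg w ` team u) \<phi>" if "wf_fml \<phi>" "w = enc \<phi>" for \<phi>
    proof -
      have "occ w 0 (enc \<phi>)" using that(2) occ_whole by blast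
      then show ?thesis using wp_run[OF gu] game_eval[OF gv tv(2), of \<phi> ?n False] v that tv(1) by simp
    qed
    \<comment> \<open>If the input encodes no formula, the second option already wins for the
      opponent, so the value of the evaluation game is needed only on codes.\<close>
    have "?A u \<longleftrightarrow> team u \<noteq> {} \<and> (\<exists>\<phi>. wf_fml \<phi> \<and> w = enc \<phi>) \<and> wp w run Q False u"
      using ne val by simp
    then show ?thesis using evl by blast
  qed
  have "wp w main Q True (s0 w) \<longleftrightarrow> (\<exists>u\<in>gouts s1. ?A u)"
    by (simp add: main_def wp_det wp_pickteam s1_def del: wp.simps(7))
  also have "\<dots> \<longleftrightarrow> (\<exists>R\<in>{team u | u. u \<in> gouts s1}. R \<noteq> {} \<and> (\<exists>\<phi>. wf_fml \<phi> \<and> w = enc \<phi> \<and> tsat (asg w ` R) \<phi>))"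
    using A by blast
  also have "\<dots> \<longleftrightarrow> (\<exists>\<phi>. wf_fml \<phi> \<and> w = enc \<phi> \<and> (\<exists>R. R \<subseteq> {..<?L} \<and> R \<noteq> {} \<and> tsat (asg w ` R) \<phi>))"
    unfolding gouts_team[OF S(4)] by blast
  also have "\<dots> \<longleftrightarrow> (\<exists>\<phi>. wf_fml \<phi> \<and> w = enc \<phi> \<and> satisfiable \<phi>)"
    by (rule ex_cong1, intro conj_cong refl, rule satisfiable_rows[OF _ L, symmetric])
  also have "\<dots> \<longleftrightarrow> w \<in> SAT_lang" unfolding SAT_lang_def by blast
  finally show ?thesis .
qed

lemma mods_ev:
  "mods (ev VAL v) \<inter> {Pn,PE,Pit} = {}" "mods (ev EVAL v) \<inter> {Pn,PE,Pit} = {}"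
  by (simp_all add: VAL_def EVAL_def okJ_def lenf_def eqt_def valf_def Iff_def Or_def All_def inT_def)

lemma mods_step: "mods step \<inter> {Pn,PE,Pit} = {}"
  using mods_ev by (auto simp: step_def binary_def lab_def leafp_def flip_def pick_def)

lemma wfc_step: "wfc step"
  by (simp add: step_def binary_def lab_def leafp_def flip_def pick_def wfc_ev wff_VAL wff_EVAL)

lemma awf_step: "awf step"
  by (simp add: step_def binary_def lab_def leafp_def flip_def pick_def awf_ev wff_VAL wff_EVAL
      det_nomode nomode_awf)

lemma wfc_main: "wfc main"
  using wfc_step mods_step by (auto simp: main_def run_def pickteam_def inT_def)

lemma awf_main: "awf main"
  using awf_step by (simp add: main_def run_def pickteam_def awf_ev det_nomode nomode_awf)

text \<open>The inner loop is charged as many rounds as \<open>PE\<close> may be large, which is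
  exact because \<open>PJ\<close> is a copy of \<open>PE\<close>.\<close>

lemma grow_extend: "grow n extend n = 2 ^ n * Suc n"
proof -
  have s: "(Suc ^^ l) l' = l + l'" for l l' by (induction l) auto
  have d: "grow n (copy PJ PE ;; For PK PJ (Inc PE)) l = 2 * l" for l
    by (simp add: grow_id s)
  have "((\<lambda>l. grow n (copy PJ PE ;; For PK PJ (Inc PE)) l) ^^ k) l = 2 ^ k * l" for k l
    unfolding d by (induction k) auto
  then show ?thesis by (simp add: extend_def del: grow.simps(2)) (simp add: grow.simps(2)[of _ "Inc PE"])
qed

lemma grow_main: "grow n main n \<le> 2 ^ (2 * n + 2)"
proof -
  have 1: "PE \<notin> mods (pickteam ;; Mode False ;; Choice (ev (Ex PS (inT PS)) True) (Choice (flag Pph ;; run) run))"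
    using mods_step by (auto simp: pickteam_def run_def inT_def)
  have "grow n main n = 2 ^ n * Suc n"
    unfolding main_def grow.simps(2)[of n extend] grow_id[OF 1] by (rule grow_extend)
  also have "\<dots> \<le> 2 ^ n * 2 ^ n" by (intro mult_le_mono2) (simp add: Suc_leI)
  also have "\<dots> \<le> 2 ^ (2 * n + 2)" by (simp add: power_add[symmetric] mult_2)
  finally show ?thesis .
qed

theorem theorem5:
  shows "AEXPTIME_poly SAT_lang"
proof (rule AEXPTIME_polyI[where c = main and e = 2])
  show "simple main" by (simp add: main_def)
qed (rule wfc_main awf_main grow_main wp_main)+

end
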